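(* Let $\lambda>0$ and $\rho>0$ be fixed. As $\gamma\to+\infty$ the following limits hold in the space $Q_{\delta'}$: $$\varphi_{\rho,+}^{x_{1+},x_{2+}}\longrightarrow\chi_{(-\infty,0]}\,\phi\Big(\sqrt{\tfrac\lambda2}\,\tfrac\rho3,\tfrac{\lambda\rho}6,0\Big)\quad\text{in the weak topology of }Q_{\delta'},$$ $$\varphi_{\rho,-}^{\bar x,-\bar x}\longrightarrow\phi\Big(\sqrt{\tfrac\lambda2}\,\tfrac\rho2,\tfrac{\lambda\rho}4,0\Big)\quad\text{in the strong topology of }Q_{\delta'},$$ $$\varphi_{\rho,-}^{\bar x_{1+},\bar x_{2+}}\longrightarrow\chi_{[0,+\infty)}\,\phi\Big(\sqrt{\tfrac\lambda2}\,\rho,\tfrac{\lambda\rho}2,0\Big)\quad\text{in the strong topology of }Q_{\delta'},$$ where $\chi_I$ denotes the characteristic function of the set $I$.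
   Context: $Q_{\delta'}=H^1(\mathbb R^+)\oplus H^1(\mathbb R^-)$ with its natural Hilbert norm. For $A,B>0$, $C\in\mathbb R$, $\phi(A,B,C)$ denotes the function $x\mapsto A\operatorname{sech}(Bx-C)$. For $\lambda,\gamma,\omega>0$ define the following functions (stationary states of the focusing cubic NLS with nonlinearity coefficient $\lambda$ and an attractive delta prime interaction of strength $\gamma$ at the origin). (i) For $\omega>0$, $\psi_{\omega,+}^{x_{1+},x_{2+}}(x)=\sqrt{2\omega/\lambda}\,\operatorname{sech}(\sqrt\omega(x-x_{1+}))$ for $x<0$ and $\sqrt{2\omega/\lambda}\,\operatorname{sech}(\sqrt\omega(x-x_{2+}))$ for $x>0$, where $x_{i+}=\frac1{2\sqrt\omega}\log\frac{1+t_i}{1-t_i}$ ($i=1,2$) and $$t_1=\frac{1-\sqrt{1+\gamma^2\omega}+\sqrt{\gamma^2\omega-2+2\sqrt{1+\gamma^2\omega}}}{2\gamma\sqrt\omega},\quad t_2=\frac{-1+\sqrt{1+\gamma^2\omega}+\sqrt{\gamma^2\omega-2+2\sqrt{1+\gamma^2\omega}}}{2\gamma\sqrt\omega}.$$ (ii) For $\omega>4/\gamma^2$, $\psi_{\omega,-}^{\bar x,-\bar x}(x)=-\sqrt{2\omega/\lambda}\,\operatorname{sech}(\sqrt\omega(x-\bar x))$ for $x<0$ and $\sqrt{2\omega/\lambda}\,\operatorname{sech}(\sqrt\omega(x+\bar x))$ for $x>0$, with $\bar x=\frac1{2\sqrt\omega}\log\frac{\gamma\sqrt\omega+2}{\gamma\sqrt\omega-2}$.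 (iii) For $\omega>8/\gamma^2$, $\psi_{\omega,-}^{\bar x_{1+},\bar x_{2+}}(x)=\sqrt{2\omega/\lambda}\,\operatorname{sech}(\sqrt\omega(x-\bar x_{1+}))$ for $x<0$ and $-\sqrt{2\omega/\lambda}\,\operatorname{sech}(\sqrt\omega(x-\bar x_{2+}))$ for $x>0$, where $\bar x_{1+}=\frac1{2\sqrt\omega}\log\frac{1+\tau_1}{1-\tau_1}$, $\bar x_{2+}=-\frac1{2\sqrt\omega}\log\frac{1+\tau_2}{1-\tau_2}$ and $$\tau_1=\frac{1+\sqrt{1+\gamma^2\omega}+\sqrt{\gamma^2\omega-2-2\sqrt{1+\gamma^2\omega}}}{2\gamma\sqrt\omega},\quad \tau_2=\frac{1+\sqrt{1+\gamma^2\omega}-\sqrt{\gamma^2\omega-2-2\sqrt{1+\gamma^2\omega}}}{2\gamma\sqrt\omega}.$$ In each family the squared $L^2$-norm is a strictly increasing function of $\omega$, with range $(0,+\infty)$ for (i) and (ii) and $(\frac8{\gamma\lambda}(\sqrt2-1),+\infty)$ for (iii). For $\rho$ in this range, $\varphi_{\rho,+}^{x_{1+},x_{2+}}$, $\varphi_{\rho,-}^{\bar x,-\bar x}$, $\varphi_{\rho,-}^{\bar x_{1+},\bar x_{2+}}$ denote the member of the corresponding family ($\gamma,\lambda$ given) whose squared $L^2$-norm equals $\rho$; for (iii) this is defined for all $\gamma>\frac{8}{\lambda\rho}(\sqrt2-1)$.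
   Formalization: The second limit is proved with the extra factor sgn(x) and the third with an extra minus sign, since the families as defined are negative on x<0 (second) and on x>0 (third), so the printed positive limits are false. *)

theory Defs
  imports "HOL-Analysis.Analysis"
begin

section \<open>The space \<open>H\<^sup>1(\<real>\<^sup>+) \<oplus> H\<^sup>1(\<real>\<^sup>-)\<close>\<close>

text \<open>
  Elements of \<open>L\<^sup>2(I)\<close> and \<open>H\<^sup>1(I)\<close> are represented by complex-valued functions on the whole real
  line, of which only the restriction to \<open>I\<close> (up to null sets) matters. Sobolev functions are
  defined as in Brezis, Functional Analysis, Sobolev Spaces and Partial Differential Equations,
  Section 8.2, where the test functions on an open interval are those of class \<open>C\<^sup>1\<close> with compact
  support in it.
\<close>

definition test_funs :: "real set \<Rightarrow> (real \<Rightarrow> real) set" where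
  "test_funs I = {\<eta>. (\<forall>x. \<eta> differentiable (at x)) \<and> continuous_on UNIV (deriv \<eta>) \<and>
     compact (closure {x. \<eta> x \<noteq> 0}) \<and> closure {x. \<eta> x \<noteq> 0} \<subseteq> I}"

definition L2 :: "real set \<Rightarrow> (real \<Rightarrow> complex) set" where
  "L2 I = {f. f \<in> borel_measurable (lebesgue_on I) \<and>
     integrable (lebesgue_on I) (\<lambda>x. (cmod (f x))\<^sup>2)}"

definition L2_sqnorm :: "real set \<Rightarrow> (real \<Rightarrow> complex) \<Rightarrow> real" where
  "L2_sqnorm I f = (LINT x|lebesgue_on I. (cmod (f x))\<^sup>2)"

definition has_weak_deriv :: "real set \<Rightarrow> (real \<Rightarrow> complex) \<Rightarrow> (real \<Rightarrow> complex) \<Rightarrow> bool" where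
  "has_weak_deriv I f g \<longleftrightarrow> (\<forall>\<eta>\<in>test_funs I.
     (LINT x|lebesgue_on I. f x * of_real (deriv \<eta> x)) = - (LINT x|lebesgue_on I. g x * of_real (\<eta> x)))"

definition H1 :: "real set \<Rightarrow> (real \<Rightarrow> complex) set" where
  "H1 I = {f \<in> L2 I. \<exists>g\<in>L2 I. has_weak_deriv I f g}"

text \<open>The weak derivative is unique only almost everywhere on \<open>I\<close>, hence the choice operator.\<close>

definition weak_deriv :: "real set \<Rightarrow> (real \<Rightarrow> complex) \<Rightarrow> real \<Rightarrow> complex" where
  "weak_deriv I f = (SOME g. g \<in> L2 I \<and> has_weak_deriv I f g)"

definition H1_norm :: "real set \<Rightarrow> (real \<Rightarrow> complex) \<Rightarrow> real" where
  "H1_norm I f = sqrt (L2_sqnorm I f + L2_sqnorm I (weak_deriv I f))"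

text \<open>
  A pair in \<open>H\<^sup>1(\<real>\<^sup>+) \<oplus> H\<^sup>1(\<real>\<^sup>-)\<close> is represented by one function on the line, whose two components
  are its restrictions to the open half-lines; its value at 0 is immaterial.
\<close>

definition Q :: "(real \<Rightarrow> complex) set" where
  "Q = H1 {0<..} \<inter> H1 {..<0}"

definition Q_norm :: "(real \<Rightarrow> complex) \<Rightarrow> real" where
  "Q_norm f = sqrt ((H1_norm {0<..} f)\<^sup>2 + (H1_norm {..<0} f)\<^sup>2)"

text \<open>
  Bounded linear functionals; boundedness by the seminorm \<open>Q_norm\<close> forces them to respect almost
  everywhere equality, so they are exactly the elements of the topological dual of the quotient.
\<close>

definition Q_dual :: "((real \<Rightarrow> complex) \<Rightarrow> complex) set" where
  "Q_dual = {l. (\<forall>f\<in>Q. \<forall>g\<in>Q. l (\<lambda>x. f x + g x) = l f + l g) \<and>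
     (\<forall>c. \<forall>f\<in>Q. l (\<lambda>x. c * f x) = c * l f) \<and>
     (\<exists>K. \<forall>f\<in>Q. cmod (l f) \<le> K * Q_norm f)}"

definition tendsto_strongly_in_Q ::
    "('i \<Rightarrow> real \<Rightarrow> complex) \<Rightarrow> (real \<Rightarrow> complex) \<Rightarrow> 'i filter \<Rightarrow> bool" where
  "tendsto_strongly_in_Q u v F \<longleftrightarrow> v \<in> Q \<and> (\<forall>\<^sub>F i in F. u i \<in> Q) \<and>
     ((\<lambda>i. Q_norm (\<lambda>x. u i x - v x)) \<longlongrightarrow> 0) F"

definition tendsto_weakly_in_Q ::
    "('i \<Rightarrow> real \<Rightarrow> complex) \<Rightarrow> (real \<Rightarrow> complex) \<Rightarrow> 'i filter \<Rightarrow> bool" where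
  "tendsto_weakly_in_Q u v F \<longleftrightarrow> v \<in> Q \<and> (\<forall>\<^sub>F i in F. u i \<in> Q) \<and>
     (\<forall>l\<in>Q_dual. ((\<lambda>i. l (u i)) \<longlongrightarrow> l v) F)"


section \<open>Stationary states\<close>

definition sech :: "real \<Rightarrow> real" where
  "sech x = 1 / cosh x"

definition sech_profile :: "real \<Rightarrow> real \<Rightarrow> real \<Rightarrow> real \<Rightarrow> complex" where
  "sech_profile A B C = (\<lambda>x. of_real (A * sech (B * x - C)))"

text \<open>
  \<open>\<kappa>\<close> is the nonlinearity coefficient and \<open>\<gamma>\<close> the strength of the attractive delta prime
  interaction. The signs are part of the definition: \<open>psi_odd\<close> is an odd function, and \<open>psi_asym\<close> is
  positive on the left and negative on the right half-line. As the topologies of \<open>Q\<close> see these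
  signs, they must reappear in limits; a global phase factor could at best remove the one of
  \<open>psi_asym\<close>.
\<close>

definition t1 :: "real \<Rightarrow> real \<Rightarrow> real" where
  "t1 \<gamma> \<omega> = (1 - sqrt (1 + \<gamma>\<^sup>2 * \<omega>) + sqrt (\<gamma>\<^sup>2 * \<omega> - 2 + 2 * sqrt (1 + \<gamma>\<^sup>2 * \<omega>))) / (2 * \<gamma> * sqrt \<omega>)"

definition t2 :: "real \<Rightarrow> real \<Rightarrow> real" where
  "t2 \<gamma> \<omega> = (- 1 + sqrt (1 + \<gamma>\<^sup>2 * \<omega>) + sqrt (\<gamma>\<^sup>2 * \<omega> - 2 + 2 * sqrt (1 + \<gamma>\<^sup>2 * \<omega>))) / (2 * \<gamma> * sqrt \<omega>)"

definition centre1 :: "real \<Rightarrow> real \<Rightarrow> real" where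
  "centre1 \<gamma> \<omega> = 1 / (2 * sqrt \<omega>) * ln ((1 + t1 \<gamma> \<omega>) / (1 - t1 \<gamma> \<omega>))"

definition centre2 :: "real \<Rightarrow> real \<Rightarrow> real" where
  "centre2 \<gamma> \<omega> = 1 / (2 * sqrt \<omega>) * ln ((1 + t2 \<gamma> \<omega>) / (1 - t2 \<gamma> \<omega>))"

definition psi_plus :: "real \<Rightarrow> real \<Rightarrow> real \<Rightarrow> real \<Rightarrow> complex" where
  "psi_plus \<kappa> \<gamma> \<omega> = (\<lambda>x. of_real
     (if x < 0 then sqrt (2 * \<omega> / \<kappa>) * sech (sqrt \<omega> * (x - centre1 \<gamma> \<omega>))
      else sqrt (2 * \<omega> / \<kappa>) * sech (sqrt \<omega> * (x - centre2 \<gamma> \<omega>))))"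

definition odd_centre :: "real \<Rightarrow> real \<Rightarrow> real" where
  "odd_centre \<gamma> \<omega> = 1 / (2 * sqrt \<omega>) * ln ((\<gamma> * sqrt \<omega> + 2) / (\<gamma> * sqrt \<omega> - 2))"

definition psi_odd :: "real \<Rightarrow> real \<Rightarrow> real \<Rightarrow> real \<Rightarrow> complex" where
  "psi_odd \<kappa> \<gamma> \<omega> = (\<lambda>x. of_real
     (if x < 0 then - sqrt (2 * \<omega> / \<kappa>) * sech (sqrt \<omega> * (x - odd_centre \<gamma> \<omega>))
      else sqrt (2 * \<omega> / \<kappa>) * sech (sqrt \<omega> * (x + odd_centre \<gamma> \<omega>))))"

definition tau1 :: "real \<Rightarrow> real \<Rightarrow> real" where
  "tau1 \<gamma> \<omega> = (1 + sqrt (1 + \<gamma>\<^sup>2 * \<omega>) + sqrt (\<gamma>\<^sup>2 * \<omega> - 2 - 2 * sqrt (1 + \<gamma>\<^sup>2 * \<omega>))) / (2 * \<gamma> * sqrt \<omega>)"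

definition tau2 :: "real \<Rightarrow> real \<Rightarrow> real" where
  "tau2 \<gamma> \<omega> = (1 + sqrt (1 + \<gamma>\<^sup>2 * \<omega>) - sqrt (\<gamma>\<^sup>2 * \<omega> - 2 - 2 * sqrt (1 + \<gamma>\<^sup>2 * \<omega>))) / (2 * \<gamma> * sqrt \<omega>)"

definition asym_centre1 :: "real \<Rightarrow> real \<Rightarrow> real" where
  "asym_centre1 \<gamma> \<omega> = 1 / (2 * sqrt \<omega>) * ln ((1 + tau1 \<gamma> \<omega>) / (1 - tau1 \<gamma> \<omega>))"

definition asym_centre2 :: "real \<Rightarrow> real \<Rightarrow> real" where
  "asym_centre2 \<gamma> \<omega> = - (1 / (2 * sqrt \<omega>) * ln ((1 + tau2 \<gamma> \<omega>) / (1 - tau2 \<gamma> \<omega>)))"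

definition psi_asym :: "real \<Rightarrow> real \<Rightarrow> real \<Rightarrow> real \<Rightarrow> complex" where
  "psi_asym \<kappa> \<gamma> \<omega> = (\<lambda>x. of_real
     (if x < 0 then sqrt (2 * \<omega> / \<kappa>) * sech (sqrt \<omega> * (x - asym_centre1 \<gamma> \<omega>))
      else - sqrt (2 * \<omega> / \<kappa>) * sech (sqrt \<omega> * (x - asym_centre2 \<gamma> \<omega>))))"

text \<open>
  The members of the families with squared \<open>L\<^sup>2\<close>-norm \<open>\<rho>\<close>. The frequency is unique for all
  \<open>\<rho> > 0\<close> in the first two cases and for \<open>\<gamma> > 8 / (\<kappa> * \<rho>) * (sqrt 2 - 1)\<close> in the third one;
  otherwise \<open>THE\<close> is unspecified, which does not affect limits as \<open>\<gamma>\<close> tends to infinity.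
\<close>

definition phi_plus :: "real \<Rightarrow> real \<Rightarrow> real \<Rightarrow> real \<Rightarrow> complex" where
  "phi_plus \<kappa> \<rho> \<gamma> = psi_plus \<kappa> \<gamma> (THE \<omega>. 0 < \<omega> \<and> L2_sqnorm UNIV (psi_plus \<kappa> \<gamma> \<omega>) = \<rho>)"

definition phi_odd :: "real \<Rightarrow> real \<Rightarrow> real \<Rightarrow> real \<Rightarrow> complex" where
  "phi_odd \<kappa> \<rho> \<gamma> = psi_odd \<kappa> \<gamma> (THE \<omega>. 4 / \<gamma>\<^sup>2 < \<omega> \<and> L2_sqnorm UNIV (psi_odd \<kappa> \<gamma> \<omega>) = \<rho>)"

definition phi_asym :: "real \<Rightarrow> real \<Rightarrow> real \<Rightarrow> real \<Rightarrow> complex" where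
  "phi_asym \<kappa> \<rho> \<gamma> = psi_asym \<kappa> \<gamma> (THE \<omega>. 8 / \<gamma>\<^sup>2 < \<omega> \<and> L2_sqnorm UNIV (psi_asym \<kappa> \<gamma> \<omega>) = \<rho>)"

end

theory Submission
  imports Defs "HOL-Real_Asymp.Real_Asymp"
begin

text \<open>
  On each half-line every state is, up to sign, a soliton \<open>A * sech (s * x - C)\<close> with \<open>s = sqrt \<omega>\<close> and
  \<open>A = sqrt (2 / \<kappa>) * s\<close>; only the centres differ, and \<open>tanh C\<close> is one of the explicit
  parameters \<open>\<plusminus>t\<^sub>i\<close>, \<open>\<plusminus>\<tau>\<^sub>i\<close>, \<open>\<plusminus>2 / (\<gamma> * s)\<close>. As \<open>sech\<^sup>2\<close> has the primitive \<open>tanh\<close>, the squared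
  norm on the line is elementary. With \<open>S = sqrt (1 + \<gamma>\<^sup>2 * s\<^sup>2)\<close> it is

    \<^item> \<open>(2 / \<kappa>) * (2 * s + (S - 1) / \<gamma>)\<close> for the first family,
    \<^item> \<open>(4 / \<kappa>) * (s - 2 / \<gamma>)\<close> for the odd family,
    \<^item> \<open>(2 / \<kappa>) * (2 * s - (1 + S) / \<gamma>)\<close> for the third family,

  because the nested square roots in the parameters cancel in \<open>t\<^sub>2 - t\<^sub>1\<close> and in \<open>\<tau>\<^sub>1 + \<tau>\<^sub>2\<close>. Each
  expression is strictly increasing in \<open>s\<close>, so the squared norm \<open>\<rho>\<close> selects one frequency, and
  \<open>\<gamma> * s \<le> S \<le> 1 + \<gamma> * s\<close> shows that \<open>s\<close> is \<open>\<kappa> * \<rho> / 6\<close>, \<open>\<kappa> * \<rho> / 4\<close>, \<open>\<kappa> * \<rho> / 2\<close> up to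
  an error of order \<open>1 / \<gamma>\<close> (\<open>frequency_plus\<close>, \<open>frequency_odd\<close>, \<open>frequency_asym\<close>).

  Since \<open>\<gamma> * s\<close> tends to infinity, \<open>t\<^sub>1\<close>, \<open>\<tau>\<^sub>2\<close> and \<open>2 / (\<gamma> * s)\<close> tend to 0, while \<open>t\<^sub>2\<close> and \<open>\<tau>\<^sub>1\<close>
  tend to 1. Where the parameter tends to 0 the soliton becomes centred at the origin, and dominated
  convergence gives convergence in \<open>H\<^sup>1\<close> of the half-line (\<open>tendsto_L2_sech_profile\<close>). Where it
  tends to 1 the centre runs off to \<open>+\<infinity>\<close>. In the third family this is the centre of the left piece,
  of which only a tail of vanishing norm remains. In the first family it is the centre of the right
  piece, which escapes along its own half-line with its mass: its norm does not tend to 0, but it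
  converges weakly to 0.

  That weak limit is obtained without the Riesz representation
  (\<open>tendsto_Q_dual_escaping_profile\<close>). If a bounded functional stayed above \<open>\<epsilon>\<close> on bumps arbitrarily
  far out, one could pick \<open>n\<close> of them successively so far apart that they are almost orthogonal. Their
  sum, with phases that align the values of the functional, has norm of order \<open>sqrt n\<close>, but the
  functional is at least \<open>n * \<epsilon>\<close> on it.

  As the \<open>Q\<close>-norm refers to a chosen weak derivative, it is computable only because weak derivatives
  are unique almost everywhere (\<open>has_weak_deriv_unique_AE\<close>); this is the fundamental lemma of the
  calculus of variations for \<open>C\<^sup>1\<close> test functions. For the piecewise smooth functions at hand the
  weak derivative is then the classical one (\<open>H1_norm_classical\<close>).
\<close>

section \<open>The fundamental lemma of the calculus of variations\<close>

text \<open>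
  Compact intervals generate the Borel sets and are stable under intersection, and every Lebesgue
  set is a Borel set up to a null set; so all set integrals vanish.
\<close>

lemma AE_eq_0_if_interval_integrals_eq_0:
  fixes h :: "real \<Rightarrow> complex"
  assumes h: "integrable lebesgue h"
    and zero: "\<And>c d. (LINT x:{c..d}|lebesgue. h x) = 0"
  shows "AE x in lebesgue. h x = 0"
proof -
  have sub: "set_integrable lebesgue A h" if "A \<in> sets lebesgue" for A
    using h that unfolding set_integrable_def by (simp add: integrable_mult_indicator)
  have total: "(LINT x|lebesgue. h x) = 0"
  proof -
    have "(\<lambda>n. LINT x|lebesgue. indicator {- real n..real n} x *\<^sub>R h x) \<longlonglongrightarrow> (LINT x|lebesgue. h x)"
    proof (rule integral_dominated_convergence[where w = "\<lambda>x. cmod (h x)"])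
      show "AE x in lebesgue. (\<lambda>n. indicator {- real n..real n} x *\<^sub>R h x) \<longlonglongrightarrow> h x"
      proof (rule AE_I2, rule tendsto_eventually)
        fix x :: real
        obtain N :: nat where "\<bar>x\<bar> \<le> real N" using real_arch_simple by blast
        then show "\<forall>\<^sub>F n in sequentially. indicator {- real n..real n} x *\<^sub>R h x = h x"
          by (intro eventually_sequentiallyI[of N]) (auto simp: indicator_def)
      qed
    next
      show "(\<lambda>x. indicator {- real n..real n} x *\<^sub>R h x) \<in> borel_measurable lebesgue" for n
        using sub[of "{- real n..real n}"] unfolding set_integrable_def
        by (simp add: borel_measurable_integrable)
    qed (use h in \<open>auto simp: indicator_def intro: borel_measurable_integrable\<close>)
    moreover have "(LINT x|lebesgue. indicator {- real n..real n} x *\<^sub>R h x) = 0" for n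
      using zero[of "- real n" "real n"] by (simp add: set_lebesgue_integral_def)
    ultimately show ?thesis by (simp add: LIMSEQ_const_iff)
  qed
  have borel: "(LINT x:A|lebesgue. h x) = 0" if "A \<in> sets borel" for A
  proof -
    from that show ?thesis
    proof (induction rule: borel_set_induct)
      case (compl A)
      then have "A \<in> sets borel" "- A \<in> sets borel" by auto
      then have A: "A \<in> sets lebesgue" "- A \<in> sets lebesgue"
        by (auto simp del: borel_comp)
      have "(LINT x|lebesgue. h x) = (LINT x:(A \<union> - A)|lebesgue. h x)"
        by (simp add: set_lebesgue_integral_def)
      also have "\<dots> = (LINT x:A|lebesgue. h x) + (LINT x:- A|lebesgue. h x)"
        by (rule set_integral_Un) (use A sub in auto)
      finally show ?case using total compl by simp
    next
      case (union A)
      then have A: "A i \<in> sets lebesgue" for i by auto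
      have "(LINT x:(\<Union>i. A i)|lebesgue. h x) = (\<Sum>i. (LINT x:(A i)|lebesgue. h x))"
        by (rule lebesgue_integral_countable_add)
          (use union A sub in \<open>auto simp: disjoint_family_on_def\<close>)
      then show ?case using union by simp
    qed (use zero in \<open>auto simp: set_lebesgue_integral_def\<close>)
  qed
  interpret sigma_finite_measure "lebesgue :: real measure"
  proof
    obtain \<A> :: "real set set" where \<A>: "countable \<A>" "\<A> \<subseteq> sets lborel" "\<Union>\<A> = space lborel"
      and fin: "\<forall>a\<in>\<A>. emeasure lborel a \<noteq> \<infinity>"
      using lborel.sigma_finite_countable by blast
    show "\<exists>\<A>. countable \<A> \<and> \<A> \<subseteq> sets lebesgue \<and> \<Union>\<A> = space lebesgue \<and>
        (\<forall>a\<in>\<A>. emeasure lebesgue (a :: real set) \<noteq> \<infinity>)"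
    proof (intro exI conjI ballI)
      show "\<A> \<subseteq> sets lebesgue" using \<A>(2) sets_completionI_sets by blast
      show "emeasure lebesgue a \<noteq> \<infinity>" if "a \<in> \<A>" for a
      proof -
        have "a \<in> sets lborel" using that \<A>(2) by blast
        then have "emeasure lebesgue a = emeasure lborel a"
          by (simp only: emeasure_completion[OF sets_completionI_sets] main_part)
        then show ?thesis using fin that by simp
      qed
    qed (use \<A> in simp_all)
  qed
  show ?thesis
  proof (rule density_zero[OF h])
    fix A :: "real set" assume "A \<in> sets lebesgue"
    then obtain S N N' where A: "A = S \<union> N" "N \<subseteq> N'" "N' \<in> null_sets lborel" "S \<in> sets lborel"
      by (rule sets_completionE)
    have "AE x in lebesgue. x \<notin> N'"
      using A(3) AE_not_in null_sets_completionI by blast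
    then have "AE x in lebesgue. indicator A x *\<^sub>R h x = indicator S x *\<^sub>R h x"
      by eventually_elim (use A in \<open>auto simp: indicator_def\<close>)
    then have "(LINT x:A|lebesgue. h x) = (LINT x:S|lebesgue. h x)"
      unfolding set_lebesgue_integral_def
      using h \<open>A \<in> sets lebesgue\<close> A(4)
      by (intro integral_cong_AE) (auto intro!: borel_measurable_integrable integrable_mult_indicator)
    then show "(LINT x:A|lebesgue. h x) = 0" using borel A(4) by simp
  qed
qed

text \<open>
  Squaring the positive part removes its kink at 0, so it can serve to build \<open>C\<^sup>1\<close> bumps.
\<close>

lemma has_real_derivative_max_0_power2:
  "((\<lambda>t::real. (max 0 t)\<^sup>2) has_real_derivative 2 * max 0 t) (at t)"
proof (cases "t = 0")
  case False
  then consider "t > 0" | "t < 0" by linarith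
  then show ?thesis
  proof cases
    case 1
    have "((\<lambda>t::real. t\<^sup>2) has_real_derivative 2 * t) (at t)"
      by (auto intro!: derivative_eq_intros)
    then show ?thesis
      by (rule has_field_derivative_transform_within_open[of _ _ _ "{0<..}", THEN DERIV_cong]) (use 1 in auto)
  next
    case 2
    have "((\<lambda>t::real. 0) has_real_derivative 0) (at t)" by simp
    then show ?thesis
      by (rule has_field_derivative_transform_within_open[of _ _ _ "{..<0}", THEN DERIV_cong]) (use 2 in auto)
  qed
next
  case True
  have "(\<lambda>y::real. (max 0 y)\<^sup>2 / y) \<midarrow>0\<rightarrow> 0"
  proof (rule Lim_null_comparison)
    show "\<forall>\<^sub>F y in at 0. norm ((max 0 y)\<^sup>2 / y) \<le> \<bar>y\<bar>"
      by (rule eventuallyI) (auto simp: max_def power2_eq_square)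
    show "(\<lambda>y::real. \<bar>y\<bar>) \<midarrow>0\<rightarrow> 0" by (auto intro: tendsto_eq_intros)
  qed
  with True show ?thesis by (simp add: has_field_derivative_iff)
qed

text \<open>
  With a \<open>C\<^sup>1\<close> function \<open>w\<close> that is positive exactly on \<open>{a<..<b}\<close>, the bumps
  \<open>n * w / (1 + n * w)\<close> saturate at 1 there and keep their support in \<open>{a..b}\<close>.
\<close>

lemma test_funs_approximate_indicator:
  fixes a b :: real
  assumes "a \<le> b" "{a..b} \<subseteq> I"
  obtains \<eta> :: "nat \<Rightarrow> real \<Rightarrow> real" where "\<And>n. \<eta> n \<in> test_funs I"
    "\<And>n x. \<bar>\<eta> n x\<bar> \<le> indicator {a..b} x"
    "\<And>x. (\<lambda>n. \<eta> n x) \<longlonglongrightarrow> indicator {a<..<b} x"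
proof
  define w where "w = (\<lambda>x. (max 0 ((x - a) * (b - x)))\<^sup>2)"
  define w' where "w' = (\<lambda>x. 2 * max 0 ((x - a) * (b - x)) * (a + b - 2 * x))"
  define \<eta> where "\<eta> = (\<lambda>n x. real n * w x / (1 + real n * w x))"
  have w_nonneg: "w x \<ge> 0" for x by (simp add: w_def)
  have pos: "1 + real n * w x > 0" for n x using w_nonneg[of x] by (simp add: add_pos_nonneg)
  have dw: "(w has_real_derivative w' x) (at x)" for x
    unfolding w_def w'_def
    by (rule DERIV_cong, rule DERIV_chain2[OF has_real_derivative_max_0_power2])
      (auto intro!: derivative_eq_intros simp: algebra_simps)
  have d\<eta>: "(\<eta> n has_real_derivative real n * w' x / (1 + real n * w x)\<^sup>2) (at x)" for n x
    unfolding \<eta>_def using pos[of n x]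
    by (auto intro!: derivative_eq_intros dw simp: field_simps power2_eq_square)
  have w_eq_0: "w x = 0" if "x \<notin> {a<..<b}" for x
  proof -
    have "(x - a) * (b - x) \<le> 0"
      using that \<open>a \<le> b\<close> by (auto simp: mult_le_0_iff)
    then show ?thesis by (auto simp: w_def max_def)
  qed
  have w_pos: "w x > 0" if "x \<in> {a<..<b}" for x
    using that by (auto simp: w_def max_def not_le)
  have \<eta>_eq_0: "\<eta> n x = 0" if "x \<notin> {a..b}" for n x
    using w_eq_0[of x] that by (auto simp: \<eta>_def)
  have supp: "closure {x. \<eta> n x \<noteq> 0} \<subseteq> {a..b}" for n
  proof (rule closure_minimal[OF _ closed_atLeastAtMost], rule subsetI)
    fix x assume "x \<in> {x. \<eta> n x \<noteq> 0}"
    then show "x \<in> {a..b}" using \<eta>_eq_0[of x n] by (cases "x \<in> {a..b}") simp_all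
  qed
  show "\<eta> n \<in> test_funs I" for n
  proof -
    have "deriv (\<eta> n) = (\<lambda>x. real n * w' x / (1 + real n * w x)\<^sup>2)"
      by (rule ext, rule DERIV_imp_deriv, rule d\<eta>)
    moreover have "continuous_on UNIV w" "continuous_on UNIV w'"
      unfolding w_def w'_def by (intro continuous_intros)+
    moreover have "(1 + real n * w x)\<^sup>2 \<noteq> 0" for x
      using pos[of n x] by simp
    ultimately have "continuous_on UNIV (deriv (\<eta> n))"
      by (simp only:) (intro continuous_intros ballI; assumption)
    moreover have "compact (closure {x. \<eta> n x \<noteq> 0})"
      using supp[of n] by (meson bounded_closed_interval bounded_subset closed_closure compact_eq_bounded_closed)
    ultimately show ?thesis
      using d\<eta> supp[of n] assms(2) unfolding test_funs_def
      by (auto simp: real_differentiable_def)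
  qed
  show "\<bar>\<eta> n x\<bar> \<le> indicator {a..b} x" for n x
  proof (cases "x \<in> {a..b}")
    case True
    then show ?thesis using pos[of n x] w_nonneg[of x] by (simp add: \<eta>_def abs_of_nonneg)
  next
    case False
    then show ?thesis using \<eta>_eq_0[of x] by simp
  qed
  show "(\<lambda>n. \<eta> n x) \<longlonglongrightarrow> indicator {a<..<b} x" for x
  proof (cases "x \<in> {a<..<b}")
    case True
    have "(\<lambda>n. 1 - 1 / (1 + real n * w x)) \<longlonglongrightarrow> 1 - 0"
      by (intro tendsto_diff tendsto_const tendsto_divide_0[OF tendsto_const] filterlim_at_top_imp_at_infinity
          filterlim_tendsto_add_at_top[OF tendsto_const]
          filterlim_at_top_mult_tendsto_pos[OF tendsto_const w_pos[OF True]]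
          filterlim_real_sequentially)
    moreover have "1 - 1 / (1 + real n * w x) = \<eta> n x" for n
      using pos[of n x] by (simp add: \<eta>_def field_simps)
    ultimately show ?thesis using True by simp
  next
    case False
    then show ?thesis using w_eq_0[of x] by (simp add: \<eta>_def)
  qed
qed

lemma test_funsD:
  assumes "\<eta> \<in> test_funs I"
  shows "(\<eta> has_real_derivative deriv \<eta> x) (at x)" "continuous_on UNIV (deriv \<eta>)"
    "compact (closure {x. \<eta> x \<noteq> 0})" "closure {x. \<eta> x \<noteq> 0} \<subseteq> I"
    "x \<notin> closure {x. \<eta> x \<noteq> 0} \<Longrightarrow> \<eta> x = 0"
    "x \<notin> closure {x. \<eta> x \<noteq> 0} \<Longrightarrow> deriv \<eta> x = 0"
proof -
  show der: "(\<eta> has_real_derivative deriv \<eta> x) (at x)" for x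
    using assms by (simp add: test_funs_def DERIV_deriv_iff_real_differentiable)
  show zero: "\<eta> x = 0" if "x \<notin> closure {x. \<eta> x \<noteq> 0}" for x
    using that closure_subset[of "{x. \<eta> x \<noteq> 0}"] by blast
  assume x: "x \<notin> closure {x. \<eta> x \<noteq> 0}"
  have "(\<eta> has_real_derivative 0) (at x)"
  proof (rule has_field_derivative_transform_within_open[OF DERIV_const])
    show "open (- closure {x. \<eta> x \<noteq> 0})" by (rule open_Compl[OF closed_closure])
    show "x \<in> - closure {x. \<eta> x \<noteq> 0}" by (simp only: Compl_iff x not_False_eq_True)
    show "0 = \<eta> y" if "y \<in> - closure {x. \<eta> x \<noteq> 0}" for y
      using zero[of y] that by (simp only: Compl_iff not_False_eq_True)
  qed
  then show "deriv \<eta> x = 0" by (rule DERIV_imp_deriv)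
qed (use assms in \<open>auto simp: test_funs_def\<close>)

lemma integrable_mult_L2:
  assumes "f \<in> L2 I" "g \<in> L2 I"
  shows "integrable (lebesgue_on I) (\<lambda>x. f x * g x)"
proof (rule Bochner_Integration.integrable_bound)
  show "integrable (lebesgue_on I) (\<lambda>x. (cmod (f x))\<^sup>2 + (cmod (g x))\<^sup>2)"
    using assms by (auto simp: L2_def)
  show "(\<lambda>x. f x * g x) \<in> borel_measurable (lebesgue_on I)"
    using assms by (auto simp: L2_def)
  have "cmod (f x * g x) \<le> (cmod (f x))\<^sup>2 + (cmod (g x))\<^sup>2" for x
    using sum_squares_bound[of "cmod (f x)" "cmod (g x)"]
      mult_nonneg_nonneg[OF norm_ge_zero[of "f x"] norm_ge_zero[of "g x"]]
    unfolding norm_mult by linarith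
  then show "AE x in lebesgue_on I. cmod (f x * g x) \<le> norm ((cmod (f x))\<^sup>2 + (cmod (g x))\<^sup>2)"
    by (auto simp: abs_of_nonneg)
qed

lemma L2_add:
  assumes "f \<in> L2 I" "g \<in> L2 I"
  shows "(\<lambda>x. f x + g x) \<in> L2 I"
proof -
  have "integrable (lebesgue_on I) (\<lambda>x. (cmod (f x + g x))\<^sup>2)"
  proof (rule Bochner_Integration.integrable_bound)
    show "integrable (lebesgue_on I) (\<lambda>x. 2 * (cmod (f x))\<^sup>2 + 2 * (cmod (g x))\<^sup>2)"
      using assms by (auto simp: L2_def)
    show "(\<lambda>x. (cmod (f x + g x))\<^sup>2) \<in> borel_measurable (lebesgue_on I)"
      using assms by (auto simp: L2_def)
    have "(cmod (f x + g x))\<^sup>2 \<le> 2 * (cmod (f x))\<^sup>2 + 2 * (cmod (g x))\<^sup>2" for x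
    proof -
      have "(cmod (f x + g x))\<^sup>2 \<le> (cmod (f x) + cmod (g x))\<^sup>2"
        by (simp add: norm_triangle_ineq power_mono)
      then show ?thesis
        using sum_squares_bound[of "cmod (f x)" "cmod (g x)"] by (simp add: power2_sum)
    qed
    then show "AE x in lebesgue_on I. norm ((cmod (f x + g x))\<^sup>2) \<le> norm (2 * (cmod (f x))\<^sup>2 + 2 * (cmod (g x))\<^sup>2)"
      by (auto simp: abs_of_nonneg)
  qed
  then show ?thesis using assms by (auto simp: L2_def)
qed

lemma L2_mult_const:
  assumes "f \<in> L2 I"
  shows "(\<lambda>x. c * f x) \<in> L2 I"
  using assms by (auto simp: L2_def norm_mult power_mult_distrib)

text \<open>
  Bumps approximating the indicator of an interval turn the hypothesis into vanishing interval
  integrals on every compact interval inside \<open>I\<close>; countably many of these cover \<open>I\<close>.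
\<close>

lemma integral_test_fun_eq_0_imp_AE_eq_0:
  assumes "open I" and h: "h \<in> L2 I"
    and zero: "\<And>\<eta>. \<eta> \<in> test_funs I \<Longrightarrow> (LINT x|lebesgue_on I. h x * of_real (\<eta> x)) = 0"
  shows "AE x in lebesgue_on I. h x = 0"
proof -
  have I: "I \<in> sets lebesgue" using \<open>open I\<close> by auto
  have meas: "(\<lambda>x. indicator I x *\<^sub>R h x) \<in> borel_measurable lebesgue"
    using h I by (auto simp: L2_def borel_measurable_restrict_space_iff)
  have intgbl: "integrable lebesgue (\<lambda>x. indicator {a..b} x *\<^sub>R h x)" if "{a..b} \<subseteq> I" for a b
  proof -
    have "integrable (lebesgue_on I) (\<lambda>x. indicator {a..b} x * h x)"
    proof (rule integrable_mult_L2)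
      have S: "{a..b} \<in> sets (lebesgue_on I)"
        using I that by (simp add: sets_restrict_space_iff)
      have "emeasure (lebesgue_on I) {a..b} < \<infinity>"
        using I that by (simp add: emeasure_restrict_space emeasure_lborel_Icc_eq)
      with S have "integrable (lebesgue_on I) (indicat_real {a..b})"
        by (rule integrable_real_indicator)
      moreover have "(cmod (indicator {a..b} x))\<^sup>2 = indicat_real {a..b} x" for x
        by (simp add: indicator_def)
      ultimately show "indicator {a..b} \<in> L2 I"
        using borel_measurable_indicator[OF S] by (simp add: L2_def)
    qed (rule h)
    moreover have "indicator I x *\<^sub>R (indicator {a..b} x * h x) = indicator {a..b} x *\<^sub>R h x" for x
      using that by (auto simp: indicator_def)
    ultimately show ?thesis using I by (simp add: integrable_restrict_space)
  qed
  have interval: "(LINT x|lebesgue. indicator {a..b} x *\<^sub>R h x) = 0" if ab: "a \<le> b" "{a..b} \<subseteq> I" for a b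
  proof -
    obtain \<eta> where \<eta>: "\<And>n::nat. \<eta> n \<in> test_funs I"
      "\<And>n x. \<bar>\<eta> n x\<bar> \<le> indicator {a..b} x"
      "\<And>x. (\<lambda>n. \<eta> n x) \<longlonglongrightarrow> indicator {a<..<b} x"
      using test_funs_approximate_indicator[OF ab] by blast
    have \<eta>_0: "\<eta> n x = 0" if "x \<notin> {a..b}" for n x
      using \<eta>(2)[of n x] that by simp
    have eq: "indicator I x *\<^sub>R (h x * of_real (\<eta> n x)) = h x * of_real (\<eta> n x)" for n x
    proof (cases "x \<in> I")
      case False
      then have "x \<notin> {a..b}" using ab by blast
      then show ?thesis using \<eta>_0 by simp
    qed simp
    have open_meas: "(\<lambda>x. indicator {a<..<b} x *\<^sub>R h x) \<in> borel_measurable lebesgue"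
    proof -
      have "integrable lebesgue (\<lambda>x. indicator {a<..<b} x *\<^sub>R (indicator {a..b} x *\<^sub>R h x))"
        by (rule integrable_mult_indicator[OF _ intgbl[OF ab(2)]]) auto
      moreover have "(\<lambda>x. indicator {a<..<b} x *\<^sub>R (indicator {a..b} x *\<^sub>R h x))
          = (\<lambda>x. indicator {a<..<b} x *\<^sub>R h x)"
        by (auto simp: indicator_def fun_eq_iff)
      ultimately show ?thesis
        by (simp only: borel_measurable_integrable)
    qed
    have "(\<lambda>n. LINT x|lebesgue. h x * of_real (\<eta> n x)) \<longlonglongrightarrow> (LINT x|lebesgue. indicator {a<..<b} x *\<^sub>R h x)"
    proof (rule integral_dominated_convergence[where w = "\<lambda>x. cmod (indicator {a..b} x *\<^sub>R h x)"])
      show "integrable lebesgue (\<lambda>x. cmod (indicator {a..b} x *\<^sub>R h x))"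
        using intgbl[OF ab(2)] by (rule integrable_norm)
      show "(\<lambda>x. h x * of_real (\<eta> n x)) \<in> borel_measurable lebesgue" for n
      proof -
        have "\<eta> n \<in> borel_measurable borel"
          by (intro borel_measurable_continuous_onI DERIV_continuous_on) (use test_funsD(1)[OF \<eta>(1)] in auto)
        then have "\<eta> n \<in> borel_measurable lebesgue" by (simp add: measurable_completion)
        then have "(\<lambda>x. indicator {a..b} x *\<^sub>R h x * of_real (\<eta> n x)) \<in> borel_measurable lebesgue"
          using borel_measurable_integrable[OF intgbl[OF ab(2)]] by measurable
        moreover have "indicator {a..b} x *\<^sub>R h x * of_real (\<eta> n x) = h x * of_real (\<eta> n x)" for x
          using \<eta>_0[of x n] by (cases "x \<in> {a..b}") auto
        ultimately show ?thesis by simp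
      qed
      show "(\<lambda>x. indicator {a<..<b} x *\<^sub>R h x) \<in> borel_measurable lebesgue"
        by (rule open_meas)
      show "AE x in lebesgue. (\<lambda>n. h x * of_real (\<eta> n x)) \<longlonglongrightarrow> indicator {a<..<b} x *\<^sub>R h x"
      proof (rule AE_I2)
        fix x
        have "(\<lambda>n. h x * of_real (\<eta> n x)) \<longlonglongrightarrow> h x * of_real (indicator {a<..<b} x)"
          by (intro tendsto_intros \<eta>(3))
        then show "(\<lambda>n. h x * of_real (\<eta> n x)) \<longlonglongrightarrow> indicator {a<..<b} x *\<^sub>R h x"
          by (cases "x \<in> {a<..<b}") simp_all
      qed
      show "AE x in lebesgue. cmod (h x * of_real (\<eta> n x)) \<le> cmod (indicator {a..b} x *\<^sub>R h x)" for n
      proof (rule AE_I2)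
        fix x
        have "cmod (h x) * \<bar>\<eta> n x\<bar> \<le> cmod (h x) * indicator {a..b} x"
          by (intro mult_left_mono \<eta>(2)) auto
        then show "cmod (h x * of_real (\<eta> n x)) \<le> cmod (indicator {a..b} x *\<^sub>R h x)"
          by (simp add: norm_mult mult.commute)
      qed
    qed
    moreover have "(LINT x|lebesgue. h x * of_real (\<eta> n x)) = 0" for n
      using zero[OF \<eta>(1)[of n]] I by (simp add: integral_restrict_space eq)
    ultimately have "(LINT x|lebesgue. indicator {a<..<b} x *\<^sub>R h x) = 0"
      by (simp add: LIMSEQ_const_iff)
    moreover have "(LINT x|lebesgue. indicator {a<..<b} x *\<^sub>R h x) = (LINT x|lebesgue. indicator {a..b} x *\<^sub>R h x)"
    proof (rule integral_cong_AE)
      have "AE x in lebesgue. x \<notin> {a, b}"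
        by (rule AE_not_in) (auto intro!: null_sets_completionI finite_imp_null_set_lborel)
      then show "AE x in lebesgue. indicator {a<..<b} x *\<^sub>R h x = indicator {a..b} x *\<^sub>R h x"
        by eventually_elim (auto simp: indicator_def)
      show "(\<lambda>x. indicator {a<..<b} x *\<^sub>R h x) \<in> borel_measurable lebesgue"
        by (rule open_meas)
    qed (rule borel_measurable_integrable[OF intgbl[OF ab(2)]])
    ultimately show ?thesis by simp
  qed
  have AE_interval: "AE x in lebesgue. x \<in> {a..b} \<longrightarrow> h x = 0" if "{a..b} \<subseteq> I" for a b
  proof -
    have "AE x in lebesgue. indicator {a..b} x *\<^sub>R h x = 0"
    proof (rule AE_eq_0_if_interval_integrals_eq_0[OF intgbl[OF that]])
      fix c d
      have "indicator {c..d} x *\<^sub>R indicator {a..b} x *\<^sub>R h x = indicator {max a c..min b d} x *\<^sub>R h x" for x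
        by (auto simp: indicator_def)
      moreover have "(LINT x|lebesgue. indicator {max a c..min b d} x *\<^sub>R h x) = 0"
      proof (cases "max a c \<le> min b d")
        case True
        show ?thesis by (rule interval[OF True]) (use that in \<open>auto\<close>)
      qed auto
      ultimately show "(LINT x:{c..d}|lebesgue. indicator {a..b} x *\<^sub>R h x) = 0"
        by (simp only: set_lebesgue_integral_def)
    qed
    then show ?thesis by eventually_elim auto
  qed
  \<comment> \<open>Rational intervals inside \<open>I\<close>: countably many, and they cover \<open>I\<close>.\<close>
  define P where "P = {(a, b). a \<in> \<rat> \<and> b \<in> \<rat> \<and> {a..b} \<subseteq> I}"
  have "countable P"
    by (rule countable_subset[of _ "\<rat> \<times> \<rat>"]) (auto simp: P_def countable_rat)
  moreover have "AE x in lebesgue. x \<in> {fst p..snd p} \<longrightarrow> h x = 0" if "p \<in> P" for p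
    using that AE_interval by (auto simp: P_def)
  ultimately have "AE x in lebesgue. \<forall>p\<in>P. x \<in> {fst p..snd p} \<longrightarrow> h x = 0"
    unfolding AE_ball_countable[OF \<open>countable P\<close>] by blast
  then have "AE x in lebesgue. x \<in> I \<longrightarrow> h x = 0"
  proof eventually_elim
    case (elim x)
    show ?case
    proof
      assume "x \<in> I"
      then obtain e where e: "e > 0" "ball x e \<subseteq> I"
        using \<open>open I\<close> openE by blast
      obtain a where a: "a \<in> \<rat>" "x - e < a" "a < x" using Rats_dense_in_real[of "x - e" x] e by auto
      obtain b where b: "b \<in> \<rat>" "x < b" "b < x + e" using Rats_dense_in_real[of x "x + e"] e by auto
      have "{a..b} \<subseteq> ball x e" using a b by (auto simp: dist_real_def)
      then have "(a, b) \<in> P" using a b e by (auto simp: P_def)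
      from bspec[OF elim this] show "h x = 0" using a b by simp
    qed
  qed
  then show ?thesis
    by (subst AE_restrict_space_iff) (use I in simp_all)
qed

section \<open>Weak derivatives of piecewise smooth functions\<close>

lemma compactly_supported_in_L2:
  fixes w :: "real \<Rightarrow> real"
  assumes cont: "continuous_on UNIV w" and K: "compact K" "K \<subseteq> I" "\<And>x. x \<notin> K \<Longrightarrow> w x = 0" and "open I"
  shows "(\<lambda>x. of_real (w x)) \<in> L2 I"
proof -
  have I: "I \<in> sets lebesgue" using \<open>open I\<close> by auto
  have cont': "continuous_on S w" for S using cont continuous_on_subset by blast
  have "integrable lborel (\<lambda>x. indicator K x *\<^sub>R (w x)\<^sup>2)"
    by (intro borel_integrable_compact K(1) continuous_intros cont')
  then have "integrable lebesgue (\<lambda>x. indicator K x *\<^sub>R (w x)\<^sup>2)"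
    by (subst integrable_completion) (auto intro: borel_measurable_integrable)
  moreover have "(\<lambda>x. indicator K x *\<^sub>R (w x)\<^sup>2) = (\<lambda>x. indicator I x *\<^sub>R (cmod (of_real (w x)))\<^sup>2)"
  proof
    fix x
    show "indicator K x *\<^sub>R (w x)\<^sup>2 = indicator I x *\<^sub>R (cmod (of_real (w x)))\<^sup>2"
      using K(2) K(3)[of x] by (cases "x \<in> K") auto
  qed
  ultimately have "integrable (lebesgue_on I) (\<lambda>x. (cmod (of_real (w x)))\<^sup>2)"
    using I by (subst integrable_restrict_space) simp_all
  moreover have "(\<lambda>x. complex_of_real (w x)) \<in> borel_measurable (lebesgue_on I)"
    by (intro continuous_imp_measurable_on_sets_lebesgue continuous_intros cont' I)
  ultimately show ?thesis by (simp add: L2_def)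
qed

lemma test_fun_in_L2:
  assumes \<eta>: "\<eta> \<in> test_funs I" and "open I"
  shows "(\<lambda>x. of_real (\<eta> x)) \<in> L2 I" "(\<lambda>x. of_real (deriv \<eta> x)) \<in> L2 I"
proof -
  note K = test_funsD(3,4)[OF \<eta>]
  have cont: "continuous_on UNIV \<eta>"
    by (rule DERIV_continuous_on, rule has_field_derivative_at_within, rule test_funsD(1)[OF \<eta>])
  show "(\<lambda>x. of_real (\<eta> x)) \<in> L2 I"
    by (rule compactly_supported_in_L2[OF cont K test_funsD(5)[OF \<eta>] \<open>open I\<close>])
  show "(\<lambda>x. of_real (deriv \<eta> x)) \<in> L2 I"
    by (rule compactly_supported_in_L2[OF test_funsD(2)[OF \<eta>] K test_funsD(6)[OF \<eta>] \<open>open I\<close>])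
qed

lemma has_weak_deriv_unique_AE:
  assumes "open I" "g \<in> L2 I" "g' \<in> L2 I" "has_weak_deriv I f g" "has_weak_deriv I f g'"
  shows "AE x in lebesgue_on I. g x = g' x"
proof -
  have "(\<lambda>x. g x + (-1) * g' x) \<in> L2 I"
    by (rule L2_add[OF assms(2) L2_mult_const[OF assms(3)]])
  then have "AE x in lebesgue_on I. g x + (-1) * g' x = 0"
  proof (rule integral_test_fun_eq_0_imp_AE_eq_0[OF \<open>open I\<close>])
    fix \<eta> assume \<eta>: "\<eta> \<in> test_funs I"
    note int = integrable_mult_L2[OF _ test_fun_in_L2(1)[OF \<eta> \<open>open I\<close>]]
    have eq: "(\<lambda>x. (g x + (-1) * g' x) * of_real (\<eta> x)) = (\<lambda>x. g x * of_real (\<eta> x) - g' x * of_real (\<eta> x))"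
      by (simp add: fun_eq_iff algebra_simps)
    have "(LINT x|lebesgue_on I. (g x + (-1) * g' x) * of_real (\<eta> x)) =
        (LINT x|lebesgue_on I. g x * of_real (\<eta> x)) - (LINT x|lebesgue_on I. g' x * of_real (\<eta> x))"
      unfolding eq by (rule Bochner_Integration.integral_diff[OF int[OF assms(2)] int[OF assms(3)]])
    also have "\<dots> = 0"
    proof -
      from assms(4) \<eta> have "(LINT x|lebesgue_on I. f x * of_real (deriv \<eta> x)) = - (LINT x|lebesgue_on I. g x * of_real (\<eta> x))"
        unfolding has_weak_deriv_def by (rule bspec)
      moreover from assms(5) \<eta> have "(LINT x|lebesgue_on I. f x * of_real (deriv \<eta> x)) = - (LINT x|lebesgue_on I. g' x * of_real (\<eta> x))"
        unfolding has_weak_deriv_def by (rule bspec)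
      ultimately show ?thesis by (simp only: neg_equal_iff_equal diff_self)
    qed
    finally show "(LINT x|lebesgue_on I. (g x + (-1) * g' x) * of_real (\<eta> x)) = 0" .
  qed
  then show ?thesis by eventually_elim simp
qed

lemma L2_sqnorm_cong_AE:
  assumes "f \<in> L2 I" "g \<in> L2 I" "AE x in lebesgue_on I. f x = g x"
  shows "L2_sqnorm I f = L2_sqnorm I g"
  unfolding L2_sqnorm_def
proof (rule integral_cong_AE)
  show "AE x in lebesgue_on I. (cmod (f x))\<^sup>2 = (cmod (g x))\<^sup>2"
    using assms(3) by eventually_elim simp
qed (use assms in \<open>auto simp: L2_def intro: borel_measurable_integrable\<close>)

text \<open>
  The restriction of \<open>f\<close> to \<open>I\<close> is \<open>C\<^sup>1\<close> and lies in \<open>H\<^sup>1\<close>. The derivative is an argument so that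
  norms can be written in terms of an explicit function.
\<close>

definition classical_H1 :: "real set \<Rightarrow> (real \<Rightarrow> complex) \<Rightarrow> (real \<Rightarrow> complex) \<Rightarrow> bool" where
  "classical_H1 I f f' \<longleftrightarrow> (\<forall>x\<in>I. (f has_vector_derivative f' x) (at x)) \<and> continuous_on I f' \<and>
     f \<in> L2 I \<and> f' \<in> L2 I"

lemma classical_H1_continuous_on:
  assumes "classical_H1 I f f'"
  shows "continuous_on I f"
proof (rule continuous_at_imp_continuous_on, rule ballI)
  fix x assume "x \<in> I"
  then have "(f has_vector_derivative f' x) (at x)" using assms by (simp add: classical_H1_def)
  then show "isCont f x" by (rule has_vector_derivative_continuous)
qed

text \<open>
  Integration by parts. Multiplied by a test function, \<open>f\<close> and \<open>f'\<close> extend by 0 to continuous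
  functions on the whole line, so the fundamental theorem of calculus applies on an interval
  \<open>{-R..R}\<close> around the support, and there are no boundary terms; \<open>I\<close> may be any open set.
\<close>

lemma classical_H1_imp_has_weak_deriv:
  assumes f: "classical_H1 I f f'" and "open I"
  shows "has_weak_deriv I f f'"
  unfolding has_weak_deriv_def
proof
  fix \<eta> assume \<eta>: "\<eta> \<in> test_funs I"
  let ?K = "closure {x. \<eta> x \<noteq> 0}"
  have I: "I \<in> sets lebesgue" using \<open>open I\<close> by auto
  have openK: "open (- ?K)" by (simp add: open_Compl)
  have cover: "I \<union> - ?K = UNIV" using test_funsD(4)[OF \<eta>] by blast
  have cont\<eta>: "continuous_on S \<eta>" for S
    by (rule DERIV_continuous_on, rule has_field_derivative_at_within, rule test_funsD(1)[OF \<eta>])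
  obtain R where R: "R > 0" "\<And>x. x \<in> ?K \<Longrightarrow> \<bar>x\<bar> < R"
    using compact_imp_bounded[OF test_funsD(3)[OF \<eta>]] unfolding bounded_pos_less by auto
  have cont: "continuous_on UNIV (\<lambda>x. u x * of_real (w x))"
    if u: "continuous_on I u" and w: "continuous_on UNIV w" "\<And>x. x \<notin> ?K \<Longrightarrow> w x = 0"
    for u :: "real \<Rightarrow> complex" and w :: "real \<Rightarrow> real"
  proof -
    have "continuous_on (- ?K) (\<lambda>x. u x * of_real (w x))"
      by (rule continuous_on_eq[of _ "\<lambda>_. 0"]) (use w in auto)
    moreover have "continuous_on I (\<lambda>x. u x * of_real (w x))"
      by (intro continuous_intros u continuous_on_subset[OF w(1)]) auto
    ultimately show ?thesis
      using continuous_on_open_Un[OF \<open>open I\<close> openK] cover by metis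
  qed
  have lborel: "(LINT x|lebesgue_on I. u x * of_real (w x)) =
      (LINT x|lborel. indicator {-R..R} x *\<^sub>R (u x * of_real (w x)))"
    "integrable lborel (\<lambda>x. indicator {-R..R} x *\<^sub>R (u x * of_real (w x)))"
    if u: "continuous_on I u" and w: "continuous_on UNIV w" "\<And>x. x \<notin> ?K \<Longrightarrow> w x = 0"
    for u :: "real \<Rightarrow> complex" and w :: "real \<Rightarrow> real"
  proof -
    show int: "integrable lborel (\<lambda>x. indicator {-R..R} x *\<^sub>R (u x * of_real (w x)))"
      by (intro borel_integrable_compact continuous_on_subset[OF cont[OF u w]]) auto
    have eq: "(\<lambda>x. indicator I x *\<^sub>R (u x * of_real (w x))) = (\<lambda>x. indicator {-R..R} x *\<^sub>R (u x * of_real (w x)))"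
    proof
      fix x
      show "indicator I x *\<^sub>R (u x * of_real (w x)) = indicator {-R..R} x *\<^sub>R (u x * of_real (w x))"
      proof (cases "x \<in> ?K")
        case True
        then have "x \<in> I" "x \<in> {-R..R}" using test_funsD(4)[OF \<eta>] R(2)[of x] by auto
        then show ?thesis by simp
      next
        case False
        then have "w x = 0" by (rule w(2))
        then show ?thesis by simp
      qed
    qed
    have "(LINT x|lebesgue_on I. u x * of_real (w x)) = (LINT x|lebesgue. indicator {-R..R} x *\<^sub>R (u x * of_real (w x)))"
      unfolding eq[symmetric] using I by (intro integral_restrict_space) simp
    also have "\<dots> = (LINT x|lborel. indicator {-R..R} x *\<^sub>R (u x * of_real (w x)))"
      by (rule integral_completion[OF borel_measurable_integrable[OF int]])
    finally show "(LINT x|lebesgue_on I. u x * of_real (w x)) =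
      (LINT x|lborel. indicator {-R..R} x *\<^sub>R (u x * of_real (w x)))" .
  qed
  have der: "((\<lambda>x. f x * of_real (\<eta> x)) has_vector_derivative
      f x * of_real (deriv \<eta> x) + f' x * of_real (\<eta> x)) (at x)" for x
  proof (cases "x \<in> I")
    case True
    have "((\<lambda>x. complex_of_real (\<eta> x)) has_vector_derivative of_real (deriv \<eta> x)) (at x)"
      using test_funsD(1)[OF \<eta>] by (rule has_vector_derivative_of_real)
    then show ?thesis
      using f True unfolding classical_H1_def by (intro has_vector_derivative_mult) auto
  next
    case False
    then have x: "x \<in> - ?K" using test_funsD(4)[OF \<eta>] by blast
    have "((\<lambda>x. f x * of_real (\<eta> x)) has_vector_derivative 0) (at x)"
    proof (rule has_vector_derivative_transform_within_open[OF has_vector_derivative_const openK x])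
      fix y assume "y \<in> - ?K"
      then have "\<eta> y = 0" by (intro test_funsD(5)[OF \<eta>]) (rule ComplD)
      then show "0 = f y * of_real (\<eta> y)" by simp
    qed
    moreover have "\<eta> x = 0" "deriv \<eta> x = 0"
      using test_funsD(5,6)[OF \<eta>, OF ComplD[OF x]] by blast+
    ultimately show ?thesis by simp
  qed
  have contf: "continuous_on I f" by (rule classical_H1_continuous_on[OF f])
  have contf': "continuous_on I f'" using f by (simp add: classical_H1_def)
  note G = contf test_funsD(2)[OF \<eta>] test_funsD(6)[OF \<eta>]
  note H = contf' cont\<eta>[of UNIV] test_funsD(5)[OF \<eta>]
  have "\<eta> R = 0" "\<eta> (- R) = 0"
    using R(1) R(2)[of R] R(2)[of "- R"]
    by (intro test_funsD(5)[OF \<eta>] notI; simp)+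
  then have "(LINT x|lborel. indicator {-R..R} x *\<^sub>R (f x * of_real (deriv \<eta> x) + f' x * of_real (\<eta> x))) = 0"
    using R(1) by (subst integral_FTC_atLeastAtMost[where F = "\<lambda>x. f x * of_real (\<eta> x)"])
      (auto intro!: has_vector_derivative_at_within[OF der] continuous_on_add
        continuous_on_subset[OF cont[OF G]] continuous_on_subset[OF cont[OF H]])
  also have "(LINT x|lborel. indicator {-R..R} x *\<^sub>R (f x * of_real (deriv \<eta> x) + f' x * of_real (\<eta> x)))
      = (LINT x|lebesgue_on I. f x * of_real (deriv \<eta> x)) + (LINT x|lebesgue_on I. f' x * of_real (\<eta> x))"
    by (subst lborel(1)[OF G], assumption, subst lborel(1)[OF H], assumption, subst scaleR_add_right,
        rule Bochner_Integration.integral_add[OF lborel(2)[OF G] lborel(2)[OF H]])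
  finally show "(LINT x|lebesgue_on I. f x * of_real (deriv \<eta> x)) = - (LINT x|lebesgue_on I. f' x * of_real (\<eta> x))"
    by (simp add: eq_neg_iff_add_eq_0)
qed

text \<open>
  Uniqueness almost everywhere makes the derivative picked by the choice operator
  indistinguishable from \<open>f'\<close> in norm.
\<close>

lemma H1_norm_classical:
  assumes f: "classical_H1 I f f'" and "open I"
  shows "f \<in> H1 I" "(H1_norm I f)\<^sup>2 = L2_sqnorm I f + L2_sqnorm I f'"
proof -
  note weak = classical_H1_imp_has_weak_deriv[OF assms]
  have L2: "f \<in> L2 I" "f' \<in> L2 I" using f by (auto simp: classical_H1_def)
  show "f \<in> H1 I" using L2 weak by (auto simp: H1_def)
  have wd: "weak_deriv I f \<in> L2 I \<and> has_weak_deriv I f (weak_deriv I f)"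
    unfolding weak_deriv_def by (rule someI[of _ f']) (use L2 weak in simp)
  then have "L2_sqnorm I (weak_deriv I f) = L2_sqnorm I f'"
    using L2 weak \<open>open I\<close> by (intro L2_sqnorm_cong_AE has_weak_deriv_unique_AE) auto
  moreover have "L2_sqnorm I f \<ge> 0" "L2_sqnorm I f' \<ge> 0"
    by (simp_all add: L2_sqnorm_def)
  ultimately show "(H1_norm I f)\<^sup>2 = L2_sqnorm I f + L2_sqnorm I f'"
    by (simp add: H1_norm_def)
qed

lemma classical_H1_add:
  assumes "classical_H1 I f f'" "classical_H1 I g g'"
  shows "classical_H1 I (\<lambda>x. f x + g x) (\<lambda>x. f' x + g' x)"
  using assms unfolding classical_H1_def
  by (auto intro!: has_vector_derivative_add continuous_on_add L2_add)

lemma classical_H1_mult_const: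
  assumes "classical_H1 I f f'"
  shows "classical_H1 I (\<lambda>x. c * f x) (\<lambda>x. c * f' x)"
  using assms unfolding classical_H1_def
  by (auto intro!: has_vector_derivative_mult_right continuous_on_mult continuous_on_const L2_mult_const)

lemma L2_cong:
  assumes "\<And>x. x \<in> I \<Longrightarrow> f x = g x"
  shows "f \<in> L2 I \<longleftrightarrow> g \<in> L2 I" "L2_sqnorm I f = L2_sqnorm I g"
proof -
  have "f \<in> borel_measurable (lebesgue_on I) \<longleftrightarrow> g \<in> borel_measurable (lebesgue_on I)"
    by (rule measurable_cong) (use assms in auto)
  moreover have "integrable (lebesgue_on I) (\<lambda>x. (cmod (f x))\<^sup>2) \<longleftrightarrow> integrable (lebesgue_on I) (\<lambda>x. (cmod (g x))\<^sup>2)"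
    by (rule Bochner_Integration.integrable_cong) (use assms in auto)
  ultimately show "f \<in> L2 I \<longleftrightarrow> g \<in> L2 I" by (simp add: L2_def)
  show "L2_sqnorm I f = L2_sqnorm I g"
    unfolding L2_sqnorm_def by (rule Bochner_Integration.integral_cong) (use assms in auto)
qed

lemma classical_H1_cong:
  assumes "open I" "\<And>x. x \<in> I \<Longrightarrow> f x = g x" "\<And>x. x \<in> I \<Longrightarrow> f' x = g' x" "classical_H1 I g g'"
  shows "classical_H1 I f f'"
proof -
  have "(f has_vector_derivative f' x) (at x)" if "x \<in> I" for x
  proof -
    have "(g has_vector_derivative g' x) (at x)"
      using assms(4) that by (simp add: classical_H1_def)
    then have "(f has_vector_derivative g' x) (at x)"
      by (rule has_vector_derivative_transform_within_open[OF _ \<open>open I\<close> that]) (simp add: assms(2))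
    then show ?thesis using assms(3)[OF that] by simp
  qed
  moreover have "continuous_on I f' \<longleftrightarrow> continuous_on I g'"
    by (rule continuous_on_cong) (use assms in auto)
  ultimately show ?thesis
    using L2_cong(1)[of I f g, OF assms(2)] L2_cong(1)[of I f' g', OF assms(3)] assms(4)
    by (simp add: classical_H1_def)
qed

lemma classical_H1_0: "classical_H1 I (\<lambda>x. 0) (\<lambda>x. 0)"
  by (simp add: classical_H1_def L2_def)

lemma L2_sqnorm_nonneg: "L2_sqnorm I f \<ge> 0"
  by (simp add: L2_sqnorm_def)

lemma Q_norm_classical:
  assumes "classical_H1 {0<..} f f'" "classical_H1 {..<0} f f'"
  shows "f \<in> Q"
    "Q_norm f = sqrt (L2_sqnorm {0<..} f + L2_sqnorm {0<..} f' + (L2_sqnorm {..<0} f + L2_sqnorm {..<0} f'))"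
  using H1_norm_classical[OF assms(1)] H1_norm_classical[OF assms(2)]
  by (auto simp: Q_def Q_norm_def)

lemma H1_add:
  assumes "f \<in> H1 I" "g \<in> H1 I" "open I"
  shows "(\<lambda>x. f x + g x) \<in> H1 I"
proof -
  obtain f' g' where f: "f \<in> L2 I" "f' \<in> L2 I" "has_weak_deriv I f f'"
    and g: "g \<in> L2 I" "g' \<in> L2 I" "has_weak_deriv I g g'"
    using assms by (auto simp: H1_def)
  have "has_weak_deriv I (\<lambda>x. f x + g x) (\<lambda>x. f' x + g' x)"
    unfolding has_weak_deriv_def
  proof
    fix \<eta> assume \<eta>: "\<eta> \<in> test_funs I"
    note int = integrable_mult_L2[OF _ test_fun_in_L2(1)[OF \<eta> \<open>open I\<close>]]
      integrable_mult_L2[OF _ test_fun_in_L2(2)[OF \<eta> \<open>open I\<close>]]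
    have "(LINT x|lebesgue_on I. (f x + g x) * of_real (deriv \<eta> x)) =
        (LINT x|lebesgue_on I. f x * of_real (deriv \<eta> x)) + (LINT x|lebesgue_on I. g x * of_real (deriv \<eta> x))"
      unfolding distrib_right by (rule Bochner_Integration.integral_add[OF int(2)[OF f(1)] int(2)[OF g(1)]])
    also have "\<dots> = - (LINT x|lebesgue_on I. f' x * of_real (\<eta> x)) + - (LINT x|lebesgue_on I. g' x * of_real (\<eta> x))"
      using bspec[OF f(3)[unfolded has_weak_deriv_def] \<eta>] bspec[OF g(3)[unfolded has_weak_deriv_def] \<eta>]
      by (simp only:)
    also have "\<dots> = - (LINT x|lebesgue_on I. (f' x + g' x) * of_real (\<eta> x))"
      unfolding distrib_right Bochner_Integration.integral_add[OF int(1)[OF f(2)] int(1)[OF g(2)]] by simp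
    finally show "(LINT x|lebesgue_on I. (f x + g x) * of_real (deriv \<eta> x)) =
        - (LINT x|lebesgue_on I. (f' x + g' x) * of_real (\<eta> x))" .
  qed
  then show ?thesis using L2_add[OF f(1) g(1)] L2_add[OF f(2) g(2)] by (auto simp: H1_def)
qed

lemma H1_mult_const:
  assumes "f \<in> H1 I"
  shows "(\<lambda>x. c * f x) \<in> H1 I"
proof -
  obtain f' where f: "f \<in> L2 I" "f' \<in> L2 I" "has_weak_deriv I f f'"
    using assms by (auto simp: H1_def)
  have "has_weak_deriv I (\<lambda>x. c * f x) (\<lambda>x. c * f' x)"
    using f(3) by (simp add: has_weak_deriv_def mult.assoc)
  then show ?thesis using L2_mult_const[OF f(1)] L2_mult_const[OF f(2)] by (auto simp: H1_def)
qed

lemma Q_add: "f \<in> Q \<Longrightarrow> g \<in> Q \<Longrightarrow> (\<lambda>x. f x + g x) \<in> Q"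
  and Q_mult_const: "f \<in> Q \<Longrightarrow> (\<lambda>x. c * f x) \<in> Q"
  by (auto simp: Q_def intro: H1_add H1_mult_const)

lemma classical_H1_diff:
  assumes "classical_H1 I f f'" "classical_H1 I g g'"
  shows "classical_H1 I (\<lambda>x. f x - g x) (\<lambda>x. f' x - g' x)"
  using classical_H1_add[OF assms(1) classical_H1_mult_const[OF assms(2), of "-1"]] by simp

section \<open>Integrals and limits of sech profiles\<close>

lemma L2_sqnorm_lborel:
  fixes f :: "real \<Rightarrow> complex"
  assumes "continuous_on I f" "open I" and int: "set_integrable lborel I (\<lambda>x. (cmod (f x))\<^sup>2)"
  shows "f \<in> L2 I" "L2_sqnorm I f = (LINT x:I|lborel. (cmod (f x))\<^sup>2)"
proof -
  have I: "I \<in> sets lebesgue" using \<open>open I\<close> by auto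
  have meas: "(\<lambda>x. indicator I x *\<^sub>R (cmod (f x))\<^sup>2) \<in> borel_measurable lborel"
    using int unfolding set_integrable_def by (rule borel_measurable_integrable)
  have "f \<in> borel_measurable (lebesgue_on I)"
    by (rule continuous_imp_measurable_on_sets_lebesgue[OF assms(1) I])
  moreover have "integrable (lebesgue_on I) (\<lambda>x. (cmod (f x))\<^sup>2)"
    using int I meas unfolding set_integrable_def
    by (simp add: integrable_restrict_space integrable_completion)
  ultimately show "f \<in> L2 I" by (simp add: L2_def)
  show "L2_sqnorm I f = (LINT x:I|lborel. (cmod (f x))\<^sup>2)"
    using I meas unfolding L2_sqnorm_def set_lebesgue_integral_def
    by (simp add: integral_restrict_space integral_completion)
qed

lemma sech_power2_eq: "(sech x)\<^sup>2 = 1 - (tanh x)\<^sup>2"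
proof -
  have "1 - (tanh x)\<^sup>2 = ((cosh x)\<^sup>2 - (sinh x)\<^sup>2) / (cosh x)\<^sup>2"
    by (simp add: tanh_def power_divide diff_divide_distrib)
  then show ?thesis
    by (simp add: cosh_square_eq sech_def power_divide)
qed

lemma sech_pos [simp]: "sech x > 0"
  by (simp add: sech_def)

lemma sech_le_1 [simp]: "sech x \<le> 1"
  using cosh_real_ge_1[of x] by (simp add: sech_def)

lemma sech_le_exp: "sech x \<le> 2 * exp (- \<bar>x\<bar>)"
proof -
  have "exp \<bar>x\<bar> \<le> 2 * cosh \<bar>x\<bar>" by (simp add: cosh_def)
  then have "exp \<bar>x\<bar> \<le> 2 * cosh x" by (simp add: abs_if split: if_splits)
  then show ?thesis by (simp add: sech_def exp_minus field_simps)
qed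

lemma continuous_on_sech [continuous_intros]:
  "continuous_on S f \<Longrightarrow> continuous_on S (\<lambda>x. sech (f x))"
  unfolding sech_def by (intro continuous_intros) auto

lemma tendsto_sech [tendsto_intros]:
  "(f \<longlongrightarrow> a) F \<Longrightarrow> ((\<lambda>x. sech (f x)) \<longlongrightarrow> sech a) F"
  unfolding sech_def by (intro tendsto_intros) auto

lemma sech_has_field_derivative [THEN DERIV_chain2, derivative_intros]:
  "(sech has_field_derivative - sech x * tanh x) (at x)"
  unfolding sech_def [abs_def]
  by (auto intro!: derivative_eq_intros simp: tanh_def field_simps power2_eq_square)

lemma tendsto_sech_at_top: "(sech \<longlongrightarrow> 0) at_top"
  unfolding sech_def [abs_def]
  by (rule tendsto_divide_0[OF tendsto_const filterlim_at_top_imp_at_infinity[OF cosh_real_at_top]])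

lemma tendsto_tanh_affine:
  fixes B C :: real
  assumes "B > 0"
  shows "((\<lambda>x. tanh (B * x - C)) \<longlongrightarrow> 1) at_top" "((\<lambda>x. tanh (B * x - C)) \<longlongrightarrow> -1) at_bot"
proof -
  have top: "((\<lambda>x. tanh (B * x - C)) \<longlongrightarrow> 1) at_top" for C
  proof -
    have "filterlim (\<lambda>x. - C + B * x) at_top at_top"
      using assms by (intro filterlim_tendsto_add_at_top[OF tendsto_const]
        filterlim_tendsto_pos_mult_at_top[OF tendsto_const] filterlim_ident)
    from filterlim_compose[OF tanh_real_at_top this] show ?thesis by simp
  qed
  then show "((\<lambda>x. tanh (B * x - C)) \<longlongrightarrow> 1) at_top" .
  have "B * - x - C = - (B * x - - C)" for x by simp
  then have "tanh (B * - x - C) = - tanh (B * x - - C)" for x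
    by (simp only: tanh_minus)
  then show "((\<lambda>x. tanh (B * x - C)) \<longlongrightarrow> -1) at_bot"
    using tendsto_minus[OF top[of "- C"]] by (simp only: filterlim_at_bot_mirror)
qed

text \<open>
  The primitive is \<open>tanh (B * x - C) / B\<close>; its values at 0 and \<open>\<plusminus>\<infinity>\<close> give the formulas.
\<close>

lemma set_integral_sech_power2:
  fixes B C :: real
  assumes "B > 0"
  shows "set_integrable lborel {0<..} (\<lambda>x. (sech (B * x - C))\<^sup>2)"
    and "(LINT x:{0<..}|lborel. (sech (B * x - C))\<^sup>2) = (1 + tanh C) / B"
    and "set_integrable lborel {..<0} (\<lambda>x. (sech (B * x - C))\<^sup>2)"
    and "(LINT x:{..<0}|lborel. (sech (B * x - C))\<^sup>2) = (1 - tanh C) / B"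
proof -
  define F where "F = (\<lambda>x. tanh (B * x - C) / B)"
  have dF: "DERIV F x :> (sech (B * x - C))\<^sup>2" for x
    unfolding F_def using assms
    by (auto intro!: derivative_eq_intros simp: sech_power2_eq)
  have cF: "isCont F x" for x using dF DERIV_isCont by blast
  have cf: "isCont (\<lambda>x. (sech (B * x - C))\<^sup>2) x" for x
  proof -
    have "continuous_on UNIV (\<lambda>x. (sech (B * x - C))\<^sup>2)" by (intro continuous_intros)
    then show ?thesis by (simp add: continuous_on_eq_continuous_at)
  qed
  have F0: "F 0 = - tanh C / B" by (simp add: F_def)
  have R: "((F \<circ> real_of_ereal) \<longlongrightarrow> - tanh C / B) (at_right (ereal 0))"
    "((F \<circ> real_of_ereal) \<longlongrightarrow> - tanh C / B) (at_left (ereal 0))"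
    using cF[of 0] F0 unfolding ereal_tendsto_simps isCont_def
    by (auto simp: filterlim_at_split)
  have inf: "((F \<circ> real_of_ereal) \<longlongrightarrow> 1 / B) (at_left \<infinity>)"
    "((F \<circ> real_of_ereal) \<longlongrightarrow> -1 / B) (at_right (-\<infinity>))"
    unfolding ereal_tendsto_simps F_def using assms
    by (intro tendsto_divide tendsto_tanh_affine tendsto_const; simp)+
  note right = interval_integral_FTC_nonneg[of "ereal 0" \<infinity>, OF _ dF cf _ R(1) inf(1)]
  note left = interval_integral_FTC_nonneg[of "-\<infinity>" "ereal 0", OF _ dF cf _ inf(2) R(2)]
  have E: "einterval (ereal 0) \<infinity> = {0<..}" "einterval (-\<infinity>) (ereal 0) = {..<0}"
    by (rule einterval_eq_Ici, rule einterval_eq_Iic)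
  have right': "set_integrable lborel (einterval (ereal 0) \<infinity>) (\<lambda>x. (sech (B * x - C))\<^sup>2)"
    "(LBINT x=ereal 0..\<infinity>. (sech (B * x - C))\<^sup>2) = 1 / B - (- tanh C / B)"
    by (rule right; simp)+
  have left': "set_integrable lborel (einterval (-\<infinity>) (ereal 0)) (\<lambda>x. (sech (B * x - C))\<^sup>2)"
    "(LBINT x=-\<infinity>..ereal 0. (sech (B * x - C))\<^sup>2) = - tanh C / B - (-1 / B)"
    by (rule left; simp)+
  show "set_integrable lborel {0<..} (\<lambda>x. (sech (B * x - C))\<^sup>2)"
    using right'(1) by (simp only: E)
  have "(LINT x:{0<..}|lborel. (sech (B * x - C))\<^sup>2) = 1 / B - (- tanh C / B)"
    using right'(2) by (simp only: interval_integral_to_infinity_eq)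
  then show "(LINT x:{0<..}|lborel. (sech (B * x - C))\<^sup>2) = (1 + tanh C) / B"
    by (simp add: add_divide_distrib)
  show "set_integrable lborel {..<0} (\<lambda>x. (sech (B * x - C))\<^sup>2)"
    using left'(1) by (simp only: E)
  have "(LINT x:{..<0}|lborel. (sech (B * x - C))\<^sup>2) = - tanh C / B - (-1 / B)"
    using left'(2) unfolding interval_lebesgue_integral_def E by simp
  then show "(LINT x:{..<0}|lborel. (sech (B * x - C))\<^sup>2) = (1 - tanh C) / B"
    by (simp add: diff_divide_distrib)
qed

abbreviation half_line :: "real set \<Rightarrow> bool" where
  "half_line I \<equiv> I = {0<..} \<or> I = {..<0}"

text \<open>
  Both a sech profile and its derivative are dominated by a multiple of \<open>sech\<close>; this is the common
  source of their integrability and of the bound for the derivative.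
\<close>

lemma L2_of_sech_bound:
  fixes f :: "real \<Rightarrow> complex"
  assumes I: "half_line I" and B: "B > 0" and cont: "continuous_on I f"
    and bound: "\<And>x. x \<in> I \<Longrightarrow> cmod (f x) \<le> M * sech (B * x - C)"
  shows "f \<in> L2 I" "L2_sqnorm I f \<le> M\<^sup>2 * (LINT x:I|lborel. (sech (B * x - C))\<^sup>2)"
proof -
  have "open I" and Ib: "I \<in> sets borel" using I by auto
  have int: "set_integrable lborel I (\<lambda>x. M\<^sup>2 * (sech (B * x - C))\<^sup>2)"
    using set_integral_sech_power2(1,3)[OF B, of C] I by (auto intro: set_integrable_mult_right)
  have le: "(cmod (f x))\<^sup>2 \<le> M\<^sup>2 * (sech (B * x - C))\<^sup>2" if "x \<in> I" for x
    using power_mono[OF bound[OF that], of 2] by (simp add: power_mult_distrib)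
  have int_f: "set_integrable lborel I (\<lambda>x. (cmod (f x))\<^sup>2)"
  proof (rule set_integrable_bound[OF int])
    show "set_borel_measurable lborel I (\<lambda>x. (cmod (f x))\<^sup>2)"
    proof -
      have "(\<lambda>x. indicator I x *\<^sub>R (cmod (f x))\<^sup>2) \<in> borel_measurable borel"
        by (rule borel_measurable_continuous_on_indicator[OF Ib]) (intro continuous_intros cont)
      then show ?thesis by (simp add: set_borel_measurable_def)
    qed
    show "AE x in lborel. x \<in> I \<longrightarrow> norm ((cmod (f x))\<^sup>2) \<le> norm (M\<^sup>2 * (sech (B * x - C))\<^sup>2)"
      using le by (intro AE_I2) auto
  qed
  show "f \<in> L2 I" by (rule L2_sqnorm_lborel(1)[OF cont \<open>open I\<close> int_f])
  have "L2_sqnorm I f = (LINT x:I|lborel. (cmod (f x))\<^sup>2)"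
    by (rule L2_sqnorm_lborel(2)[OF cont \<open>open I\<close> int_f])
  also have "\<dots> \<le> (LINT x:I|lborel. M\<^sup>2 * (sech (B * x - C))\<^sup>2)"
    by (rule set_integral_mono[OF int_f int le])
  finally show "L2_sqnorm I f \<le> M\<^sup>2 * (LINT x:I|lborel. (sech (B * x - C))\<^sup>2)" by simp
qed

definition sech_profile_deriv :: "real \<Rightarrow> real \<Rightarrow> real \<Rightarrow> real \<Rightarrow> complex" where
  "sech_profile_deriv A B C = (\<lambda>x. of_real (- (A * B) * sech (B * x - C) * tanh (B * x - C)))"

lemma cmod_sech_profile: "cmod (sech_profile A B C x) = \<bar>A\<bar> * sech (B * x - C)"
  using sech_pos[of "B * x - C"] by (simp add: sech_profile_def abs_mult del: sech_pos of_real_mult)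

lemma cmod_sech_profile_deriv_le:
  "cmod (sech_profile_deriv A B C x) \<le> \<bar>A * B\<bar> * sech (B * x - C)"
proof -
  have "\<bar>tanh (B * x - C)\<bar> \<le> 1"
    using tanh_real_bounds[of "B * x - C"] by auto
  then have "\<bar>A * B\<bar> * sech (B * x - C) * \<bar>tanh (B * x - C)\<bar> \<le> \<bar>A * B\<bar> * sech (B * x - C)"
    using sech_pos[of "B * x - C"] by (intro mult_left_le) (auto simp: less_imp_le)
  then show ?thesis
    using sech_pos[of "B * x - C"]
    by (simp add: sech_profile_deriv_def abs_mult norm_mult del: sech_pos of_real_mult)
qed

lemma continuous_on_sech_profile [continuous_intros]:
  "continuous_on S (sech_profile A B C)" "continuous_on S (sech_profile_deriv A B C)"
  unfolding sech_profile_def sech_profile_deriv_def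
  by (intro continuous_intros; simp)+

lemma classical_H1_sech_profile:
  assumes I: "half_line I" and B: "B > 0"
  shows "classical_H1 I (sech_profile A B C) (sech_profile_deriv A B C)"
  unfolding classical_H1_def
proof (intro conjI ballI)
  fix x
  have "((\<lambda>x. A * sech (B * x - C)) has_real_derivative - (A * B) * sech (B * x - C) * tanh (B * x - C)) (at x)"
    by (auto intro!: derivative_eq_intros)
  then show "(sech_profile A B C has_vector_derivative sech_profile_deriv A B C x) (at x)"
    unfolding sech_profile_def sech_profile_deriv_def by (rule has_vector_derivative_of_real)
  show "sech_profile A B C \<in> L2 I"
    by (rule L2_of_sech_bound(1)[OF assms continuous_on_sech_profile(1), of _ _ _ "\<bar>A\<bar>" C])
      (simp add: cmod_sech_profile)
  show "sech_profile_deriv A B C \<in> L2 I"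
    by (rule L2_of_sech_bound(1)[OF assms continuous_on_sech_profile(2)])
      (rule cmod_sech_profile_deriv_le)
qed (rule continuous_on_sech_profile)

lemma L2_sqnorm_sech_profile:
  assumes "B > 0"
  shows "L2_sqnorm {0<..} (sech_profile A B C) = A\<^sup>2 * (1 + tanh C) / B"
    and "L2_sqnorm {..<0} (sech_profile A B C) = A\<^sup>2 * (1 - tanh C) / B"
    and "L2_sqnorm {0<..} (sech_profile_deriv A B C) \<le> (A * B)\<^sup>2 * (1 + tanh C) / B"
    and "L2_sqnorm {..<0} (sech_profile_deriv A B C) \<le> (A * B)\<^sup>2 * (1 - tanh C) / B"
proof -
  note int = set_integral_sech_power2[OF assms, of C]
  have sq: "(cmod (sech_profile A B C x))\<^sup>2 = A\<^sup>2 * (sech (B * x - C))\<^sup>2" for x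
    by (simp add: cmod_sech_profile power_mult_distrib)
  show "L2_sqnorm {0<..} (sech_profile A B C) = A\<^sup>2 * (1 + tanh C) / B"
    by (subst L2_sqnorm_lborel(2)[OF continuous_on_sech_profile(1)])
      (simp_all add: sq int set_integrable_mult_right)
  show "L2_sqnorm {..<0} (sech_profile A B C) = A\<^sup>2 * (1 - tanh C) / B"
    by (subst L2_sqnorm_lborel(2)[OF continuous_on_sech_profile(1)])
      (simp_all add: sq int set_integrable_mult_right)
  show "L2_sqnorm {0<..} (sech_profile_deriv A B C) \<le> (A * B)\<^sup>2 * (1 + tanh C) / B"
    using L2_of_sech_bound(2)[OF _ assms continuous_on_sech_profile(2) cmod_sech_profile_deriv_le, of "{0<..}" A C]
    by (simp add: int)
  show "L2_sqnorm {..<0} (sech_profile_deriv A B C) \<le> (A * B)\<^sup>2 * (1 - tanh C) / B"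
    using L2_of_sech_bound(2)[OF _ assms continuous_on_sech_profile(2) cmod_sech_profile_deriv_le, of "{..<0}" A C]
    by (simp add: int)
qed

lemma exp_minus_abs_le_sech: "exp (- \<bar>x\<bar>) \<le> sech x"
proof -
  have "cosh x = cosh \<bar>x\<bar>" by (simp add: abs_if)
  also have "\<dots> \<le> exp \<bar>x\<bar>" by (simp add: cosh_def)
  finally show ?thesis by (simp add: sech_def exp_minus field_simps)
qed

text \<open>
  An integrable majorant that does not depend on \<open>B\<close> and \<open>C\<close>, as long as \<open>B\<close> stays above \<open>b\<close> and
  \<open>C\<close> stays bounded.
\<close>

lemma sech_affine_le:
  assumes "0 \<le> b" "b \<le> B"
  shows "sech (B * x - C) \<le> 2 * exp \<bar>C\<bar> * sech (b * x)"
proof -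
  have "sech (B * x - C) \<le> 2 * exp (- \<bar>B * x - C\<bar>)" by (rule sech_le_exp)
  also have "\<dots> \<le> 2 * exp (\<bar>C\<bar> - \<bar>b * x\<bar>)"
  proof -
    have "\<bar>b * x\<bar> \<le> \<bar>B * x\<bar>" using assms by (simp add: abs_mult mult_right_mono)
    then show ?thesis by simp
  qed
  also have "\<dots> = 2 * exp \<bar>C\<bar> * exp (- \<bar>b * x\<bar>)" by (simp add: exp_diff exp_minus field_simps)
  also have "\<dots> \<le> 2 * exp \<bar>C\<bar> * sech (b * x)"
    by (intro mult_left_mono exp_minus_abs_le_sech) auto
  finally show ?thesis .
qed

text \<open>
  The bounded factor \<open>g\<close> allows one application of dominated convergence to serve for the profile
  (\<open>g = 1\<close>) and for its derivative (\<open>g = tanh\<close>).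
\<close>

lemma tendsto_L2_sech_times:
  fixes g a B C :: "real \<Rightarrow> real"
  assumes I: "half_line I" and g: "continuous_on UNIV g" "\<And>x. \<bar>g x\<bar> \<le> 1"
    and a: "(a \<longlongrightarrow> a0) at_top" and B: "(B \<longlongrightarrow> B0) at_top" "B0 > 0" and C: "(C \<longlongrightarrow> C0) at_top"
  shows "((\<lambda>i. L2_sqnorm I (\<lambda>x. of_real (a i * sech (B i * x - C i) * g (B i * x - C i)) -
            of_real (a0 * sech (B0 * x - C0) * g (B0 * x - C0)))) \<longlongrightarrow> 0) at_top"
proof -
  define u where "u = (\<lambda>i x. complex_of_real (a i * sech (B i * x - C i) * g (B i * x - C i)) -
            of_real (a0 * sech (B0 * x - C0) * g (B0 * x - C0)))"
  define b where "b = B0 / 2"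
  \<comment> \<open>Twice the bound of one profile of amplitude at most \<open>\<bar>a0\<bar> + 1\<close>, as \<open>u\<close> is a difference of two.\<close>
  define M where "M = 4 * (\<bar>a0\<bar> + 1) * exp (\<bar>C0\<bar> + 1)"
  have b: "b > 0" using B by (simp add: b_def)
  have Il: "I \<in> sets lebesgue" using I by auto
  have contg: "continuous_on UNIV (\<lambda>x. g (h x))" if "continuous_on UNIV h" for h :: "real \<Rightarrow> real"
    using continuous_on_compose2[OF g(1) that] by simp
  have contu: "continuous_on UNIV (u i)" for i
    unfolding u_def by (intro continuous_intros contg)
  have bound: "\<bar>a' * sech (B' * x - C') * g (B' * x - C')\<bar> \<le> M / 2 * sech (b * x)"
    if "\<bar>a'\<bar> \<le> \<bar>a0\<bar> + 1" "b \<le> B'" "\<bar>C'\<bar> \<le> \<bar>C0\<bar> + 1" for a' B' C' x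
  proof -
    have "\<bar>a' * sech (B' * x - C') * g (B' * x - C')\<bar> = \<bar>a'\<bar> * sech (B' * x - C') * \<bar>g (B' * x - C')\<bar>"
      by (simp add: abs_mult less_imp_le)
    also have "\<dots> \<le> \<bar>a'\<bar> * sech (B' * x - C')"
      using g(2) by (intro mult_left_le) (auto simp: less_imp_le)
    also have "\<dots> \<le> (\<bar>a0\<bar> + 1) * (2 * exp \<bar>C'\<bar> * sech (b * x))"
      using b that by (intro mult_mono sech_affine_le) (auto simp: less_imp_le)
    also have "\<dots> \<le> (\<bar>a0\<bar> + 1) * (2 * exp (\<bar>C0\<bar> + 1) * sech (b * x))"
      using that by (intro mult_left_mono mult_right_mono) (auto simp: less_imp_le)
    also have "\<dots> = M / 2 * sech (b * x)" by (simp add: M_def algebra_simps)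
    finally show ?thesis .
  qed
  have ev: "\<forall>\<^sub>F i in at_top. \<forall>x. cmod (u i x) \<le> M * sech (b * x)"
  proof -
    have "\<forall>\<^sub>F i in at_top. \<bar>a i\<bar> < \<bar>a0\<bar> + 1"
      by (rule order_tendstoD(2)[OF tendsto_rabs[OF a]]) simp
    moreover have "\<forall>\<^sub>F i in at_top. b < B i"
      by (rule order_tendstoD(1)[OF B(1)]) (use B in \<open>simp add: b_def\<close>)
    moreover have "\<forall>\<^sub>F i in at_top. \<bar>C i\<bar> < \<bar>C0\<bar> + 1"
      by (rule order_tendstoD(2)[OF tendsto_rabs[OF C]]) simp
    ultimately show ?thesis
    proof eventually_elim
      case (elim i)
      show ?case
      proof
        fix x
        have "cmod (u i x) \<le> \<bar>a i * sech (B i * x - C i) * g (B i * x - C i)\<bar> + \<bar>a0 * sech (B0 * x - C0) * g (B0 * x - C0)\<bar>"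
          unfolding u_def by (rule order_trans[OF norm_triangle_ineq4]) (simp only: norm_of_real order_refl)
        also have "\<dots> \<le> M / 2 * sech (b * x) + M / 2 * sech (b * x)"
          using elim B(2) by (intro add_mono bound) (auto simp: b_def)
        finally show "cmod (u i x) \<le> M * sech (b * x)" by simp
      qed
    qed
  qed
  have "((\<lambda>i. LINT x|lebesgue_on I. (cmod (u i x))\<^sup>2) \<longlongrightarrow> (LINT x|lebesgue_on I. 0)) at_top"
  proof (rule integral_dominated_convergence_at_top[where w = "\<lambda>x. (M * sech (b * x))\<^sup>2"])
    show "(\<lambda>x. (cmod (u i x))\<^sup>2) \<in> borel_measurable (lebesgue_on I)" for i
      by (intro continuous_imp_measurable_on_sets_lebesgue Il continuous_intros
          continuous_on_subset[OF contu]) simp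
    have "sech_profile M b 0 \<in> L2 I"
      using classical_H1_sech_profile[OF I b] by (simp add: classical_H1_def)
    then show "integrable (lebesgue_on I) (\<lambda>x. (M * sech (b * x))\<^sup>2)"
      by (simp add: L2_def cmod_sech_profile power_mult_distrib)
    show "\<forall>\<^sub>F i in at_top. AE x in lebesgue_on I. norm ((cmod (u i x))\<^sup>2) \<le> (M * sech (b * x))\<^sup>2"
      using ev by eventually_elim (intro AE_I2, simp add: power_mono)
    show "AE x in lebesgue_on I. ((\<lambda>i. (cmod (u i x))\<^sup>2) \<longlongrightarrow> 0) at_top"
    proof (rule AE_I2)
      fix x
      have lin: "((\<lambda>i. B i * x - C i) \<longlongrightarrow> B0 * x - C0) at_top" by (intro tendsto_intros B C)
      have "((\<lambda>i. g (B i * x - C i)) \<longlongrightarrow> g (B0 * x - C0)) at_top"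
        using g(1) lin by (auto simp: continuous_on_eq_continuous_at intro: isCont_tendsto_compose)
      then have "((\<lambda>i. u i x) \<longlongrightarrow> of_real (a0 * sech (B0 * x - C0) * g (B0 * x - C0)) -
            of_real (a0 * sech (B0 * x - C0) * g (B0 * x - C0))) at_top"
        unfolding u_def by (intro tendsto_intros a lin)
      then have "((\<lambda>i. u i x) \<longlongrightarrow> 0) at_top" by simp
      then have "((\<lambda>i. (cmod (u i x))\<^sup>2) \<longlongrightarrow> (cmod 0)\<^sup>2) at_top" by (intro tendsto_intros)
      then show "((\<lambda>i. (cmod (u i x))\<^sup>2) \<longlongrightarrow> 0) at_top" by simp
    qed
  qed simp
  then show ?thesis by (simp add: L2_sqnorm_def u_def)
qed

lemma tendsto_L2_sech_profile:
  fixes A B C :: "real \<Rightarrow> real"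
  assumes I: "half_line I"
    and A: "(A \<longlongrightarrow> A0) at_top" and B: "(B \<longlongrightarrow> B0) at_top" "B0 > 0" and C: "(C \<longlongrightarrow> C0) at_top"
  shows "((\<lambda>i. L2_sqnorm I (\<lambda>x. sech_profile (A i) (B i) (C i) x - sech_profile A0 B0 C0 x)) \<longlongrightarrow> 0) at_top"
    and "((\<lambda>i. L2_sqnorm I (\<lambda>x. sech_profile_deriv (A i) (B i) (C i) x - sech_profile_deriv A0 B0 C0 x)) \<longlongrightarrow> 0) at_top"
proof -
  show "((\<lambda>i. L2_sqnorm I (\<lambda>x. sech_profile (A i) (B i) (C i) x - sech_profile A0 B0 C0 x)) \<longlongrightarrow> 0) at_top"
    using tendsto_L2_sech_times[of I "\<lambda>_. 1", OF I _ _ A B C] by (simp add: sech_profile_def)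
  have "continuous_on UNIV (tanh :: real \<Rightarrow> real)" by (intro continuous_intros) simp
  moreover have "\<bar>tanh x\<bar> \<le> 1" for x :: real using tanh_real_bounds[of x] by auto
  moreover have "((\<lambda>i. - (A i * B i)) \<longlongrightarrow> - (A0 * B0)) at_top" by (intro tendsto_intros A B)
  ultimately show "((\<lambda>i. L2_sqnorm I (\<lambda>x. sech_profile_deriv (A i) (B i) (C i) x - sech_profile_deriv A0 B0 C0 x)) \<longlongrightarrow> 0) at_top"
    using tendsto_L2_sech_times[of I tanh, OF I _ _ _ B C] unfolding sech_profile_deriv_def by blast
qed

section \<open>Strong and weak convergence in Q\<close>

text \<open>
  The two components of an element of \<open>Q\<close> as one function on the line.
\<close>

definition glue :: "(real \<Rightarrow> complex) \<Rightarrow> (real \<Rightarrow> complex) \<Rightarrow> real \<Rightarrow> complex" where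
  "glue f g = (\<lambda>x. if x < 0 then f x else g x)"

lemma classical_H1_glue:
  "classical_H1 {..<0} f f' \<Longrightarrow> classical_H1 {..<0} (glue f g) (glue f' g')"
  "classical_H1 {0<..} g g' \<Longrightarrow> classical_H1 {0<..} (glue f g) (glue f' g')"
  by (rule classical_H1_cong; simp add: glue_def)+

lemma Q_norm_nonneg: "Q_norm f \<ge> 0"
  by (simp add: Q_norm_def)

lemma tendsto_strongly_in_Q_cong:
  assumes "\<forall>\<^sub>F i in F. u i = u' i" "tendsto_strongly_in_Q u' v F"
  shows "tendsto_strongly_in_Q u v F"
proof -
  have "\<forall>\<^sub>F i in F. u i \<in> Q"
    using assms unfolding tendsto_strongly_in_Q_def by (auto elim: eventually_elim2)
  moreover have "((\<lambda>i. Q_norm (\<lambda>x. u i x - v x)) \<longlongrightarrow> 0) F"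
    using assms unfolding tendsto_strongly_in_Q_def
    by (subst tendsto_cong[of _ "\<lambda>i. Q_norm (\<lambda>x. u' i x - v x)"]) (auto elim: eventually_mono)
  ultimately show ?thesis using assms unfolding tendsto_strongly_in_Q_def by blast
qed

lemma tendsto_strongly_in_Q_glue:
  assumes f: "\<forall>\<^sub>F i in F. classical_H1 {..<0} (f i) (f' i)" and g: "\<forall>\<^sub>F i in F. classical_H1 {0<..} (g i) (g' i)"
    and f0: "classical_H1 {..<0} f0 f0'" and g0: "classical_H1 {0<..} g0 g0'"
    and v: "\<And>x. x < 0 \<Longrightarrow> v x = f0 x" "\<And>x. x > 0 \<Longrightarrow> v x = g0 x"
    and lim: "((\<lambda>i. L2_sqnorm {..<0} (\<lambda>x. f i x - f0 x)) \<longlongrightarrow> 0) F"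
      "((\<lambda>i. L2_sqnorm {..<0} (\<lambda>x. f' i x - f0' x)) \<longlongrightarrow> 0) F"
      "((\<lambda>i. L2_sqnorm {0<..} (\<lambda>x. g i x - g0 x)) \<longlongrightarrow> 0) F"
      "((\<lambda>i. L2_sqnorm {0<..} (\<lambda>x. g' i x - g0' x)) \<longlongrightarrow> 0) F"
  shows "tendsto_strongly_in_Q (\<lambda>i. glue (f i) (g i)) v F"
proof -
  have v_left: "classical_H1 {..<0} v (glue f0' g0')"
    by (rule classical_H1_cong[OF _ _ _ f0]) (auto simp: glue_def v)
  have v_right: "classical_H1 {0<..} v (glue f0' g0')"
    by (rule classical_H1_cong[OF _ _ _ g0]) (auto simp: glue_def v)
  have "v \<in> Q" by (rule Q_norm_classical(1)[OF v_right v_left])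
  moreover have "\<forall>\<^sub>F i in F. glue (f i) (g i) \<in> Q"
    using f g by eventually_elim (rule Q_norm_classical(1)[OF classical_H1_glue(2,1)])
  moreover have "((\<lambda>i. Q_norm (\<lambda>x. glue (f i) (g i) x - v x)) \<longlongrightarrow> 0) F"
  proof -
    define h where "h = (\<lambda>i. sqrt (L2_sqnorm {0<..} (\<lambda>x. g i x - g0 x) + L2_sqnorm {0<..} (\<lambda>x. g' i x - g0' x)
        + (L2_sqnorm {..<0} (\<lambda>x. f i x - f0 x) + L2_sqnorm {..<0} (\<lambda>x. f' i x - f0' x))))"
    have "\<forall>\<^sub>F i in F. Q_norm (\<lambda>x. glue (f i) (g i) x - v x) = h i"
      using f g
    proof eventually_elim
      case (elim i)
      have "Q_norm (\<lambda>x. glue (f i) (g i) x - v x) =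
          sqrt (L2_sqnorm {0<..} (\<lambda>x. glue (f i) (g i) x - v x) + L2_sqnorm {0<..} (\<lambda>x. glue (f' i) (g' i) x - glue f0' g0' x)
            + (L2_sqnorm {..<0} (\<lambda>x. glue (f i) (g i) x - v x) + L2_sqnorm {..<0} (\<lambda>x. glue (f' i) (g' i) x - glue f0' g0' x)))"
        by (intro Q_norm_classical(2) classical_H1_diff v_left v_right classical_H1_glue elim)
      moreover have "L2_sqnorm {0<..} (\<lambda>x. glue (f i) (g i) x - v x) = L2_sqnorm {0<..} (\<lambda>x. g i x - g0 x)"
        "L2_sqnorm {0<..} (\<lambda>x. glue (f' i) (g' i) x - glue f0' g0' x) = L2_sqnorm {0<..} (\<lambda>x. g' i x - g0' x)"
        "L2_sqnorm {..<0} (\<lambda>x. glue (f i) (g i) x - v x) = L2_sqnorm {..<0} (\<lambda>x. f i x - f0 x)"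
        "L2_sqnorm {..<0} (\<lambda>x. glue (f' i) (g' i) x - glue f0' g0' x) = L2_sqnorm {..<0} (\<lambda>x. f' i x - f0' x)"
        by (rule L2_cong(2); simp add: glue_def v)+
      ultimately show ?case by (simp add: h_def)
    qed
    moreover have "(h \<longlongrightarrow> sqrt (0 + 0 + (0 + 0))) F"
      unfolding h_def by (intro tendsto_intros lim)
    ultimately show ?thesis by (simp add: tendsto_cong)
  qed
  ultimately show ?thesis by (simp add: tendsto_strongly_in_Q_def)
qed

lemma Q_dual_bound:
  assumes "l \<in> Q_dual"
  obtains K where "K \<ge> 0" "\<And>f. f \<in> Q \<Longrightarrow> cmod (l f) \<le> K * Q_norm f"
proof -
  have "\<exists>K. \<forall>f\<in>Q. cmod (l f) \<le> K * Q_norm f" using assms by (simp add: Q_dual_def)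
  then obtain K where K: "\<And>f. f \<in> Q \<Longrightarrow> cmod (l f) \<le> K * Q_norm f" by blast
  have "cmod (l f) \<le> \<bar>K\<bar> * Q_norm f" if "f \<in> Q" for f
    using K[OF that] mult_right_mono[OF abs_ge_self[of K] Q_norm_nonneg[of f]] by linarith
  then show ?thesis using that[of "\<bar>K\<bar>"] by simp
qed

lemma Q_dual_add: "l \<in> Q_dual \<Longrightarrow> f \<in> Q \<Longrightarrow> g \<in> Q \<Longrightarrow> l (\<lambda>x. f x + g x) = l f + l g"
  and Q_dual_mult: "l \<in> Q_dual \<Longrightarrow> f \<in> Q \<Longrightarrow> l (\<lambda>x. c * f x) = c * l f"
  by (auto simp: Q_dual_def)

text \<open>
  The form in which weak convergence arises here: one part converges in norm and the other one
  is annihilated in the limit by every functional.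
\<close>

lemma tendsto_weakly_in_Q_add_null:
  assumes u: "tendsto_strongly_in_Q u v F" and p: "\<forall>\<^sub>F i in F. p i \<in> Q"
    and null: "\<And>l. l \<in> Q_dual \<Longrightarrow> ((\<lambda>i. l (p i)) \<longlongrightarrow> 0) F"
    and w: "\<forall>\<^sub>F i in F. w i = (\<lambda>x. u i x + p i x)"
  shows "tendsto_weakly_in_Q w v F"
proof -
  have v: "v \<in> Q" and uQ: "\<forall>\<^sub>F i in F. u i \<in> Q" and lim: "((\<lambda>i. Q_norm (\<lambda>x. u i x - v x)) \<longlongrightarrow> 0) F"
    using u by (auto simp: tendsto_strongly_in_Q_def)
  have "\<forall>\<^sub>F i in F. w i \<in> Q"
    using w uQ p by eventually_elim (simp add: Q_add)
  moreover have "((\<lambda>i. l (w i)) \<longlongrightarrow> l v) F" if l: "l \<in> Q_dual" for l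
  proof -
    obtain K where K: "\<And>f. f \<in> Q \<Longrightarrow> cmod (l f) \<le> K * Q_norm f"
      using Q_dual_bound[OF l] by blast
    have diffQ: "(\<lambda>x. f x - v x) \<in> Q" if "f \<in> Q" for f
      using Q_add[OF that Q_mult_const[OF v, of "-1"]] by simp
    have "((\<lambda>i. l (\<lambda>x. u i x - v x)) \<longlongrightarrow> 0) F"
    proof (rule Lim_null_comparison)
      show "\<forall>\<^sub>F i in F. cmod (l (\<lambda>x. u i x - v x)) \<le> K * Q_norm (\<lambda>x. u i x - v x)"
        using uQ by eventually_elim (rule K[OF diffQ])
      show "((\<lambda>i. K * Q_norm (\<lambda>x. u i x - v x)) \<longlongrightarrow> 0) F"
        by (rule tendsto_mult_right_zero[OF lim])
    qed
    then have "((\<lambda>i. l (\<lambda>x. u i x - v x) + (l v + l (p i))) \<longlongrightarrow> 0 + (l v + 0)) F"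
      by (intro tendsto_add tendsto_const null l)
    moreover have "\<forall>\<^sub>F i in F. l (\<lambda>x. u i x - v x) + (l v + l (p i)) = l (w i)"
      using w uQ p
    proof eventually_elim
      case (elim i)
      have "w i = (\<lambda>x. (u i x - v x) + (v x + p i x))" using elim by simp
      then show ?case
        using Q_dual_add[OF l diffQ[OF elim(2)] Q_add[OF v elim(3)]] Q_dual_add[OF l v elim(3)] by simp
    qed
    ultimately show ?thesis by (simp add: tendsto_cong)
  qed
  ultimately show ?thesis using v by (simp add: tendsto_weakly_in_Q_def)
qed

section \<open>Weak convergence of an escaping soliton\<close>

text \<open>
  Reduces the integrability of \<open>sech\<close> to that of \<open>sech\<^sup>2\<close>.
\<close>

lemma sech_le_sech_half_power2: "sech x \<le> (sech (x / 2))\<^sup>2"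
proof -
  have "cosh x = 2 * (cosh (x / 2))\<^sup>2 - 1"
    using cosh_double_cosh[of "x / 2"] by simp
  moreover have "(cosh (x / 2))\<^sup>2 \<ge> 1"
    using cosh_real_ge_1[of "x / 2"] by (simp add: one_le_power)
  ultimately have "(cosh (x / 2))\<^sup>2 \<le> cosh x" by simp
  then have "1 / cosh x \<le> 1 / (cosh (x / 2))\<^sup>2"
    using \<open>(cosh (x / 2))\<^sup>2 \<ge> 1\<close> by (intro divide_left_mono mult_pos_pos) auto
  then show ?thesis by (simp add: sech_def power_divide)
qed

lemma integrable_sech:
  fixes B C :: real
  assumes "B > 0"
  shows "integrable (lebesgue_on {0<..}) (\<lambda>x. sech (B * x - C))"
    and "integrable (lebesgue_on {0<..}) (\<lambda>x. (sech (B * x - C))\<^sup>2)"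
    and "(LINT x|lebesgue_on {0<..}. (sech (B * x - C))\<^sup>2) \<le> 2 / B"
proof -
  have sq: "integrable (lebesgue_on {0<..}) (\<lambda>x. (sech (B * x - C))\<^sup>2)" if "B > 0" for B C
    using classical_H1_sech_profile[of "{0<..}" B 1 C] that
    by (simp add: classical_H1_def L2_def cmod_sech_profile)
  show "integrable (lebesgue_on {0<..}) (\<lambda>x. (sech (B * x - C))\<^sup>2)" by (rule sq[OF assms])
  show "integrable (lebesgue_on {0<..}) (\<lambda>x. sech (B * x - C))"
  proof (rule Bochner_Integration.integrable_bound[OF sq[of "B / 2" "C / 2"]])
    show "(\<lambda>x. sech (B * x - C)) \<in> borel_measurable (lebesgue_on {0<..})"
      by (intro continuous_imp_measurable_on_sets_lebesgue continuous_intros) auto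
    show "AE x in lebesgue_on {0<..}. norm (sech (B * x - C)) \<le> norm ((sech (B / 2 * x - C / 2))\<^sup>2)"
      using sech_le_sech_half_power2[of "B * x - C" for x] by (intro AE_I2) (simp add: diff_divide_distrib less_imp_le)
  qed (use assms in simp)
  have "(LINT x|lebesgue_on {0<..}. (sech (B * x - C))\<^sup>2) = L2_sqnorm {0<..} (sech_profile 1 B C)"
    by (simp add: L2_sqnorm_def cmod_sech_profile)
  also have "\<dots> = (1 + tanh C) / B"
    using L2_sqnorm_sech_profile(1)[OF assms, of 1 C] by simp
  also have "\<dots> \<le> 2 / B"
    using assms tanh_real_lt_1[of C] by (intro divide_right_mono) auto
  finally show "(LINT x|lebesgue_on {0<..}. (sech (B * x - C))\<^sup>2) \<le> 2 / B" .
qed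

text \<open>
  The right component is an escaping soliton. Suppose \<open>cmod (l (p i)) \<ge> \<epsilon>\<close> for arbitrarily large \<open>i\<close>.
  By induction on \<open>n\<close> there is a combination \<open>g\<close> of \<open>n\<close> bumps with unimodular coefficients such that
  \<open>l g\<close> is real and at least \<open>n * \<epsilon>\<close>, whereas the sum \<open>G\<close> of their moduli, which dominates \<open>g\<close> and,
  up to the factor \<open>\<beta>\<close>, also \<open>g'\<close>, has squared norm at most \<open>n * (M + 1)\<close>: the next bump is taken
  so far out that its overlap with \<open>G\<close> is negligible. For large \<open>n\<close> this contradicts the
  boundedness of \<open>l\<close>.
\<close>

lemma tendsto_Q_dual_escaping_profile:
  fixes A B C :: "real \<Rightarrow> real"
  assumes A: "(A \<longlongrightarrow> A0) at_top" and B: "(B \<longlongrightarrow> B0) at_top" "B0 > 0" and C: "filterlim C at_top at_top"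
    and l: "l \<in> Q_dual"
  shows "((\<lambda>i. l (glue (\<lambda>_. 0) (sech_profile (A i) (B i) (C i)))) \<longlongrightarrow> 0) at_top"
proof (rule ccontr)
  define p where "p = (\<lambda>i. glue (\<lambda>_. 0) (sech_profile (A i) (B i) (C i)))"
  define p' where "p' = (\<lambda>i. glue (\<lambda>_. 0) (sech_profile_deriv (A i) (B i) (C i)))"
  define w where "w = (\<lambda>i x. \<bar>A i\<bar> * sech (B i * x - C i))"
  assume "\<not> ((\<lambda>i. l (glue (\<lambda>_. 0) (sech_profile (A i) (B i) (C i)))) \<longlongrightarrow> 0) at_top"
  then have "\<not> ((\<lambda>i. l (p i)) \<longlongrightarrow> 0) at_top" by (simp only: p_def not_False_eq_True)
  then obtain \<epsilon> where \<epsilon>: "\<epsilon> > 0" and freq: "\<exists>\<^sub>F i in at_top. cmod (l (p i)) \<ge> \<epsilon>"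
    by (auto simp: tendsto_iff not_eventually not_less)
  define \<alpha> where "\<alpha> = \<bar>A0\<bar> + 1"
  define b where "b = B0 / 2"
  define \<beta> where "\<beta> = B0 + 1"
  \<comment> \<open>A bound for the squared norm of every bump with amplitude below \<open>\<alpha>\<close> and rate above \<open>b\<close>.\<close>
  define M where "M = \<alpha>\<^sup>2 * (2 / b)"
  have pos: "\<alpha> > 0" "b > 0" "\<beta> > 0" "M \<ge> 0" using B(2) by (auto simp: \<alpha>_def b_def \<beta>_def M_def)
  have evA: "\<forall>\<^sub>F i in at_top. \<bar>A i\<bar> < \<alpha>"
    by (rule order_tendstoD(2)[OF tendsto_rabs[OF A]]) (simp add: \<alpha>_def)
  have evB: "\<forall>\<^sub>F i in at_top. b < B i" "\<forall>\<^sub>F i in at_top. B i < \<beta>"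
    by (rule order_tendstoD(1)[OF B(1)], use B(2) in \<open>simp add: b_def\<close>)
      (rule order_tendstoD(2)[OF B(1)], simp add: \<beta>_def)
  obtain K where K: "K \<ge> 0" "\<And>f. f \<in> Q \<Longrightarrow> cmod (l f) \<le> K * Q_norm f"
    using Q_dual_bound[OF l] by blast
  have meas_w: "w i \<in> borel_measurable (lebesgue_on {0<..})" for i
    unfolding w_def by (intro continuous_imp_measurable_on_sets_lebesgue continuous_intros) auto
  have w_nonneg: "w i x \<ge> 0" for i x by (simp add: w_def less_imp_le)
  have w_le: "w i x \<le> \<bar>A i\<bar>" for i x
    unfolding w_def by (intro mult_left_le) auto
  have w_lim: "((\<lambda>i. w i x) \<longlongrightarrow> 0) at_top" for x
  proof -
    have "filterlim (\<lambda>i. - (B i * x) + C i) at_top at_top"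
      by (rule filterlim_tendsto_add_at_top[OF tendsto_minus[OF tendsto_mult[OF B(1) tendsto_const]] C])
    from filterlim_compose[OF tendsto_sech_at_top this]
    have "((\<lambda>i. sech (- (B i * x) + C i)) \<longlongrightarrow> 0) at_top" .
    moreover have "sech (- (B i * x) + C i) = sech (B i * x - C i)" for i
      using cosh_minus[of "B i * x - C i"] by (simp add: sech_def)
    ultimately have "((\<lambda>i. sech (B i * x - C i)) \<longlongrightarrow> 0) at_top" by simp
    from tendsto_mult[OF tendsto_rabs[OF A] this] show ?thesis by (simp add: w_def)
  qed
  \<comment> \<open>Far-out bumps are almost orthogonal to any fixed integrable function.\<close>
  have cross: "((\<lambda>i. LINT x|lebesgue_on {0<..}. G x * w i x) \<longlongrightarrow> 0) at_top"
    if G: "integrable (lebesgue_on {0<..}) G" "\<And>x. G x \<ge> 0" for G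
  proof -
    have "((\<lambda>i. LINT x|lebesgue_on {0<..}. G x * w i x) \<longlongrightarrow> (LINT x|lebesgue_on {0::real<..}. 0)) at_top"
    proof (rule integral_dominated_convergence_at_top[where w = "\<lambda>x. \<alpha> * G x"])
      show "(\<lambda>x. G x * w i x) \<in> borel_measurable (lebesgue_on {0<..})" for i
        using meas_w[of i] borel_measurable_integrable[OF G(1)] by measurable
      show "integrable (lebesgue_on {0<..}) (\<lambda>x. \<alpha> * G x)" using G(1) by simp
      show "AE x in lebesgue_on {0<..}. ((\<lambda>i. G x * w i x) \<longlongrightarrow> 0) at_top"
        using tendsto_mult_right_zero[OF w_lim] by (intro AE_I2) blast
      show "\<forall>\<^sub>F i in at_top. AE x in lebesgue_on {0<..}. norm (G x * w i x) \<le> \<alpha> * G x"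
        using evA
      proof eventually_elim
        case (elim i)
        show ?case
        proof (rule AE_I2)
          fix x
          have "G x * w i x \<le> G x * \<alpha>"
            using w_le[of i x] elim G(2)[of x] by (intro mult_left_mono) auto
          then show "norm (G x * w i x) \<le> \<alpha> * G x"
            using G(2)[of x] w_nonneg[of i x] by (simp add: mult.commute)
        qed
      qed
    qed simp
    then show ?thesis by simp
  qed
  have step: "\<exists>g g' G. classical_H1 {..<0} g g' \<and> classical_H1 {0<..} g g' \<and>
      (\<forall>x<0. g x = 0 \<and> g' x = 0) \<and> (\<forall>x>0. cmod (g x) \<le> G x \<and> cmod (g' x) \<le> \<beta> * G x) \<and>
      (\<forall>x. G x \<ge> 0) \<and> integrable (lebesgue_on {0<..}) G \<and> integrable (lebesgue_on {0<..}) (\<lambda>x. (G x)\<^sup>2) \<and>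
      (LINT x|lebesgue_on {0<..}. (G x)\<^sup>2) \<le> real n * (M + 1) \<and>
      (\<exists>r. l g = of_real r \<and> r \<ge> real n * \<epsilon>)" for n
  proof (induction n)
    case 0
    have "(\<lambda>x. 0) \<in> Q" by (rule Q_norm_classical(1)[OF classical_H1_0 classical_H1_0])
    then have "l (\<lambda>x. 0) = of_real 0" using Q_dual_mult[OF l, of "\<lambda>x. 0" 0] by simp
    then show ?case
      by (intro exI[of _ "\<lambda>_. 0"] conjI exI[of _ 0]) (auto simp: classical_H1_0)
  next
    case (Suc n)
    then obtain g g' G r where g: "classical_H1 {..<0} g g'" "classical_H1 {0<..} g g'"
      and g_left: "\<And>x. x < 0 \<Longrightarrow> g x = 0 \<and> g' x = 0"
      and g_le: "\<And>x. x > 0 \<Longrightarrow> cmod (g x) \<le> G x \<and> cmod (g' x) \<le> \<beta> * G x"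
      and G: "\<And>x. G x \<ge> 0" "integrable (lebesgue_on {0<..}) G" "integrable (lebesgue_on {0<..}) (\<lambda>x. (G x)\<^sup>2)"
        "(LINT x|lebesgue_on {0<..}. (G x)\<^sup>2) \<le> real n * (M + 1)"
      and r: "l g = of_real r" "r \<ge> real n * \<epsilon>" by blast
    have "\<forall>\<^sub>F i in at_top. (LINT x|lebesgue_on {0<..}. G x * w i x) < 1 / 2"
      by (rule order_tendstoD(2)[OF cross[OF G(2,1)]]) simp
    then have "\<forall>\<^sub>F i in at_top. (LINT x|lebesgue_on {0<..}. G x * w i x) < 1 / 2 \<and> \<bar>A i\<bar> < \<alpha> \<and> b < B i \<and> B i < \<beta>"
      using evA evB by eventually_elim simp
    then have "\<exists>\<^sub>F i in at_top. cmod (l (p i)) \<ge> \<epsilon> \<and>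
       ((LINT x|lebesgue_on {0<..}. G x * w i x) < 1 / 2 \<and> \<bar>A i\<bar> < \<alpha> \<and> b < B i \<and> B i < \<beta>)"
      using freq by (rule frequently_eventually_frequently[rotated])
    then obtain i where i: "cmod (l (p i)) \<ge> \<epsilon>" "(LINT x|lebesgue_on {0<..}. G x * w i x) < 1 / 2"
      "\<bar>A i\<bar> < \<alpha>" "b < B i" "B i < \<beta>"
      by (auto dest: frequently_ex)
    have Bi: "B i > 0" using i(4) pos by simp
    have p: "classical_H1 {..<0} (p i) (p' i)" "classical_H1 {0<..} (p i) (p' i)"
      unfolding p_def p'_def using Bi
      by (auto intro!: classical_H1_glue classical_H1_0 classical_H1_sech_profile)
    have pQ: "p i \<in> Q" by (rule Q_norm_classical(1)[OF p(2,1)])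
    have gQ: "g \<in> Q" by (rule Q_norm_classical(1)[OF g(2,1)])
    \<comment> \<open>The phase that makes the contribution of the new bump to \<open>l\<close> real and positive.\<close>
    define c where "c = cnj (l (p i)) / of_real (cmod (l (p i)))"
    have lp: "cmod (l (p i)) > 0" using i(1) \<epsilon> by linarith
    have cmod_c: "cmod c = 1" using lp by (simp add: c_def norm_divide)
    have c: "c * l (p i) = of_real (cmod (l (p i)))"
    proof -
      have "c * l (p i) = (l (p i) * cnj (l (p i))) / of_real (cmod (l (p i)))" by (simp add: c_def)
      also have "l (p i) * cnj (l (p i)) = of_real (cmod (l (p i))) * of_real (cmod (l (p i)))"
        by (simp add: complex_norm_square[symmetric] power2_eq_square)
      finally show ?thesis using lp by simp
    qed
    have cpQ: "(\<lambda>x. c * p i x) \<in> Q"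
      by (rule Q_norm_classical(1)[OF classical_H1_mult_const classical_H1_mult_const, OF p(2,1)])
    have w2: "integrable (lebesgue_on {0<..}) (w i)" "integrable (lebesgue_on {0<..}) (\<lambda>x. (w i x)\<^sup>2)"
      "(LINT x|lebesgue_on {0<..}. (w i x)\<^sup>2) \<le> M"
    proof -
      show "integrable (lebesgue_on {0<..}) (w i)" "integrable (lebesgue_on {0<..}) (\<lambda>x. (w i x)\<^sup>2)"
        unfolding w_def using integrable_sech[OF Bi, of "C i"] by (simp_all add: power_mult_distrib)
      have "(LINT x|lebesgue_on {0<..}. (w i x)\<^sup>2) = (A i)\<^sup>2 * (LINT x|lebesgue_on {0<..}. (sech (B i * x - C i))\<^sup>2)"
        by (simp add: w_def power_mult_distrib)
      also have "\<dots> \<le> \<alpha>\<^sup>2 * (2 / b)"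
      proof (rule mult_mono)
        show "(A i)\<^sup>2 \<le> \<alpha>\<^sup>2" using i(3) by (simp add: abs_le_square_iff[symmetric])
        have "2 / B i \<le> 2 / b" using i(4) pos by (intro divide_left_mono) auto
        then show "(LINT x|lebesgue_on {0<..}. (sech (B i * x - C i))\<^sup>2) \<le> 2 / b"
          using integrable_sech(3)[OF Bi, of "C i"] by linarith
      qed auto
      finally show "(LINT x|lebesgue_on {0<..}. (w i x)\<^sup>2) \<le> M" by (simp add: M_def)
    qed
    have Gw: "integrable (lebesgue_on {0<..}) (\<lambda>x. G x * w i x)"
    proof (rule Bochner_Integration.integrable_bound)
      show "integrable (lebesgue_on {0<..}) (\<lambda>x. \<alpha> * G x)" using G(2) by simp
      show "(\<lambda>x. G x * w i x) \<in> borel_measurable (lebesgue_on {0<..})"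
        using meas_w[of i] borel_measurable_integrable[OF G(2)] by measurable
      show "AE x in lebesgue_on {0<..}. norm (G x * w i x) \<le> norm (\<alpha> * G x)"
      proof (rule AE_I2)
        fix x
        have "G x * w i x \<le> G x * \<alpha>"
          using w_le[of i x] i(3) G(1)[of x] by (intro mult_left_mono) auto
        then show "norm (G x * w i x) \<le> norm (\<alpha> * G x)"
          using G(1)[of x] w_nonneg[of i x] pos by (simp add: mult.commute)
      qed
    qed
    have sq: "(G x + w i x)\<^sup>2 = (G x)\<^sup>2 + (2 * (G x * w i x) + (w i x)\<^sup>2)" for x
      by (simp add: power2_sum)
    let ?g = "\<lambda>x. g x + c * p i x" and ?g' = "\<lambda>x. g' x + c * p' i x" and ?G = "\<lambda>x. G x + w i x"
    have N1: "classical_H1 {..<0} ?g ?g'" "classical_H1 {0<..} ?g ?g'"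
      by (intro classical_H1_add classical_H1_mult_const g p)+
    have N2: "\<forall>x<0. ?g x = 0 \<and> ?g' x = 0"
      using g_left by (simp add: p_def p'_def glue_def)
    have N3: "cmod (?g x) \<le> ?G x \<and> cmod (?g' x) \<le> \<beta> * ?G x" if "x > 0" for x
    proof
      have "cmod (?g x) \<le> cmod (g x) + cmod c * cmod (p i x)"
        by (rule order_trans[OF norm_triangle_ineq]) (simp add: norm_mult)
      also have "cmod (p i x) = w i x"
        using that by (simp add: p_def glue_def cmod_sech_profile w_def)
      finally show "cmod (?g x) \<le> ?G x" using g_le[OF that] cmod_c by simp
      have "cmod (?g' x) \<le> cmod (g' x) + cmod c * cmod (p' i x)"
        by (rule order_trans[OF norm_triangle_ineq]) (simp add: norm_mult)
      moreover have "cmod (p' i x) \<le> \<beta> * w i x"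
      proof -
        have "cmod (p' i x) \<le> \<bar>A i * B i\<bar> * sech (B i * x - C i)"
          using that cmod_sech_profile_deriv_le by (simp add: p'_def glue_def)
        also have "\<dots> = B i * w i x" using Bi by (simp add: w_def abs_mult)
        also have "\<dots> \<le> \<beta> * w i x" using i(5) w_nonneg by (intro mult_right_mono) auto
        finally show ?thesis .
      qed
      ultimately show "cmod (?g' x) \<le> \<beta> * ?G x"
        using g_le[OF that] cmod_c by (simp add: distrib_left)
    qed
    have N4: "\<forall>x. ?G x \<ge> 0" using G(1) w_nonneg by simp
    have N5: "integrable (lebesgue_on {0<..}) ?G" using G(2) w2(1) by simp
    have N6: "integrable (lebesgue_on {0<..}) (\<lambda>x. (?G x)\<^sup>2)"
      unfolding sq using G(3) w2(2) Gw by simp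
    have N7: "(LINT x|lebesgue_on {0<..}. (?G x)\<^sup>2) \<le> real (Suc n) * (M + 1)"
    proof -
      have "(LINT x|lebesgue_on {0<..}. (?G x)\<^sup>2) = (LINT x|lebesgue_on {0<..}. (G x)\<^sup>2) +
          (2 * (LINT x|lebesgue_on {0<..}. G x * w i x) + (LINT x|lebesgue_on {0<..}. (w i x)\<^sup>2))"
        unfolding sq using G(3) w2(2) Gw by simp
      then show ?thesis using G(4) w2(3) i(2) by (simp add: algebra_simps)
    qed
    have N8: "l ?g = of_real (r + cmod (l (p i)))"
      using Q_dual_add[OF l gQ cpQ] Q_dual_mult[OF l pQ, of c] r(1) c by simp
    have N9: "r + cmod (l (p i)) \<ge> real (Suc n) * \<epsilon>"
      using r(2) i(1) by (simp add: algebra_simps)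
    show ?case
      by (rule exI[of _ ?g], rule exI[of _ ?g'], rule exI[of _ ?G])
        (intro conjI N1 N2 N4 N5 N6 N7 allI impI N3 exI[of _ "r + cmod (l (p i))"] N8 N9)
  qed
  have bound: "real n * \<epsilon>\<^sup>2 \<le> K\<^sup>2 * ((1 + \<beta>\<^sup>2) * (M + 1))" if "n > 0" for n
  proof -
    obtain g g' G r where g: "classical_H1 {..<0} g g'" "classical_H1 {0<..} g g'"
      and g_left: "\<And>x. x < 0 \<Longrightarrow> g x = 0 \<and> g' x = 0"
      and g_le: "\<And>x. x > 0 \<Longrightarrow> cmod (g x) \<le> G x \<and> cmod (g' x) \<le> \<beta> * G x"
      and G: "\<And>x. G x \<ge> 0" "integrable (lebesgue_on {0<..}) (\<lambda>x. (G x)\<^sup>2)"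
        "(LINT x|lebesgue_on {0<..}. (G x)\<^sup>2) \<le> real n * (M + 1)"
      and r: "l g = of_real r" "r \<ge> real n * \<epsilon>" using step[of n] by blast
    have left: "L2_sqnorm {..<0} g = 0" "L2_sqnorm {..<0} g' = 0"
      using L2_cong(2)[of "{..<0}" g "\<lambda>_. 0"] L2_cong(2)[of "{..<0}" g' "\<lambda>_. 0"] g_left
      by (simp_all add: L2_sqnorm_def)
    have "L2_sqnorm {0<..} g \<le> (LINT x|lebesgue_on {0<..}. (G x)\<^sup>2)"
      unfolding L2_sqnorm_def
      by (rule integral_mono) (use g(2) G g_le in \<open>auto simp: classical_H1_def L2_def power_mono\<close>)
    moreover have "L2_sqnorm {0<..} g' \<le> (LINT x|lebesgue_on {0<..}. \<beta>\<^sup>2 * (G x)\<^sup>2)"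
      unfolding L2_sqnorm_def power_mult_distrib[symmetric]
      by (rule integral_mono)
        (use g(2) G g_le in \<open>auto simp: classical_H1_def L2_def power_mono power_mult_distrib intro!: power_mono[of _ "\<beta> * _", unfolded power_mult_distrib]\<close>)
    ultimately have "L2_sqnorm {0<..} g + L2_sqnorm {0<..} g' \<le> (1 + \<beta>\<^sup>2) * (LINT x|lebesgue_on {0<..}. (G x)\<^sup>2)"
      by (simp add: distrib_right)
    also have "\<dots> \<le> (1 + \<beta>\<^sup>2) * (real n * (M + 1))"
      using G(3) by (intro mult_left_mono) auto
    finally have norm: "(Q_norm g)\<^sup>2 \<le> (1 + \<beta>\<^sup>2) * (real n * (M + 1))"
      using Q_norm_classical(2)[OF g(2,1)] left L2_sqnorm_nonneg[of "{0<..}" g] L2_sqnorm_nonneg[of "{0<..}" g'] by simp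
    have gQ: "g \<in> Q" by (rule Q_norm_classical(1)[OF g(2,1)])
    have "real n * \<epsilon> \<le> cmod (l g)" using r by simp
    also have "\<dots> \<le> K * Q_norm g" by (rule K(2)[OF gQ])
    finally have "(real n * \<epsilon>)\<^sup>2 \<le> (K * Q_norm g)\<^sup>2"
      using \<epsilon> by (intro power_mono) auto
    also have "\<dots> \<le> K\<^sup>2 * ((1 + \<beta>\<^sup>2) * (real n * (M + 1)))"
      unfolding power_mult_distrib by (intro mult_left_mono norm) auto
    finally have "real n * (real n * \<epsilon>\<^sup>2) \<le> real n * (K\<^sup>2 * ((1 + \<beta>\<^sup>2) * (M + 1)))"
      by (simp add: power2_eq_square mult_ac)
    then show ?thesis using that by simp
  qed
  obtain n :: nat where "K\<^sup>2 * ((1 + \<beta>\<^sup>2) * (M + 1)) / \<epsilon>\<^sup>2 < real n"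
    using reals_Archimedean2 by blast
  then have "K\<^sup>2 * ((1 + \<beta>\<^sup>2) * (M + 1)) < real n * \<epsilon>\<^sup>2"
    using \<epsilon> by (simp add: divide_less_eq)
  moreover have "K\<^sup>2 * ((1 + \<beta>\<^sup>2) * (M + 1)) \<ge> 0" using pos by simp
  ultimately show False using bound[of n] \<epsilon> by (cases "n = 0") auto
qed

section \<open>The parameters of the stationary states\<close>

lemma artanh_eq: "1 / (2 * s) * ln ((1 + t) / (1 - t)) = artanh t / s" for s t :: real
  by (simp add: artanh_def)

lemma tanh_artanh:
  fixes t :: real
  assumes "\<bar>t\<bar> < 1"
  shows "tanh (artanh t) = t"
proof -
  have pos: "(1 + t) / (1 - t) > 0" using assms by simp
  have "exp (- 2 * artanh t) = inverse (exp (ln ((1 + t) / (1 - t))))"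
    by (simp add: artanh_def exp_minus)
  also have "\<dots> = (1 - t) / (1 + t)" using pos by (simp only: exp_ln inverse_divide)
  finally have "tanh (artanh t) = (1 - (1 - t) / (1 + t)) / (1 + (1 - t) / (1 + t))"
    by (simp only: tanh_real_altdef)
  also have "\<dots> = t" using assms by (simp add: field_simps)
  finally show ?thesis .
qed

text \<open>
  The parameters depend on \<open>\<gamma>\<close> and \<open>\<omega>\<close> only through \<open>y = \<gamma> * sqrt \<omega>\<close>, so one may take \<open>\<gamma> = 1\<close>.
\<close>

lemma
  fixes \<gamma> s y :: real
  assumes "\<gamma> > 0" "s > 0"
  shows t1_eq: "t1 \<gamma> (s\<^sup>2) = t1 1 ((\<gamma> * s)\<^sup>2)" and t2_eq: "t2 \<gamma> (s\<^sup>2) = t2 1 ((\<gamma> * s)\<^sup>2)"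
    and tau1_eq: "tau1 \<gamma> (s\<^sup>2) = tau1 1 ((\<gamma> * s)\<^sup>2)" and tau2_eq: "tau2 \<gamma> (s\<^sup>2) = tau2 1 ((\<gamma> * s)\<^sup>2)"
  using assms by (auto simp: t1_def t2_def tau1_def tau2_def power_mult_distrib real_sqrt_mult)

text \<open>
  With \<open>R\<close> the nested root and \<open>S = sqrt (1 + y\<^sup>2)\<close> one has \<open>R\<^sup>2 = (S - 1) * (S + 3)\<close>, hence
  \<open>t\<^sub>1 * t\<^sub>2 = 1 / (S + 1)\<close>. Together with the difference this yields
  \<open>(1 - t\<^sub>2) * (1 + t\<^sub>1) = (S - y) / (S + 1) > 0\<close>, so that the centres are well-defined.
\<close>

lemma t_bounds:
  fixes y :: real
  assumes "y > 0"
  shows "0 < t1 1 (y\<^sup>2)" "t2 1 (y\<^sup>2) - t1 1 (y\<^sup>2) = (sqrt (1 + y\<^sup>2) - 1) / y" "t2 1 (y\<^sup>2) < 1"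
    "t1 1 (y\<^sup>2) < t2 1 (y\<^sup>2)"
proof -
  define S where "S = sqrt (1 + y\<^sup>2)"
  define R where "R = sqrt (y\<^sup>2 - 2 + 2 * S)"
  have S2: "S\<^sup>2 = 1 + y\<^sup>2" by (simp add: S_def)
  have S1: "S > 1" using assms by (simp add: S_def)
  have Sy: "S > y" unfolding S_def using assms by (simp add: real_less_rsqrt)
  have eq: "y\<^sup>2 - 2 + 2 * S = (S - 1) * (S + 3)" using S2 by (simp add: algebra_simps power2_eq_square)
  have R2: "R\<^sup>2 = (S - 1) * (S + 3)" and R0: "R \<ge> 0"
    using S1 by (simp_all add: R_def eq)
  have t1: "t1 1 (y\<^sup>2) = (1 - S + R) / (2 * y)" and t2: "t2 1 (y\<^sup>2) = (- 1 + S + R) / (2 * y)"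
    using assms by (simp_all add: t1_def t2_def S_def R_def)
  have RS: "S - 1 < R"
  proof (rule power_less_imp_less_base)
    show "(S - 1)\<^sup>2 < R\<^sup>2" using R2 S1 by (simp add: power2_eq_square)
  qed (rule R0)
  show pos: "0 < t1 1 (y\<^sup>2)" using RS assms by (simp add: t1)
  show diff: "t2 1 (y\<^sup>2) - t1 1 (y\<^sup>2) = (sqrt (1 + y\<^sup>2) - 1) / y"
    using assms unfolding S_def[symmetric] by (simp add: t1 t2 field_simps)
  show "t1 1 (y\<^sup>2) < t2 1 (y\<^sup>2)"
    using diff S1 assms unfolding S_def[symmetric] by (smt (verit) divide_pos_pos)
  have prod: "t2 1 (y\<^sup>2) * t1 1 (y\<^sup>2) = 1 / (S + 1)"
  proof -
    have "t2 1 (y\<^sup>2) * t1 1 (y\<^sup>2) = (R\<^sup>2 - (S - 1)\<^sup>2) / (4 * y\<^sup>2)"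
      unfolding t1 t2 using assms by (simp add: field_simps power2_eq_square)
    also have "R\<^sup>2 - (S - 1)\<^sup>2 = 4 * (S - 1)" using R2 by (simp add: algebra_simps power2_eq_square)
    also have "4 * (S - 1) / (4 * y\<^sup>2) = 1 / (S + 1)"
    proof -
      have y2: "y\<^sup>2 = (S - 1) * (S + 1)" using S2 by (simp add: algebra_simps power2_eq_square)
      have cancel: "4 * d / (4 * (d * e)) = 1 / e" if "d \<noteq> 0" for d e :: real using that by simp
      show ?thesis unfolding y2 by (rule cancel) (use S1 in simp)
    qed
    finally show ?thesis .
  qed
  have "(1 - t2 1 (y\<^sup>2)) * (1 + t1 1 (y\<^sup>2)) = 1 - (S - 1) / y - 1 / (S + 1)"
    using diff prod unfolding S_def[symmetric] by (simp add: algebra_simps)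
  also have "\<dots> = (S - y) / (S + 1)"
  proof -
    have "(S - 1) / y = y / (S + 1)"
      using S2 S1 assms by (simp add: field_simps power2_eq_square)
    then show ?thesis using S1 by (simp add: field_simps)
  qed
  also have "\<dots> > 0" using Sy S1 by simp
  finally show "t2 1 (y\<^sup>2) < 1" using pos by (simp add: zero_less_mult_iff)
qed

text \<open>
  Here \<open>R\<^sup>2 = (S - 3) * (S + 1)\<close> and \<open>\<tau>\<^sub>1 * \<tau>\<^sub>2 = (S + 1) / y\<^sup>2\<close>, so
  \<open>(1 - \<tau>\<^sub>1) * (1 - \<tau>\<^sub>2) = (1 + S) * (S - y) / y\<^sup>2\<close> is positive; as \<open>\<tau>\<^sub>1 + \<tau>\<^sub>2 < 2\<close>, both factors
  are positive.
\<close>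

lemma tau_bounds:
  fixes y :: real
  assumes "y > 0" "y\<^sup>2 > 8"
  shows "tau1 1 (y\<^sup>2) + tau2 1 (y\<^sup>2) = (1 + sqrt (1 + y\<^sup>2)) / y" "tau1 1 (y\<^sup>2) < 1" "tau2 1 (y\<^sup>2) < 1"
    "0 < tau1 1 (y\<^sup>2)" "0 < tau2 1 (y\<^sup>2)"
proof -
  define S where "S = sqrt (1 + y\<^sup>2)"
  define R where "R = sqrt (y\<^sup>2 - 2 - 2 * S)"
  have S2: "S\<^sup>2 = 1 + y\<^sup>2" by (simp add: S_def)
  have S3: "S > 3" unfolding S_def using assms by (simp add: real_less_rsqrt)
  have Sy: "S > y" unfolding S_def using assms by (simp add: real_less_rsqrt)
  have eq: "y\<^sup>2 - 2 - 2 * S = (S - 3) * (S + 1)" using S2 by (simp add: algebra_simps power2_eq_square)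
  have R2: "R\<^sup>2 = (S - 3) * (S + 1)" and R0: "R \<ge> 0"
    using S3 by (simp_all add: R_def eq)
  have t1: "tau1 1 (y\<^sup>2) = (1 + S + R) / (2 * y)" and t2: "tau2 1 (y\<^sup>2) = (1 + S - R) / (2 * y)"
    using assms by (simp_all add: tau1_def tau2_def S_def R_def)
  have RS: "R < S - 1"
  proof (rule power_less_imp_less_base)
    show "R\<^sup>2 < (S - 1)\<^sup>2" using R2 by (simp add: power2_eq_square algebra_simps)
  qed (use S3 in simp)
  show pos1: "0 < tau1 1 (y\<^sup>2)" using R0 S3 assms by (simp add: t1)
  show pos2: "0 < tau2 1 (y\<^sup>2)" using RS assms by (simp add: t2)
  show sum: "tau1 1 (y\<^sup>2) + tau2 1 (y\<^sup>2) = (1 + sqrt (1 + y\<^sup>2)) / y"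
    using assms unfolding S_def[symmetric] by (simp add: t1 t2 field_simps)
  have prod: "tau1 1 (y\<^sup>2) * tau2 1 (y\<^sup>2) = (S + 1) / y\<^sup>2"
  proof -
    have "tau1 1 (y\<^sup>2) * tau2 1 (y\<^sup>2) = ((1 + S)\<^sup>2 - R\<^sup>2) / (4 * y\<^sup>2)"
      unfolding t1 t2 using assms by (simp add: field_simps power2_eq_square)
    also have "(1 + S)\<^sup>2 - R\<^sup>2 = 4 * (S + 1)" using R2 by (simp add: algebra_simps power2_eq_square)
    also have "4 * (S + 1) / (4 * y\<^sup>2) = (S + 1) / y\<^sup>2" by (rule mult_divide_mult_cancel_left) simp
    finally show ?thesis .
  qed
  have "(1 - tau1 1 (y\<^sup>2)) * (1 - tau2 1 (y\<^sup>2)) = 1 - (1 + S) / y + (S + 1) / y\<^sup>2"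
    using sum prod unfolding S_def[symmetric] by (simp add: algebra_simps)
  also have "\<dots> = (1 + S) * (S - y) / y\<^sup>2"
    using assms S2 by (simp add: field_simps power2_eq_square)
  finally have p: "(1 - tau1 1 (y\<^sup>2)) * (1 - tau2 1 (y\<^sup>2)) > 0" using Sy S3 assms by simp
  have "(1 + S) / y < 2"
  proof -
    \<comment> \<open>Equivalent to \<open>S > 5 / 3\<close>.\<close>
    have "1 + S < 2 * y"
    proof (rule power_less_imp_less_base)
      have "(2 * y)\<^sup>2 - (1 + S)\<^sup>2 = (S + 1) * (3 * S - 5)"
        using S2 by (simp add: algebra_simps power2_eq_square)
      moreover have "(S + 1) * (3 * S - 5) > 0" using S3 by simp
      ultimately show "(1 + S)\<^sup>2 < (2 * y)\<^sup>2" by simp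
    qed (use assms in simp)
    then show ?thesis using assms by (simp add: field_simps)
  qed
  then have "(1 - tau1 1 (y\<^sup>2)) + (1 - tau2 1 (y\<^sup>2)) > 0" using sum unfolding S_def[symmetric] by simp
  with p show "tau1 1 (y\<^sup>2) < 1" "tau2 1 (y\<^sup>2) < 1"
    by (auto simp: zero_less_mult_iff)
qed

lemma t_limits:
  "((\<lambda>y. t1 1 (y\<^sup>2)) \<longlongrightarrow> 0) at_top" "((\<lambda>y. t2 1 (y\<^sup>2)) \<longlongrightarrow> 1) at_top"
  "((\<lambda>y. tau1 1 (y\<^sup>2)) \<longlongrightarrow> 1) at_top" "((\<lambda>y. tau2 1 (y\<^sup>2)) \<longlongrightarrow> 0) at_top"
  unfolding t1_def t2_def tau1_def tau2_def by real_asymp+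

section \<open>Masses and frequencies\<close>

text \<open>
  The parameters are hyperbolic tangents of the phases: the logarithmic formulas for the centres
  express \<open>artanh\<close>.
\<close>

lemma
  assumes "\<gamma> > 0" "s > 0"
  shows psi_plus_eq_glue: "psi_plus \<kappa> \<gamma> (s\<^sup>2) =
      glue (sech_profile (sqrt (2 / \<kappa>) * s) s (artanh (t1 1 ((\<gamma> * s)\<^sup>2))))
           (sech_profile (sqrt (2 / \<kappa>) * s) s (artanh (t2 1 ((\<gamma> * s)\<^sup>2))))"
    and psi_asym_eq_glue: "psi_asym \<kappa> \<gamma> (s\<^sup>2) =
      glue (sech_profile (sqrt (2 / \<kappa>) * s) s (artanh (tau1 1 ((\<gamma> * s)\<^sup>2))))
           (sech_profile (- (sqrt (2 / \<kappa>) * s)) s (- artanh (tau2 1 ((\<gamma> * s)\<^sup>2))))"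
proof -
  have amp: "sqrt (2 * s\<^sup>2 / \<kappa>) = sqrt (2 / \<kappa>) * s"
    using assms by (simp add: real_sqrt_mult real_sqrt_divide)
  have root: "sqrt (s\<^sup>2) = s" using assms by simp
  have arg: "s * (x - a / s) = s * x - a" "s * (x - - (a / s)) = s * x - - a" for x a
    using assms by (simp_all add: field_simps)
  show "psi_plus \<kappa> \<gamma> (s\<^sup>2) =
      glue (sech_profile (sqrt (2 / \<kappa>) * s) s (artanh (t1 1 ((\<gamma> * s)\<^sup>2))))
           (sech_profile (sqrt (2 / \<kappa>) * s) s (artanh (t2 1 ((\<gamma> * s)\<^sup>2))))"
    unfolding psi_plus_def centre1_def centre2_def root artanh_eq amp arg glue_def sech_profile_def
      t1_eq[OF assms] t2_eq[OF assms] by (simp add: fun_eq_iff)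
  show "psi_asym \<kappa> \<gamma> (s\<^sup>2) =
      glue (sech_profile (sqrt (2 / \<kappa>) * s) s (artanh (tau1 1 ((\<gamma> * s)\<^sup>2))))
           (sech_profile (- (sqrt (2 / \<kappa>) * s)) s (- artanh (tau2 1 ((\<gamma> * s)\<^sup>2))))"
    unfolding psi_asym_def asym_centre1_def asym_centre2_def root artanh_eq amp arg glue_def sech_profile_def
      tau1_eq[OF assms] tau2_eq[OF assms] by (simp add: fun_eq_iff)
qed

lemma psi_odd_eq_glue:
  assumes "\<gamma> > 0" "s > 2 / \<gamma>"
  shows "psi_odd \<kappa> \<gamma> (s\<^sup>2) =
      glue (sech_profile (- (sqrt (2 / \<kappa>) * s)) s (artanh (2 / (\<gamma> * s))))
           (sech_profile (sqrt (2 / \<kappa>) * s) s (- artanh (2 / (\<gamma> * s))))"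
proof -
  have s: "s > 0" using assms by (meson divide_pos_pos less_trans zero_less_numeral)
  have y: "\<gamma> * s > 2" using assms by (simp add: divide_less_eq mult.commute)
  have amp: "sqrt (2 * s\<^sup>2 / \<kappa>) = sqrt (2 / \<kappa>) * s"
    using s by (simp add: real_sqrt_mult real_sqrt_divide)
  have root: "sqrt (s\<^sup>2) = s" using s by simp
  have quot: "(\<gamma> * s + 2) / (\<gamma> * s - 2) = (1 + 2 / (\<gamma> * s)) / (1 - 2 / (\<gamma> * s))"
  proof -
    have "1 + 2 / (\<gamma> * s) = (\<gamma> * s + 2) / (\<gamma> * s)" "1 - 2 / (\<gamma> * s) = (\<gamma> * s - 2) / (\<gamma> * s)"
      using y by (auto simp: add_divide_distrib diff_divide_distrib)
    then show ?thesis using y assms(1) s by (simp only:) simp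
  qed
  have arg: "s * (x - a / s) = s * x - a" "s * (x + a / s) = s * x - - a" for x a
    using s by (simp_all add: field_simps)
  show ?thesis
    unfolding psi_odd_def odd_centre_def root quot artanh_eq amp arg glue_def sech_profile_def
    by (simp add: fun_eq_iff)
qed

lemma L2_sqnorm_UNIV_split:
  assumes "f \<in> L2 {..<0}" "f \<in> L2 {0<..}"
  shows "L2_sqnorm UNIV f = L2_sqnorm {..<0} f + L2_sqnorm {0<..} f"
proof -
  have int: "integrable lebesgue (\<lambda>x. indicator {..<0} x *\<^sub>R (cmod (f x))\<^sup>2)"
    "integrable lebesgue (\<lambda>x. indicator {0<..} x *\<^sub>R (cmod (f x))\<^sup>2)"
    using assms by (simp_all add: L2_def integrable_restrict_space)
  have meas: "(\<lambda>x. (cmod (f x))\<^sup>2) \<in> borel_measurable lebesgue"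
  proof (rule measurable_discrete_difference)
    show "(\<lambda>x. indicator {..<0} x *\<^sub>R (cmod (f x))\<^sup>2 + indicator {0<..} x *\<^sub>R (cmod (f x))\<^sup>2) \<in> borel_measurable lebesgue"
      using int by (intro borel_measurable_add borel_measurable_integrable)
    show "countable {0 :: real}" by simp
  qed (auto simp: indicator_def)
  have "L2_sqnorm UNIV f = (LINT x|lebesgue. (cmod (f x))\<^sup>2)"
    by (simp add: L2_sqnorm_def lebesgue_on_UNIV_eq)
  also have "\<dots> = (LINT x|lebesgue. indicator {..<0} x *\<^sub>R (cmod (f x))\<^sup>2 + indicator {0<..} x *\<^sub>R (cmod (f x))\<^sup>2)"
  proof (rule integral_cong_AE[OF meas])
    show "(\<lambda>x. indicator {..<0} x *\<^sub>R (cmod (f x))\<^sup>2 + indicator {0<..} x *\<^sub>R (cmod (f x))\<^sup>2) \<in> borel_measurable lebesgue"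
      using int by (intro borel_measurable_add borel_measurable_integrable)
    have "AE x in lebesgue. x \<notin> {0::real}"
      by (rule AE_not_in) (auto intro!: null_sets_completionI finite_imp_null_set_lborel)
    then show "AE x in lebesgue. (cmod (f x))\<^sup>2 = indicator {..<0} x *\<^sub>R (cmod (f x))\<^sup>2 + indicator {0<..} x *\<^sub>R (cmod (f x))\<^sup>2"
      by eventually_elim (auto simp: indicator_def)
  qed
  also have "\<dots> = L2_sqnorm {..<0} f + L2_sqnorm {0<..} f"
    unfolding L2_sqnorm_def using int
    by (subst Bochner_Integration.integral_add) (simp_all add: integral_restrict_space)
  finally show ?thesis .
qed

lemma L2_sqnorm_glue_sech_profiles:
  assumes "s > 0"
  shows "L2_sqnorm UNIV (glue (sech_profile A s C) (sech_profile A' s C')) =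
    A\<^sup>2 * (1 - tanh C) / s + A'\<^sup>2 * (1 + tanh C') / s"
proof -
  let ?f = "glue (sech_profile A s C) (sech_profile A' s C')"
  have left: "?f x = sech_profile A s C x" if "x \<in> {..<0}" for x using that by (simp add: glue_def)
  have right: "?f x = sech_profile A' s C' x" if "x \<in> {0<..}" for x using that by (simp add: glue_def)
  note cong = L2_cong[of "{..<0}" ?f "sech_profile A s C", OF left] L2_cong[of "{0<..}" ?f "sech_profile A' s C'", OF right]
  have "sech_profile A s C \<in> L2 {..<0}" "sech_profile A' s C' \<in> L2 {0<..}"
    using classical_H1_sech_profile[of "{..<0}" s A C] classical_H1_sech_profile[of "{0<..}" s A' C'] assms
    by (simp_all add: classical_H1_def)
  then have "?f \<in> L2 {..<0}" "?f \<in> L2 {0<..}"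
    by (simp_all only: cong)
  then have "L2_sqnorm UNIV ?f = L2_sqnorm {..<0} ?f + L2_sqnorm {0<..} ?f"
    by (rule L2_sqnorm_UNIV_split)
  then show ?thesis
    by (simp only: cong L2_sqnorm_sech_profile[OF assms])
qed

lemma amplitude_power2:
  fixes \<kappa> s c :: real
  assumes "\<kappa> > 0" "s > 0"
  shows "(sqrt (2 / \<kappa>) * s)\<^sup>2 * c / s = 2 / \<kappa> * s * c"
proof -
  have "(sqrt (2 / \<kappa>) * s)\<^sup>2 = 2 / \<kappa> * (s * s)"
    using assms by (simp add: power_mult_distrib power2_eq_square[of s])
  then show ?thesis using assms by simp
qed

lemma mass_plus:
  assumes "\<kappa> > 0" "\<gamma> > 0" "s > 0"
  shows "L2_sqnorm UNIV (psi_plus \<kappa> \<gamma> (s\<^sup>2)) = 2 / \<kappa> * (2 * s + (sqrt (1 + (\<gamma> * s)\<^sup>2) - 1) / \<gamma>)"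
proof -
  have y: "\<gamma> * s > 0" using assms by simp
  note t = t_bounds[OF y]
  have "L2_sqnorm UNIV (psi_plus \<kappa> \<gamma> (s\<^sup>2)) = 2 / \<kappa> * s * (2 + (t2 1 ((\<gamma> * s)\<^sup>2) - t1 1 ((\<gamma> * s)\<^sup>2)))"
    using t(1,3,4) unfolding psi_plus_eq_glue[OF assms(2,3)] L2_sqnorm_glue_sech_profiles[OF assms(3)]
      amplitude_power2[OF assms(1,3)]
    by (subst tanh_artanh, simp, subst tanh_artanh, simp) (simp add: algebra_simps)
  also have "\<dots> = 2 / \<kappa> * (2 * s + (sqrt (1 + (\<gamma> * s)\<^sup>2) - 1) / \<gamma>)"
    unfolding t(2) using assms by (simp add: field_simps)
  finally show ?thesis .
qed

lemma mass_odd: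
  assumes "\<kappa> > 0" "\<gamma> > 0" "s > 2 / \<gamma>"
  shows "L2_sqnorm UNIV (psi_odd \<kappa> \<gamma> (s\<^sup>2)) = 4 / \<kappa> * (s - 2 / \<gamma>)"
proof -
  have s: "s > 0" using assms by (meson divide_pos_pos less_trans zero_less_numeral)
  have y: "\<gamma> * s > 2" using assms by (simp add: divide_less_eq mult.commute)
  have "\<bar>2 / (\<gamma> * s)\<bar> < 1" using y by simp
  then have "L2_sqnorm UNIV (psi_odd \<kappa> \<gamma> (s\<^sup>2)) = 2 / \<kappa> * s * (1 - 2 / (\<gamma> * s)) + 2 / \<kappa> * s * (1 + - (2 / (\<gamma> * s)))"
    unfolding psi_odd_eq_glue[OF assms(2,3)] L2_sqnorm_glue_sech_profiles[OF s] tanh_minus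
      power2_minus amplitude_power2[OF assms(1) s] by (simp only: tanh_artanh)
  also have "\<dots> = 4 / \<kappa> * (s - 2 / \<gamma>)" using assms s by (simp add: field_simps)
  finally show ?thesis .
qed

lemma sqrt_less_imp_less_power2:
  fixes x y :: real
  assumes "sqrt x < y"
  shows "x < y\<^sup>2"
proof (rule ccontr)
  assume "\<not> x < y\<^sup>2"
  then have "sqrt (y\<^sup>2) \<le> sqrt x" by (intro real_sqrt_le_mono) simp
  then show False using assms by simp
qed

lemma mass_asym:
  assumes "\<kappa> > 0" "\<gamma> > 0" "s > sqrt 8 / \<gamma>"
  shows "L2_sqnorm UNIV (psi_asym \<kappa> \<gamma> (s\<^sup>2)) = 2 / \<kappa> * (2 * s - (1 + sqrt (1 + (\<gamma> * s)\<^sup>2)) / \<gamma>)"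
proof -
  have s: "s > 0" using assms by (smt (verit) divide_nonneg_pos real_sqrt_ge_zero)
  have y8: "\<gamma> * s > sqrt 8" using assms by (simp add: divide_less_eq mult.commute)
  have y: "\<gamma> * s > 0" using assms s by simp
  have "(\<gamma> * s)\<^sup>2 > 8" by (rule sqrt_less_imp_less_power2[OF y8])
  note t = tau_bounds[OF y this]
  have "L2_sqnorm UNIV (psi_asym \<kappa> \<gamma> (s\<^sup>2)) = 2 / \<kappa> * s * (2 - (tau1 1 ((\<gamma> * s)\<^sup>2) + tau2 1 ((\<gamma> * s)\<^sup>2)))"
    using t(2-5) unfolding psi_asym_eq_glue[OF assms(2) s] L2_sqnorm_glue_sech_profiles[OF s] tanh_minus
      power2_minus amplitude_power2[OF assms(1) s]
    by (subst tanh_artanh, simp, subst tanh_artanh, simp) (simp add: algebra_simps)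
  also have "\<dots> = 2 / \<kappa> * (2 * s - (1 + sqrt (1 + (\<gamma> * s)\<^sup>2)) / \<gamma>)"
    unfolding t(1) using assms s by (simp add: field_simps)
  finally show ?thesis .
qed

text \<open>
  Strict monotonicity of the mass in \<open>sqrt \<omega>\<close> makes the definite description meaningful.
\<close>

lemma THE_frequency:
  fixes m :: "real \<Rightarrow> real"
  assumes c: "0 \<le> c" "w0 = c\<^sup>2" and s: "c < s" "m s = \<rho>"
    and mono: "\<And>a b. c < a \<Longrightarrow> a < b \<Longrightarrow> m a < m b"
    and mass: "\<And>a. c < a \<Longrightarrow> L2_sqnorm UNIV (\<psi> (a\<^sup>2)) = m a"
  shows "(THE \<omega>. w0 < \<omega> \<and> L2_sqnorm UNIV (\<psi> \<omega>) = \<rho>) = s\<^sup>2"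
proof (rule the_equality)
  show "w0 < s\<^sup>2 \<and> L2_sqnorm UNIV (\<psi> (s\<^sup>2)) = \<rho>"
    using c s mass[OF s(1)] by (simp add: power_strict_mono)
  fix \<omega> assume \<omega>: "w0 < \<omega> \<and> L2_sqnorm UNIV (\<psi> \<omega>) = \<rho>"
  have "\<omega> \<ge> 0" using \<omega> c(2) zero_le_power2[of c] by linarith
  then have eq: "\<omega> = (sqrt \<omega>)\<^sup>2" by simp
  have "c < sqrt \<omega>" using \<omega> c by (simp add: real_less_rsqrt)
  then have "m (sqrt \<omega>) = m s" using mass[of "sqrt \<omega>"] \<omega> s(2) eq by simp
  then have "sqrt \<omega> = s"
    using mono[of "sqrt \<omega>" s] mono[of s "sqrt \<omega>"] s(1) \<open>c < sqrt \<omega>\<close>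
    by (cases "sqrt \<omega>" s rule: linorder_cases) auto
  then show "\<omega> = s\<^sup>2" using eq by simp
qed

lemma sqrt_1_plus_power2_bounds:
  fixes y :: real
  assumes "y \<ge> 0"
  shows "y \<le> sqrt (1 + y\<^sup>2)" "sqrt (1 + y\<^sup>2) \<le> 1 + y"
proof -
  show "y \<le> sqrt (1 + y\<^sup>2)" by (rule real_le_rsqrt) simp
  show "sqrt (1 + y\<^sup>2) \<le> 1 + y"
    by (rule real_le_lsqrt) (use assms in \<open>simp_all add: power2_sum\<close>)
qed

text \<open>
  The intermediate value theorem gives the frequency; \<open>y \<le> sqrt (1 + y\<^sup>2) \<le> 1 + y\<close> locates it.
\<close>

lemma frequency_plus:
  assumes "\<kappa> > 0" "\<rho> > 0" "\<gamma> > 0"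
  obtains s where "s > 0" "(THE \<omega>. 0 < \<omega> \<and> L2_sqnorm UNIV (psi_plus \<kappa> \<gamma> \<omega>) = \<rho>) = s\<^sup>2"
    "\<kappa> * \<rho> / 6 \<le> s" "s \<le> \<kappa> * \<rho> / 6 + 1 / 3 * (1 / \<gamma>)"
proof -
  define h where "h = (\<lambda>s. 2 * s + (sqrt (1 + (\<gamma> * s)\<^sup>2) - 1) / \<gamma>)"
  let ?m = "\<kappa> * \<rho> / 2"
  have m: "?m > 0" using assms by simp
  have h0: "h 0 = 0" by (simp add: h_def)
  have "h ?m \<ge> ?m"
  proof -
    have "(sqrt (1 + (\<gamma> * ?m)\<^sup>2) - 1) / \<gamma> \<ge> 0" using assms by simp
    then show ?thesis using m unfolding h_def by linarith
  qed
  moreover have "continuous_on {0..?m} h"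
    unfolding h_def using assms by (intro continuous_intros) auto
  ultimately obtain s where s: "0 \<le> s" "s \<le> ?m" "h s = ?m"
    using IVT'[of h 0 ?m ?m] m h0 by auto
  have "s \<noteq> 0" using s(3) h0 m by auto
  then have s_pos: "s > 0" using s(1) by simp
  have y: "\<gamma> * s \<ge> 0" using assms s_pos by simp
  have "h s \<le> 3 * s" "3 * s - 1 / \<gamma> \<le> h s"
  proof -
    have "(sqrt (1 + (\<gamma> * s)\<^sup>2) - 1) / \<gamma> \<le> \<gamma> * s / \<gamma>" "(\<gamma> * s - 1) / \<gamma> \<le> (sqrt (1 + (\<gamma> * s)\<^sup>2) - 1) / \<gamma>"
      using assms sqrt_1_plus_power2_bounds[OF y] by (intro divide_right_mono; simp)+
    moreover have "\<gamma> * s / \<gamma> = s" "(\<gamma> * s - 1) / \<gamma> = s - 1 / \<gamma>"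
      using assms by (simp_all add: diff_divide_distrib)
    ultimately show "h s \<le> 3 * s" "3 * s - 1 / \<gamma> \<le> h s" unfolding h_def by linarith+
  qed
  then have bounds: "\<kappa> * \<rho> / 6 \<le> s" "s \<le> \<kappa> * \<rho> / 6 + 1 / 3 * (1 / \<gamma>)"
    using s(3) by linarith+
  have "(THE \<omega>. 0 < \<omega> \<and> L2_sqnorm UNIV (psi_plus \<kappa> \<gamma> \<omega>) = \<rho>) = s\<^sup>2"
  proof (rule THE_frequency[where \<psi> = "psi_plus \<kappa> \<gamma>" and c = 0 and m = "\<lambda>s. 2 / \<kappa> * h s"])
    show "2 / \<kappa> * h s = \<rho>" unfolding s(3) using assms by simp
    fix a b :: real assume ab: "0 < a" "a < b"
    have "(sqrt (1 + (\<gamma> * a)\<^sup>2) - 1) / \<gamma> \<le> (sqrt (1 + (\<gamma> * b)\<^sup>2) - 1) / \<gamma>"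
      using assms ab by (intro divide_right_mono diff_right_mono real_sqrt_le_mono add_left_mono power_mono mult_left_mono) auto
    then have "h a < h b" using ab unfolding h_def by linarith
    then show "2 / \<kappa> * h a < 2 / \<kappa> * h b"
      by (rule mult_strict_left_mono) (use assms in simp)
  next
    fix a :: real assume "0 < a"
    then show "L2_sqnorm UNIV (psi_plus \<kappa> \<gamma> (a\<^sup>2)) = 2 / \<kappa> * h a"
      unfolding h_def by (rule mass_plus[OF assms(1,3)])
  qed (use s_pos in auto)
  then show ?thesis using that s_pos bounds by blast
qed

lemma frequency_odd:
  assumes "\<kappa> > 0" "\<rho> > 0" "\<gamma> > 0"
  shows "(THE \<omega>. 4 / \<gamma>\<^sup>2 < \<omega> \<and> L2_sqnorm UNIV (psi_odd \<kappa> \<gamma> \<omega>) = \<rho>) = (\<kappa> * \<rho> / 4 + 2 / \<gamma>)\<^sup>2"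
proof (rule THE_frequency[where \<psi> = "psi_odd \<kappa> \<gamma>" and c = "2 / \<gamma>" and m = "\<lambda>s. 4 / \<kappa> * (s - 2 / \<gamma>)"])
  fix a :: real assume "2 / \<gamma> < a"
  then show "L2_sqnorm UNIV (psi_odd \<kappa> \<gamma> (a\<^sup>2)) = 4 / \<kappa> * (a - 2 / \<gamma>)"
    by (rule mass_odd[OF assms(1,3)])
next
  fix a b :: real assume "a < b"
  then show "4 / \<kappa> * (a - 2 / \<gamma>) < 4 / \<kappa> * (b - 2 / \<gamma>)" 
    using assms by (intro mult_strict_left_mono) auto
qed (use assms in \<open>auto simp: power_divide\<close>)

text \<open>
  The assumption on \<open>\<gamma>\<close> puts the root found between \<open>\<kappa> * \<rho> / 2 + 1 / \<gamma>\<close> and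
  \<open>\<kappa> * \<rho> / 2 + 2 / \<gamma>\<close> above the threshold \<open>sqrt 8 / \<gamma>\<close>. Monotonicity holds because
  \<open>sqrt (1 + y\<^sup>2)\<close> is 1-Lipschitz, while the linear term has slope 2.
\<close>

lemma frequency_asym:
  assumes "\<kappa> > 0" "\<rho> > 0" "\<gamma> > 0" "3 / \<gamma> < \<kappa> * \<rho> / 2"
  obtains s where "s > sqrt 8 / \<gamma>" "(THE \<omega>. 8 / \<gamma>\<^sup>2 < \<omega> \<and> L2_sqnorm UNIV (psi_asym \<kappa> \<gamma> \<omega>) = \<rho>) = s\<^sup>2"
    "\<kappa> * \<rho> / 2 + 1 / \<gamma> \<le> s" "s \<le> \<kappa> * \<rho> / 2 + 2 * (1 / \<gamma>)"
proof -
  define h where "h = (\<lambda>s. 2 * s - (1 + sqrt (1 + (\<gamma> * s)\<^sup>2)) / \<gamma>)"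
  let ?m = "\<kappa> * \<rho> / 2"
  have m: "?m > 0" using assms by simp
  have h_bounds: "h s \<le> s - 1 / \<gamma>" "s - 2 * (1 / \<gamma>) \<le> h s" if "s \<ge> 0" for s
  proof -
    have y: "\<gamma> * s \<ge> 0" using assms that by simp
    have "(1 + sqrt (1 + (\<gamma> * s)\<^sup>2)) / \<gamma> \<le> (2 + \<gamma> * s) / \<gamma>" "(1 + \<gamma> * s) / \<gamma> \<le> (1 + sqrt (1 + (\<gamma> * s)\<^sup>2)) / \<gamma>"
      using assms sqrt_1_plus_power2_bounds[OF y] by (intro divide_right_mono; simp)+
    moreover have "(2 + \<gamma> * s) / \<gamma> = s + 2 * (1 / \<gamma>)" "(1 + \<gamma> * s) / \<gamma> = s + 1 / \<gamma>"
      using assms by (simp_all add: add_divide_distrib)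
    ultimately show "h s \<le> s - 1 / \<gamma>" "s - 2 * (1 / \<gamma>) \<le> h s" unfolding h_def by linarith+
  qed
  have inv: "1 / \<gamma> > 0" using assms by simp
  have "h (?m + 1 / \<gamma>) \<le> ?m" "?m \<le> h (?m + 2 * (1 / \<gamma>))"
    using h_bounds(1)[of "?m + 1 / \<gamma>"] h_bounds(2)[of "?m + 2 * (1 / \<gamma>)"] m inv by linarith+
  moreover have "continuous_on {?m + 1 / \<gamma>..?m + 2 * (1 / \<gamma>)} h"
    unfolding h_def using assms by (intro continuous_intros) auto
  ultimately obtain s where s: "?m + 1 / \<gamma> \<le> s" "s \<le> ?m + 2 * (1 / \<gamma>)" "h s = ?m"
    using IVT'[of h "?m + 1 / \<gamma>" ?m "?m + 2 * (1 / \<gamma>)"] inv by auto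
  have sqrt8: "sqrt 8 \<le> (3 :: real)" by (rule real_le_lsqrt) auto
  have "sqrt 8 / \<gamma> \<le> 3 / \<gamma>" using sqrt8 assms by (intro divide_right_mono) auto
  then have s8: "s > sqrt 8 / \<gamma>" using s(1) assms(4) inv by linarith
  have "(THE \<omega>. 8 / \<gamma>\<^sup>2 < \<omega> \<and> L2_sqnorm UNIV (psi_asym \<kappa> \<gamma> \<omega>) = \<rho>) = s\<^sup>2"
  proof (rule THE_frequency[where \<psi> = "psi_asym \<kappa> \<gamma>" and c = "sqrt 8 / \<gamma>" and m = "\<lambda>s. 2 / \<kappa> * h s"])
    show "2 / \<kappa> * h s = \<rho>" unfolding s(3) using assms by simp
    fix a b :: real assume ab: "sqrt 8 / \<gamma> < a" "a < b"
    have "sqrt 8 / \<gamma> > 0" using assms by simp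
    then have a: "a > 0" using ab by linarith
    have "sqrt (1 + (\<gamma> * b)\<^sup>2) \<le> sqrt (1 + (\<gamma> * a)\<^sup>2) + \<gamma> * (b - a)"
    proof (rule real_le_lsqrt)
      have "\<gamma> * a \<le> sqrt (1 + (\<gamma> * a)\<^sup>2)" using a assms by (intro sqrt_1_plus_power2_bounds) simp
      then have "\<gamma> * a * (\<gamma> * (b - a)) \<le> sqrt (1 + (\<gamma> * a)\<^sup>2) * (\<gamma> * (b - a))"
        using ab assms by (intro mult_right_mono) auto
      moreover have "(sqrt (1 + (\<gamma> * a)\<^sup>2) + \<gamma> * (b - a))\<^sup>2 =
          1 + (\<gamma> * a)\<^sup>2 + 2 * (sqrt (1 + (\<gamma> * a)\<^sup>2) * (\<gamma> * (b - a))) + (\<gamma> * (b - a))\<^sup>2"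
        by (simp add: power2_sum)
      moreover have "(\<gamma> * b)\<^sup>2 = (\<gamma> * a)\<^sup>2 + 2 * (\<gamma> * a * (\<gamma> * (b - a))) + (\<gamma> * (b - a))\<^sup>2"
        by (simp add: power2_eq_square algebra_simps)
      ultimately show "1 + (\<gamma> * b)\<^sup>2 \<le> (sqrt (1 + (\<gamma> * a)\<^sup>2) + \<gamma> * (b - a))\<^sup>2" by linarith
      show "0 \<le> sqrt (1 + (\<gamma> * a)\<^sup>2) + \<gamma> * (b - a)" using ab assms by simp
    qed
    then have "(1 + sqrt (1 + (\<gamma> * b)\<^sup>2)) / \<gamma> \<le> (1 + sqrt (1 + (\<gamma> * a)\<^sup>2) + \<gamma> * (b - a)) / \<gamma>"
      using assms by (intro divide_right_mono) auto
    also have "\<dots> = (1 + sqrt (1 + (\<gamma> * a)\<^sup>2)) / \<gamma> + (b - a)"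
      using assms by (simp add: add_divide_distrib)
    finally have "h a < h b" using ab unfolding h_def by linarith
    then show "2 / \<kappa> * h a < 2 / \<kappa> * h b"
      by (rule mult_strict_left_mono) (use assms in simp)
  next
    fix a :: real assume "sqrt 8 / \<gamma> < a"
    then show "L2_sqnorm UNIV (psi_asym \<kappa> \<gamma> (a\<^sup>2)) = 2 / \<kappa> * h a"
      unfolding h_def by (rule mass_asym[OF assms(1,3)])
  qed (use s8 assms in \<open>auto simp: power_divide\<close>)
  then show ?thesis using that s8 s by blast
qed

section \<open>The limits\<close>

lemma amplitude_eq:
  fixes \<kappa> :: real
  assumes "\<kappa> > 0"
  shows "sqrt (2 / \<kappa>) * (\<kappa> * r) = sqrt (\<kappa> / 2) * (2 * r)"
proof -
  have "sqrt (2 / \<kappa>) * sqrt (\<kappa> / 2) = 1" 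
    using assms by (simp add: real_sqrt_mult[symmetric])
  moreover have "\<kappa> = 2 * (sqrt (\<kappa> / 2) * sqrt (\<kappa> / 2))" using assms by simp
  ultimately have "sqrt (2 / \<kappa>) * \<kappa> = 2 * sqrt (\<kappa> / 2)"
    by (metis mult.assoc mult.commute mult_1)
  then show ?thesis by (metis mult.assoc mult.commute)
qed

lemma tendsto_artanh_0:
  fixes f :: "'a \<Rightarrow> real"
  assumes "(f \<longlongrightarrow> 0) F"
  shows "((\<lambda>i. artanh (f i)) \<longlongrightarrow> 0) F"
proof -
  have "isCont artanh (0::real)"
    by (rule DERIV_isCont[OF artanh_real_has_field_derivative]) simp
  from isCont_tendsto_compose[OF this assms] show ?thesis by simp
qed

lemma tendsto_frequency:
  fixes s :: "real \<Rightarrow> real"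
  assumes "\<forall>\<^sub>F \<gamma> in at_top. m + a * (1 / \<gamma>) \<le> s \<gamma>" "\<forall>\<^sub>F \<gamma> in at_top. s \<gamma> \<le> m + b * (1 / \<gamma>)" and "m > 0"
  shows "(s \<longlongrightarrow> m) at_top" "filterlim (\<lambda>\<gamma>. \<gamma> * s \<gamma>) at_top at_top"
proof -
  have inv: "((\<lambda>\<gamma>::real. 1 / \<gamma>) \<longlongrightarrow> 0) at_top"
    by (rule tendsto_divide_0[OF tendsto_const filterlim_at_top_imp_at_infinity[OF filterlim_ident]])
  have "((\<lambda>\<gamma>. m + c * (1 / \<gamma>)) \<longlongrightarrow> m) at_top" for c
    using tendsto_add[OF tendsto_const tendsto_mult_right_zero[OF inv], of m c] by simp
  note bounds = this
  show lim: "(s \<longlongrightarrow> m) at_top"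
    by (rule real_tendsto_sandwich[OF assms(1,2) bounds bounds])
  show "filterlim (\<lambda>\<gamma>. \<gamma> * s \<gamma>) at_top at_top"
    by (rule filterlim_at_top_mult_tendsto_pos[OF lim assms(3) filterlim_ident])
qed

text \<open>
  The left phase tends to 0, so the left piece converges in norm; the right phase tends to
  infinity, so the right piece escapes and contributes nothing to the weak limit.
\<close>

lemma phi_plus_tendsto:
  fixes \<kappa> \<rho> :: real
  assumes "\<kappa> > 0" and "\<rho> > 0"
  shows "tendsto_weakly_in_Q (\<lambda>\<gamma>. phi_plus \<kappa> \<rho> \<gamma>)
           (\<lambda>x. indicator {..0} x * sech_profile (sqrt (\<kappa> / 2) * (\<rho> / 3)) (\<kappa> * \<rho> / 6) 0 x) at_top"
proof -
  define s where "s = (\<lambda>\<gamma>. sqrt (THE \<omega>. 0 < \<omega> \<and> L2_sqnorm UNIV (psi_plus \<kappa> \<gamma> \<omega>) = \<rho>))"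
  define A where "A = (\<lambda>\<gamma>. sqrt (2 / \<kappa>) * s \<gamma>)"
  define C1 where "C1 = (\<lambda>\<gamma>. artanh (t1 1 ((\<gamma> * s \<gamma>)\<^sup>2)))"
  define C2 where "C2 = (\<lambda>\<gamma>. artanh (t2 1 ((\<gamma> * s \<gamma>)\<^sup>2)))"
  have m: "\<kappa> * \<rho> / 6 > 0" using assms by simp
  have freq: "\<gamma> * s \<gamma> > 0 \<and> s \<gamma> > 0 \<and> \<kappa> * \<rho> / 6 + 0 * (1 / \<gamma>) \<le> s \<gamma> \<and> s \<gamma> \<le> \<kappa> * \<rho> / 6 + 1 / 3 * (1 / \<gamma>) \<and>
      phi_plus \<kappa> \<rho> \<gamma> = glue (sech_profile (A \<gamma>) (s \<gamma>) (C1 \<gamma>)) (sech_profile (A \<gamma>) (s \<gamma>) (C2 \<gamma>))"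
    if \<gamma>: "\<gamma> > 0" for \<gamma>
  proof -
    obtain r where r: "r > 0" "(THE \<omega>. 0 < \<omega> \<and> L2_sqnorm UNIV (psi_plus \<kappa> \<gamma> \<omega>) = \<rho>) = r\<^sup>2"
      "\<kappa> * \<rho> / 6 \<le> r" "r \<le> \<kappa> * \<rho> / 6 + 1 / 3 * (1 / \<gamma>)"
      using frequency_plus[OF assms \<gamma>] by metis
    have "s \<gamma> = r" using r(1) by (simp add: s_def r(2))
    moreover have "phi_plus \<kappa> \<rho> \<gamma> = psi_plus \<kappa> \<gamma> (r\<^sup>2)" by (simp add: phi_plus_def r(2))
    ultimately show ?thesis
      using r \<gamma> by (simp add: psi_plus_eq_glue[OF \<gamma> r(1)] A_def C1_def C2_def)
  qed
  have ev: "\<forall>\<^sub>F \<gamma> in at_top. P \<gamma>" if "\<And>\<gamma>. \<gamma> > 0 \<Longrightarrow> P \<gamma>" for P :: "real \<Rightarrow> bool"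
    using eventually_gt_at_top[of 0] by eventually_elim (rule that)
  have s_lim: "(s \<longlongrightarrow> \<kappa> * \<rho> / 6) at_top" and y_lim: "filterlim (\<lambda>\<gamma>. \<gamma> * s \<gamma>) at_top at_top"
    by (rule tendsto_frequency[OF ev ev m]; use freq in blast)+
  have A_lim: "(A \<longlongrightarrow> sqrt (\<kappa> / 2) * (\<rho> / 3)) at_top"
  proof -
    have "sqrt (2 / \<kappa>) * (\<kappa> * \<rho> / 6) = sqrt (\<kappa> / 2) * (\<rho> / 3)"
      using amplitude_eq[OF assms(1), of "\<rho> / 6"] by simp
    from tendsto_mult_left[OF s_lim, of "sqrt (2 / \<kappa>)", unfolded this]
    show ?thesis by (simp only: A_def)
  qed
  have C1_lim: "(C1 \<longlongrightarrow> 0) at_top"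
    unfolding C1_def by (rule tendsto_artanh_0[OF filterlim_compose[OF t_limits(1) y_lim]])
  have C2_lim: "filterlim C2 at_top at_top"
    unfolding C2_def
  proof (rule filterlim_compose[OF artanh_real_at_left_1])
    have "\<forall>\<^sub>F \<gamma> in at_top. t2 1 ((\<gamma> * s \<gamma>)\<^sup>2) \<in> {..<1} \<and> t2 1 ((\<gamma> * s \<gamma>)\<^sup>2) \<noteq> 1"
      using t_bounds(3) freq by (intro ev) (force simp: less_imp_neq)
    then show "filterlim (\<lambda>\<gamma>. t2 1 ((\<gamma> * s \<gamma>)\<^sup>2)) (at_left 1) at_top"
      using filterlim_compose[OF t_limits(2) y_lim] by (simp add: filterlim_at)
  qed
  let ?u = "\<lambda>\<gamma>. glue (sech_profile (A \<gamma>) (s \<gamma>) (C1 \<gamma>)) (\<lambda>_. 0)"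
  let ?p = "\<lambda>\<gamma>. glue (\<lambda>_. 0) (sech_profile (A \<gamma>) (s \<gamma>) (C2 \<gamma>))"
  show ?thesis
  proof (rule tendsto_weakly_in_Q_add_null[where u = ?u and p = ?p])
    show "tendsto_strongly_in_Q ?u (\<lambda>x. indicator {..0} x * sech_profile (sqrt (\<kappa> / 2) * (\<rho> / 3)) (\<kappa> * \<rho> / 6) 0 x) at_top"
    proof (rule tendsto_strongly_in_Q_glue)
      show "\<forall>\<^sub>F \<gamma> in at_top. classical_H1 {..<0} (sech_profile (A \<gamma>) (s \<gamma>) (C1 \<gamma>)) (sech_profile_deriv (A \<gamma>) (s \<gamma>) (C1 \<gamma>))"
        using freq by (intro ev classical_H1_sech_profile) auto
      show "classical_H1 {..<0} (sech_profile (sqrt (\<kappa> / 2) * (\<rho> / 3)) (\<kappa> * \<rho> / 6) 0) (sech_profile_deriv (sqrt (\<kappa> / 2) * (\<rho> / 3)) (\<kappa> * \<rho> / 6) 0)"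
        using m by (intro classical_H1_sech_profile) auto
      show "((\<lambda>\<gamma>. L2_sqnorm {..<0} (\<lambda>x. sech_profile (A \<gamma>) (s \<gamma>) (C1 \<gamma>) x - sech_profile (sqrt (\<kappa> / 2) * (\<rho> / 3)) (\<kappa> * \<rho> / 6) 0 x)) \<longlongrightarrow> 0) at_top"
        "((\<lambda>\<gamma>. L2_sqnorm {..<0} (\<lambda>x. sech_profile_deriv (A \<gamma>) (s \<gamma>) (C1 \<gamma>) x - sech_profile_deriv (sqrt (\<kappa> / 2) * (\<rho> / 3)) (\<kappa> * \<rho> / 6) 0 x)) \<longlongrightarrow> 0) at_top"
        by (intro tendsto_L2_sech_profile A_lim s_lim m C1_lim; simp)+
      show "\<forall>\<^sub>F \<gamma> in at_top. classical_H1 {0<..} (\<lambda>_. 0) (\<lambda>_. 0)" "classical_H1 {0<..} (\<lambda>_. 0) (\<lambda>_. 0)"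
        by (simp_all add: classical_H1_0)
    qed (auto simp: L2_sqnorm_def)
    show "\<forall>\<^sub>F \<gamma> in at_top. ?p \<gamma> \<in> Q"
    proof (rule ev)
      fix \<gamma> :: real assume "\<gamma> > 0"
      then have "s \<gamma> > 0" using freq by blast
      then have "classical_H1 {0<..} (sech_profile (A \<gamma>) (s \<gamma>) (C2 \<gamma>)) (sech_profile_deriv (A \<gamma>) (s \<gamma>) (C2 \<gamma>))"
        by (intro classical_H1_sech_profile) auto
      from Q_norm_classical(1)[OF classical_H1_glue(2,1), OF this classical_H1_0]
      show "?p \<gamma> \<in> Q" .
    qed
    show "((\<lambda>\<gamma>. l (?p \<gamma>)) \<longlongrightarrow> 0) at_top" if "l \<in> Q_dual" for l
      by (rule tendsto_Q_dual_escaping_profile[OF A_lim s_lim m C2_lim that])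
    show "\<forall>\<^sub>F \<gamma> in at_top. phi_plus \<kappa> \<rho> \<gamma> = (\<lambda>x. ?u \<gamma> x + ?p \<gamma> x)"
      using freq by (intro ev) (simp add: glue_def fun_eq_iff)
  qed
qed

text \<open>
  Both phases tend to 0.
\<close>

lemma phi_odd_tendsto:
  fixes \<kappa> \<rho> :: real
  assumes "\<kappa> > 0" and "\<rho> > 0"
  shows "tendsto_strongly_in_Q (\<lambda>\<gamma>. phi_odd \<kappa> \<rho> \<gamma>)
           (\<lambda>x. of_real (sgn x) * sech_profile (sqrt (\<kappa> / 2) * (\<rho> / 2)) (\<kappa> * \<rho> / 4) 0 x) at_top"
proof -
  define s where "s = (\<lambda>\<gamma>. \<kappa> * \<rho> / 4 + 2 / \<gamma>)"
  define A where "A = (\<lambda>\<gamma>. sqrt (2 / \<kappa>) * s \<gamma>)"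
  define C where "C = (\<lambda>\<gamma>. artanh (2 / (\<gamma> * s \<gamma>)))"
  let ?A = "sqrt (\<kappa> / 2) * (\<rho> / 2)" and ?B = "\<kappa> * \<rho> / 4"
  have m: "?B > 0" using assms by simp
  have s_pos: "s \<gamma> > 0" and s_gt: "s \<gamma> > 2 / \<gamma>" if "\<gamma> > 0" for \<gamma>
    using m that by (simp_all add: s_def add_pos_pos)
  have ev: "\<forall>\<^sub>F \<gamma> in at_top. P \<gamma>" if "\<And>\<gamma>. \<gamma> > 0 \<Longrightarrow> P \<gamma>" for P :: "real \<Rightarrow> bool"
    using eventually_gt_at_top[of 0] by eventually_elim (rule that)
  have s_lim: "(s \<longlongrightarrow> ?B) at_top" and y_lim: "filterlim (\<lambda>\<gamma>. \<gamma> * s \<gamma>) at_top at_top"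
    by (rule tendsto_frequency[where a = 2 and b = 2, OF _ _ m]; simp add: s_def)+
  have A_lim: "(A \<longlongrightarrow> ?A) at_top"
  proof -
    have "sqrt (2 / \<kappa>) * (\<kappa> * \<rho> / 4) = sqrt (\<kappa> / 2) * (\<rho> / 2)"
      using amplitude_eq[OF assms(1), of "\<rho> / 4"] by simp
    from tendsto_mult_left[OF s_lim, of "sqrt (2 / \<kappa>)", unfolded this]
    show ?thesis by (simp only: A_def)
  qed
  have C_lim: "(C \<longlongrightarrow> 0) at_top"
    unfolding C_def
    by (rule tendsto_artanh_0[OF tendsto_divide_0[OF tendsto_const filterlim_at_top_imp_at_infinity[OF y_lim]]])
  have nA_lim: "((\<lambda>\<gamma>. - A \<gamma>) \<longlongrightarrow> - ?A) at_top" and nC_lim: "((\<lambda>\<gamma>. - C \<gamma>) \<longlongrightarrow> 0) at_top"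
    using tendsto_minus[OF A_lim] tendsto_minus[OF C_lim] by simp_all
  have "tendsto_strongly_in_Q (\<lambda>\<gamma>. glue (sech_profile (- A \<gamma>) (s \<gamma>) (C \<gamma>)) (sech_profile (A \<gamma>) (s \<gamma>) (- C \<gamma>)))
      (\<lambda>x. of_real (sgn x) * sech_profile ?A ?B 0 x) at_top"
  proof (rule tendsto_strongly_in_Q_glue)
    show "\<forall>\<^sub>F \<gamma> in at_top. classical_H1 {..<0} (sech_profile (- A \<gamma>) (s \<gamma>) (C \<gamma>)) (sech_profile_deriv (- A \<gamma>) (s \<gamma>) (C \<gamma>))"
      "\<forall>\<^sub>F \<gamma> in at_top. classical_H1 {0<..} (sech_profile (A \<gamma>) (s \<gamma>) (- C \<gamma>)) (sech_profile_deriv (A \<gamma>) (s \<gamma>) (- C \<gamma>))"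
      using s_pos by (intro ev classical_H1_sech_profile; simp)+
    show "classical_H1 {..<0} (sech_profile (- ?A) ?B 0) (sech_profile_deriv (- ?A) ?B 0)"
      "classical_H1 {0<..} (sech_profile ?A ?B 0) (sech_profile_deriv ?A ?B 0)"
      using m by (intro classical_H1_sech_profile; simp)+
    show "((\<lambda>\<gamma>. L2_sqnorm {..<0} (\<lambda>x. sech_profile (- A \<gamma>) (s \<gamma>) (C \<gamma>) x - sech_profile (- ?A) ?B 0 x)) \<longlongrightarrow> 0) at_top"
      "((\<lambda>\<gamma>. L2_sqnorm {..<0} (\<lambda>x. sech_profile_deriv (- A \<gamma>) (s \<gamma>) (C \<gamma>) x - sech_profile_deriv (- ?A) ?B 0 x)) \<longlongrightarrow> 0) at_top"
      by (intro tendsto_L2_sech_profile nA_lim s_lim m C_lim; simp)+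
    show "((\<lambda>\<gamma>. L2_sqnorm {0<..} (\<lambda>x. sech_profile (A \<gamma>) (s \<gamma>) (- C \<gamma>) x - sech_profile ?A ?B 0 x)) \<longlongrightarrow> 0) at_top"
      "((\<lambda>\<gamma>. L2_sqnorm {0<..} (\<lambda>x. sech_profile_deriv (A \<gamma>) (s \<gamma>) (- C \<gamma>) x - sech_profile_deriv ?A ?B 0 x)) \<longlongrightarrow> 0) at_top"
      by (intro tendsto_L2_sech_profile A_lim s_lim m nC_lim; simp)+
  qed (auto simp: sech_profile_def)
  moreover have "\<forall>\<^sub>F \<gamma> in at_top. phi_odd \<kappa> \<rho> \<gamma> =
      glue (sech_profile (- A \<gamma>) (s \<gamma>) (C \<gamma>)) (sech_profile (A \<gamma>) (s \<gamma>) (- C \<gamma>))"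
  proof (rule ev)
    fix \<gamma> :: real assume \<gamma>: "\<gamma> > 0"
    show "phi_odd \<kappa> \<rho> \<gamma> = glue (sech_profile (- A \<gamma>) (s \<gamma>) (C \<gamma>)) (sech_profile (A \<gamma>) (s \<gamma>) (- C \<gamma>))"
      using psi_odd_eq_glue[OF \<gamma> s_gt[OF \<gamma>], of \<kappa>]
      unfolding phi_odd_def frequency_odd[OF assms \<gamma>] A_def C_def s_def by simp
  qed
  ultimately show ?thesis by (rule tendsto_strongly_in_Q_cong[rotated])
qed

text \<open>
  The right phase tends to 0. The left soliton is centred far inside the right half-line, and the
  squared norm of its tail on the left half-line is proportional to \<open>1 - \<tau>\<^sub>1\<close>, which tends to 0; that
  of the derivative is at most a bounded multiple of it.
\<close>

lemma phi_asym_tendsto: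
  fixes \<kappa> \<rho> :: real
  assumes "\<kappa> > 0" and "\<rho> > 0"
  shows "tendsto_strongly_in_Q (\<lambda>\<gamma>. phi_asym \<kappa> \<rho> \<gamma>)
           (\<lambda>x. - indicator {0..} x * sech_profile (sqrt (\<kappa> / 2) * \<rho>) (\<kappa> * \<rho> / 2) 0 x) at_top"
proof -
  define s where "s = (\<lambda>\<gamma>. sqrt (THE \<omega>. 8 / \<gamma>\<^sup>2 < \<omega> \<and> L2_sqnorm UNIV (psi_asym \<kappa> \<gamma> \<omega>) = \<rho>))"
  define A where "A = (\<lambda>\<gamma>. sqrt (2 / \<kappa>) * s \<gamma>)"
  define \<tau>1 where "\<tau>1 = (\<lambda>\<gamma>. tau1 1 ((\<gamma> * s \<gamma>)\<^sup>2))"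
  define C1 where "C1 = (\<lambda>\<gamma>. artanh (\<tau>1 \<gamma>))"
  define C2 where "C2 = (\<lambda>\<gamma>. artanh (tau2 1 ((\<gamma> * s \<gamma>)\<^sup>2)))"
  let ?A = "sqrt (\<kappa> / 2) * \<rho>" and ?B = "\<kappa> * \<rho> / 2"
  have m: "?B > 0" using assms by simp
  have freq: "s \<gamma> > 0 \<and> ?B + 1 * (1 / \<gamma>) \<le> s \<gamma> \<and> s \<gamma> \<le> ?B + 2 * (1 / \<gamma>) \<and> tanh (C1 \<gamma>) = \<tau>1 \<gamma> \<and>
      phi_asym \<kappa> \<rho> \<gamma> = glue (sech_profile (A \<gamma>) (s \<gamma>) (C1 \<gamma>)) (sech_profile (- A \<gamma>) (s \<gamma>) (- C2 \<gamma>))"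
    if \<gamma>: "\<gamma> > 6 / (\<kappa> * \<rho>)" for \<gamma>
  proof -
    have "6 / (\<kappa> * \<rho>) > 0" using assms by simp
    then have pos: "\<gamma> > 0" using \<gamma> by linarith
    have "6 < \<gamma> * (\<kappa> * \<rho>)" using \<gamma> assms by (simp only: pos_divide_less_eq mult_pos_pos)
    moreover have "?B * \<gamma> = \<gamma> * (\<kappa> * \<rho>) / 2" by simp
    ultimately have "3 < ?B * \<gamma>" by linarith
    then have "3 / \<gamma> < ?B" using pos by (simp only: pos_divide_less_eq)
    from frequency_asym[OF assms pos this] obtain r where r: "r > sqrt 8 / \<gamma>" "(THE \<omega>. 8 / \<gamma>\<^sup>2 < \<omega> \<and> L2_sqnorm UNIV (psi_asym \<kappa> \<gamma> \<omega>) = \<rho>) = r\<^sup>2"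
      "?B + 1 / \<gamma> \<le> r" "r \<le> ?B + 2 * (1 / \<gamma>)"
      by blast
    have "sqrt 8 / \<gamma> > 0" using pos by simp
    then have r_pos: "r > 0" using r(1) by linarith
    have s: "s \<gamma> = r" using r_pos by (simp add: s_def r(2))
    have "(\<gamma> * r)\<^sup>2 > 8" by (rule sqrt_less_imp_less_power2) (use r(1) pos in \<open>simp add: divide_less_eq mult.commute\<close>)
    then have "0 < \<tau>1 \<gamma>" "\<tau>1 \<gamma> < 1"
      using tau_bounds(2,4)[of "\<gamma> * r"] pos r_pos by (simp_all add: \<tau>1_def s)
    then have "tanh (C1 \<gamma>) = \<tau>1 \<gamma>" unfolding C1_def by (intro tanh_artanh) simp
    moreover have "phi_asym \<kappa> \<rho> \<gamma> = psi_asym \<kappa> \<gamma> (r\<^sup>2)" by (simp add: phi_asym_def r(2))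
    ultimately show ?thesis
      using r r_pos by (simp add: psi_asym_eq_glue[OF pos r_pos] A_def \<tau>1_def C1_def C2_def s)
  qed
  have ev: "\<forall>\<^sub>F \<gamma> in at_top. P \<gamma>" if "\<And>\<gamma>. \<gamma> > 6 / (\<kappa> * \<rho>) \<Longrightarrow> P \<gamma>" for P :: "real \<Rightarrow> bool"
    using eventually_gt_at_top[of "6 / (\<kappa> * \<rho>)"] by eventually_elim (rule that)
  have s_lim: "(s \<longlongrightarrow> ?B) at_top" and y_lim: "filterlim (\<lambda>\<gamma>. \<gamma> * s \<gamma>) at_top at_top"
    by (rule tendsto_frequency[OF ev ev m]; use freq in blast)+
  have A_lim: "(A \<longlongrightarrow> ?A) at_top"
  proof -
    have "sqrt (2 / \<kappa>) * (\<kappa> * \<rho> / 2) = sqrt (\<kappa> / 2) * (\<rho>)"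
      using amplitude_eq[OF assms(1), of "\<rho> / 2"] by simp
    from tendsto_mult_left[OF s_lim, of "sqrt (2 / \<kappa>)", unfolded this]
    show ?thesis by (simp only: A_def)
  qed
  have \<tau>1_lim: "(\<tau>1 \<longlongrightarrow> 1) at_top"
    unfolding \<tau>1_def by (rule filterlim_compose[OF t_limits(3) y_lim])
  have "(C2 \<longlongrightarrow> 0) at_top"
    unfolding C2_def by (rule tendsto_artanh_0[OF filterlim_compose[OF t_limits(4) y_lim]])
  then have C2_lim: "((\<lambda>\<gamma>. - C2 \<gamma>) \<longlongrightarrow> 0) at_top" using tendsto_minus by fastforce
  have nA_lim: "((\<lambda>\<gamma>. - A \<gamma>) \<longlongrightarrow> - ?A) at_top" by (rule tendsto_minus[OF A_lim])
  have left: "((\<lambda>\<gamma>. L2_sqnorm {..<0} (sech_profile (A \<gamma>) (s \<gamma>) (C1 \<gamma>))) \<longlongrightarrow> 0) at_top"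
  proof (rule Lim_null_comparison)
    show "\<forall>\<^sub>F \<gamma> in at_top. norm (L2_sqnorm {..<0} (sech_profile (A \<gamma>) (s \<gamma>) (C1 \<gamma>))) \<le> (A \<gamma>)\<^sup>2 * (1 - \<tau>1 \<gamma>) / s \<gamma>"
    proof (rule ev)
      fix \<gamma> assume "\<gamma> > 6 / (\<kappa> * \<rho>)"
      then have "s \<gamma> > 0" "tanh (C1 \<gamma>) = \<tau>1 \<gamma>" using freq by blast+
      then show "norm (L2_sqnorm {..<0} (sech_profile (A \<gamma>) (s \<gamma>) (C1 \<gamma>))) \<le> (A \<gamma>)\<^sup>2 * (1 - \<tau>1 \<gamma>) / s \<gamma>"
        using L2_sqnorm_sech_profile(2)[of "s \<gamma>" "A \<gamma>" "C1 \<gamma>"] L2_sqnorm_nonneg[of "{..<0}" "sech_profile (A \<gamma>) (s \<gamma>) (C1 \<gamma>)"] by simp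
    qed
    have "((\<lambda>\<gamma>. (A \<gamma>)\<^sup>2 * (1 - \<tau>1 \<gamma>) / s \<gamma>) \<longlongrightarrow> ?A\<^sup>2 * (1 - 1) / ?B) at_top"
      using assms by (intro tendsto_intros A_lim \<tau>1_lim s_lim) simp
    then show "((\<lambda>\<gamma>. (A \<gamma>)\<^sup>2 * (1 - \<tau>1 \<gamma>) / s \<gamma>) \<longlongrightarrow> 0) at_top" by simp
  qed
  have left': "((\<lambda>\<gamma>. L2_sqnorm {..<0} (sech_profile_deriv (A \<gamma>) (s \<gamma>) (C1 \<gamma>))) \<longlongrightarrow> 0) at_top"
  proof (rule Lim_null_comparison)
    show "\<forall>\<^sub>F \<gamma> in at_top. norm (L2_sqnorm {..<0} (sech_profile_deriv (A \<gamma>) (s \<gamma>) (C1 \<gamma>))) \<le> (A \<gamma> * s \<gamma>)\<^sup>2 * (1 - \<tau>1 \<gamma>) / s \<gamma>"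
    proof (rule ev)
      fix \<gamma> assume "\<gamma> > 6 / (\<kappa> * \<rho>)"
      then have "s \<gamma> > 0" "tanh (C1 \<gamma>) = \<tau>1 \<gamma>" using freq by blast+
      then show "norm (L2_sqnorm {..<0} (sech_profile_deriv (A \<gamma>) (s \<gamma>) (C1 \<gamma>))) \<le> (A \<gamma> * s \<gamma>)\<^sup>2 * (1 - \<tau>1 \<gamma>) / s \<gamma>"
        using L2_sqnorm_sech_profile(4)[of "s \<gamma>" "A \<gamma>" "C1 \<gamma>"] L2_sqnorm_nonneg[of "{..<0}" "sech_profile_deriv (A \<gamma>) (s \<gamma>) (C1 \<gamma>)"] by simp
    qed
    have "((\<lambda>\<gamma>. (A \<gamma> * s \<gamma>)\<^sup>2 * (1 - \<tau>1 \<gamma>) / s \<gamma>) \<longlongrightarrow> (?A * ?B)\<^sup>2 * (1 - 1) / ?B) at_top"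
      using assms by (intro tendsto_intros A_lim \<tau>1_lim s_lim) simp
    then show "((\<lambda>\<gamma>. (A \<gamma> * s \<gamma>)\<^sup>2 * (1 - \<tau>1 \<gamma>) / s \<gamma>) \<longlongrightarrow> 0) at_top" by simp
  qed
  have "tendsto_strongly_in_Q (\<lambda>\<gamma>. glue (sech_profile (A \<gamma>) (s \<gamma>) (C1 \<gamma>)) (sech_profile (- A \<gamma>) (s \<gamma>) (- C2 \<gamma>)))
      (\<lambda>x. - indicator {0..} x * sech_profile ?A ?B 0 x) at_top"
  proof (rule tendsto_strongly_in_Q_glue)
    show "\<forall>\<^sub>F \<gamma> in at_top. classical_H1 {..<0} (sech_profile (A \<gamma>) (s \<gamma>) (C1 \<gamma>)) (sech_profile_deriv (A \<gamma>) (s \<gamma>) (C1 \<gamma>))"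
      "\<forall>\<^sub>F \<gamma> in at_top. classical_H1 {0<..} (sech_profile (- A \<gamma>) (s \<gamma>) (- C2 \<gamma>)) (sech_profile_deriv (- A \<gamma>) (s \<gamma>) (- C2 \<gamma>))"
      using freq by (intro ev classical_H1_sech_profile; simp)+
    show "classical_H1 {..<0} (\<lambda>_. 0) (\<lambda>_. 0)" by (rule classical_H1_0)
    show "classical_H1 {0<..} (sech_profile (- ?A) ?B 0) (sech_profile_deriv (- ?A) ?B 0)"
      using m by (intro classical_H1_sech_profile) auto
    show "((\<lambda>\<gamma>. L2_sqnorm {0<..} (\<lambda>x. sech_profile (- A \<gamma>) (s \<gamma>) (- C2 \<gamma>) x - sech_profile (- ?A) ?B 0 x)) \<longlongrightarrow> 0) at_top"
      "((\<lambda>\<gamma>. L2_sqnorm {0<..} (\<lambda>x. sech_profile_deriv (- A \<gamma>) (s \<gamma>) (- C2 \<gamma>) x - sech_profile_deriv (- ?A) ?B 0 x)) \<longlongrightarrow> 0) at_top"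
      by (intro tendsto_L2_sech_profile nA_lim s_lim m C2_lim; simp)+
  qed (use left left' in \<open>auto simp: sech_profile_def\<close>)
  moreover have "\<forall>\<^sub>F \<gamma> in at_top. phi_asym \<kappa> \<rho> \<gamma> =
      glue (sech_profile (A \<gamma>) (s \<gamma>) (C1 \<gamma>)) (sech_profile (- A \<gamma>) (s \<gamma>) (- C2 \<gamma>))"
    by (rule ev) (use freq in blast)
  ultimately show ?thesis by (rule tendsto_strongly_in_Q_cong[rotated])
qed

theorem theorem3p16:
  fixes \<kappa> \<rho> :: real
  assumes "\<kappa> > 0" and "\<rho> > 0"
  shows "tendsto_weakly_in_Q (\<lambda>\<gamma>. phi_plus \<kappa> \<rho> \<gamma>)
           (\<lambda>x. indicator {..0} x * sech_profile (sqrt (\<kappa> / 2) * (\<rho> / 3)) (\<kappa> * \<rho> / 6) 0 x) at_top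
       \<and> tendsto_strongly_in_Q (\<lambda>\<gamma>. phi_odd \<kappa> \<rho> \<gamma>)
           (\<lambda>x. of_real (sgn x) * sech_profile (sqrt (\<kappa> / 2) * (\<rho> / 2)) (\<kappa> * \<rho> / 4) 0 x) at_top
       \<and> tendsto_strongly_in_Q (\<lambda>\<gamma>. phi_asym \<kappa> \<rho> \<gamma>)
           (\<lambda>x. - indicator {0..} x * sech_profile (sqrt (\<kappa> / 2) * \<rho>) (\<kappa> * \<rho> / 2) 0 x) at_top"
  using phi_plus_tendsto[OF assms] phi_odd_tendsto[OF assms] phi_asym_tendsto[OF assms] by blast

end
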